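(* Let $(M,\phi_\alpha,\xi_\alpha,\eta_\alpha,g)$, $\alpha\in\{1,2,3\}$, be a connected $3$-quasi-Sasakian manifold of dimension $4n+3$, and let $c\in\mathbb{R}$ be the constant such that $[\xi_\alpha,\xi_\beta]=c\,\xi_\gamma$ for every even permutation $(\alpha,\beta,\gamma)$ of $\{1,2,3\}$. Then the $1$-forms $\eta_1,\eta_2,\eta_3$ have the same rank, and, for some integer $l$ with $0\le l\leq n$, this common rank is $4l+3$ if $c\neq 0$, and $4l+1$ if $c=0$.
   Context: All manifolds are smooth and connected. Convention: $2u\wedge v=u\otimes v-v\otimes u$, so for a $1$-form $\eta$, $2d\eta(X,Y)=X(\eta(Y))-Y(\eta(X))-\eta([X,Y])$. An almost contact structure on an odd-dimensional manifold $M$ is a triple $(\phi,\xi,\eta)$ of a $(1,1)$-tensor field, a vector field (the Reeb vector field) and a $1$-form with $\phi^2=-I+\eta\otimes\xi$ and $\eta(\xi)=1$ (hence $\phi\xi=0$, $\eta\circ\phi=0$). It is normal if $N^{(1)}:=[\phi,\phi]+2d\eta\otimes\xi=0$, where $[\phi,\phi](X,Y)=\phi^2[X,Y]+[\phi X,\phi Y]-\phi[\phi X,Y]-\phi[X,\phi Y]$. A Riemannian metric $g$ is compatible if $g(\phi X,\phi Y)=g(X,Y)-\eta(X)\eta(Y)$; the fundamental $2$-form is $\Phi(X,Y)=g(X,\phi Y)$. An almost $3$-contact metric manifold is a $(4n+3)$-dimensional manifold $M$ with three almost contact structures $(\phi_\alpha,\xi_\alpha,\eta_\alpha)$, $\alpha\in\{1,2,3\}$,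 and a Riemannian metric $g$ compatible with each of them, such that for every even permutation $(\alpha,\beta,\gamma)$ of $\{1,2,3\}$: $\phi_\gamma=\phi_\alpha\phi_\beta-\eta_\beta\otimes\xi_\alpha=-\phi_\beta\phi_\alpha+\eta_\alpha\otimes\xi_\beta$, $\xi_\gamma=\phi_\alpha\xi_\beta=-\phi_\beta\xi_\alpha$, $\eta_\gamma=\eta_\alpha\circ\phi_\beta=-\eta_\beta\circ\phi_\alpha$. It is hyper-normal if each of the three almost contact structures is normal. A $3$-quasi-Sasakian manifold is a hyper-normal almost $3$-contact metric manifold such that each fundamental $2$-form $\Phi_\alpha(X,Y)=g(X,\phi_\alpha Y)$ is closed. On a connected $3$-quasi-Sasakian manifold it is known that there is a (unique) real constant $c$ with $[\xi_\alpha,\xi_\beta]=c\,\xi_\gamma$ for every even permutation $(\alpha,\beta,\gamma)$ of $\{1,2,3\}$. Rank of a $1$-form $\eta$ on $M$: $\eta$ has rank $2p$ if $(d\eta)^p\neq 0$ and $\eta\wedge(d\eta)^p=0$ on $M$ (at every point), and rank $2p+1$ if $\eta\wedge(d\eta)^p\neq 0$ and $(d\eta)^{p+1}=0$ on $M$ (at every point). *)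

theory Defs
  imports "HOL-Analysis.Analysis" "HOL-Combinatorics.Permutations"
begin

subsection \<open>Smooth manifolds\<close>

text \<open>On an open set \<open>S\<close>, \<open>Ck_on k f S\<close> says that \<open>f\<close> has continuous iterated directional
  derivatives up to order \<open>k\<close>.\<close>

fun Ck_on :: "nat \<Rightarrow> ('a::euclidean_space \<Rightarrow> 'b::real_normed_vector) \<Rightarrow> 'a set \<Rightarrow> bool" where
  "Ck_on 0 f S = continuous_on S f"
| "Ck_on (Suc k) f S =
    (f differentiable_on S \<and> (\<forall>v. Ck_on k (\<lambda>x. frechet_derivative f (at x) v) S))"

definition smooth_on :: "'a::euclidean_space set \<Rightarrow> ('a \<Rightarrow> 'b::real_normed_vector) \<Rightarrow> bool" where
  "smooth_on S f \<longleftrightarrow> (\<forall>k. Ck_on k f S)"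

text \<open>The manifold is the type \<open>'m\<close>, modelled on the Euclidean space \<open>'e\<close>, so its dimension is
  \<open>DIM('e)\<close>. A chart is a pair of a domain and a coordinate map; the values of the coordinate map
  outside the domain are irrelevant.\<close>

type_synonym ('m, 'e) chart = "'m set \<times> ('m \<Rightarrow> 'e)"

definition smooth_manifold ::
  "('m::{t2_space, second_countable_topology}, 'e::euclidean_space) chart set \<Rightarrow> bool" where
  "smooth_manifold A \<longleftrightarrow>
    (\<Union>(U, \<kappa>)\<in>A. U) = UNIV \<and>
    (\<forall>(U, \<kappa>)\<in>A. open U \<and> open (\<kappa> ` U) \<and> homeomorphism U (\<kappa> ` U) \<kappa> (inv_into U \<kappa>)) \<and>
    (\<forall>(U, \<kappa>)\<in>A. \<forall>(V, \<mu>)\<in>A. smooth_on (\<kappa> ` (U \<inter> V)) (\<mu> \<circ> inv_into U \<kappa>))"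

definition smooth_funs :: "('m, 'e::euclidean_space) chart set \<Rightarrow> ('m \<Rightarrow> real) set" where
  "smooth_funs A = {f. \<forall>(U, \<kappa>)\<in>A. smooth_on (\<kappa> ` U) (f \<circ> inv_into U \<kappa>)}"

text \<open>Tangent vectors at \<open>p\<close> are the derivations at \<open>p\<close> of the algebra of smooth functions. They are
  set to \<open>0\<close> on non-smooth functions, so that HOL equality is equality of tangent vectors.\<close>

type_synonym 'm tvec = "('m \<Rightarrow> real) \<Rightarrow> real"

definition lincomb :: "real \<Rightarrow> 'm tvec \<Rightarrow> real \<Rightarrow> 'm tvec \<Rightarrow> 'm tvec" where
  "lincomb a u b v = (\<lambda>f. a * u f + b * v f)"

definition tangent_space :: "('m, 'e::euclidean_space) chart set \<Rightarrow> 'm \<Rightarrow> 'm tvec set" where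
  "tangent_space A p = {v.
    (\<forall>f\<in>smooth_funs A. \<forall>g\<in>smooth_funs A. \<forall>a b.
       v (\<lambda>x. a * f x + b * g x) = a * v f + b * v g) \<and>
    (\<forall>f\<in>smooth_funs A. \<forall>g\<in>smooth_funs A. v (\<lambda>x. f x * g x) = f p * v g + g p * v f) \<and>
    (\<forall>f. f \<notin> smooth_funs A \<longrightarrow> v f = 0)}"

type_synonym 'm vfield = "'m \<Rightarrow> 'm tvec"

definition vector_fields :: "('m, 'e::euclidean_space) chart set \<Rightarrow> 'm vfield set" where
  "vector_fields A = {X. (\<forall>p. X p \<in> tangent_space A p) \<and>
    (\<forall>f\<in>smooth_funs A. (\<lambda>p. X p f) \<in> smooth_funs A)}"

definition lie_bracket :: "'m vfield \<Rightarrow> 'm vfield \<Rightarrow> 'm vfield" where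
  "lie_bracket X Y = (\<lambda>p f. X p (\<lambda>q. Y q f) - Y p (\<lambda>q. X q f))"

subsection \<open>Tensor fields\<close>

text \<open>Tensor fields are given pointwise on tangent spaces, and are smooth if they take smooth vector
  fields to smooth functions or vector fields. Their values off the tangent spaces are irrelevant.\<close>

type_synonym 'm oneform = "'m \<Rightarrow> 'm tvec \<Rightarrow> real"
type_synonym 'm tensor11 = "'m \<Rightarrow> 'm tvec \<Rightarrow> 'm tvec"
type_synonym 'm tensor02 = "'m \<Rightarrow> 'm tvec \<Rightarrow> 'm tvec \<Rightarrow> real"

definition one_forms :: "('m, 'e::euclidean_space) chart set \<Rightarrow> 'm oneform set" where
  "one_forms A = {\<eta>.
    (\<forall>p. \<forall>u\<in>tangent_space A p. \<forall>v\<in>tangent_space A p. \<forall>a b.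
       \<eta> p (lincomb a u b v) = a * \<eta> p u + b * \<eta> p v) \<and>
    (\<forall>X\<in>vector_fields A. (\<lambda>p. \<eta> p (X p)) \<in> smooth_funs A)}"

definition tensors11 :: "('m, 'e::euclidean_space) chart set \<Rightarrow> 'm tensor11 set" where
  "tensors11 A = {\<phi>.
    (\<forall>p. \<forall>u\<in>tangent_space A p. \<phi> p u \<in> tangent_space A p) \<and>
    (\<forall>p. \<forall>u\<in>tangent_space A p. \<forall>v\<in>tangent_space A p. \<forall>a b.
       \<phi> p (lincomb a u b v) = lincomb a (\<phi> p u) b (\<phi> p v)) \<and>
    (\<forall>X\<in>vector_fields A. (\<lambda>p. \<phi> p (X p)) \<in> vector_fields A)}"

definition riemannian_metric :: "('m, 'e::euclidean_space) chart set \<Rightarrow> 'm tensor02 \<Rightarrow> bool" where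
  "riemannian_metric A g \<longleftrightarrow>
    (\<forall>p. \<forall>u\<in>tangent_space A p. \<forall>v\<in>tangent_space A p. g p u v = g p v u) \<and>
    (\<forall>p. \<forall>u\<in>tangent_space A p. \<forall>v\<in>tangent_space A p. \<forall>w\<in>tangent_space A p. \<forall>a b.
       g p (lincomb a u b v) w = a * g p u w + b * g p v w) \<and>
    (\<forall>p. \<forall>u\<in>tangent_space A p. u \<noteq> (\<lambda>f. 0) \<longrightarrow> 0 < g p u u) \<and>
    (\<forall>X\<in>vector_fields A. \<forall>Y\<in>vector_fields A. (\<lambda>p. g p (X p) (Y p)) \<in> smooth_funs A)"

subsection \<open>Exterior calculus and rank\<close>

text \<open>Convention: \<open>2 u \<and> v = u \<otimes> v - v \<otimes> u\<close>, i.e. the wedge product is the full antisymmetrisation of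
  the tensor product; whence the factors \<open>1/2\<close> and \<open>1/3\<close> in the invariant formulas for \<open>d\<close>.\<close>

definition d1 :: "'m oneform \<Rightarrow> 'm vfield \<Rightarrow> 'm vfield \<Rightarrow> 'm \<Rightarrow> real" where
  "d1 \<eta> X Y p = 1/2 * (X p (\<lambda>q. \<eta> q (Y q)) - Y p (\<lambda>q. \<eta> q (X q)) - \<eta> p (lie_bracket X Y p))"

definition d2 :: "'m tensor02 \<Rightarrow> 'm vfield \<Rightarrow> 'm vfield \<Rightarrow> 'm vfield \<Rightarrow> 'm \<Rightarrow> real" where
  "d2 \<Omega> X Y Z p = 1/3 *
    (X p (\<lambda>q. \<Omega> q (Y q) (Z q)) + Y p (\<lambda>q. \<Omega> q (Z q) (X q)) + Z p (\<lambda>q. \<Omega> q (X q) (Y q))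
     - \<Omega> p (lie_bracket X Y p) (Z p) - \<Omega> p (lie_bracket Y Z p) (X p)
     - \<Omega> p (lie_bracket Z X p) (Y p))"

definition closed2 :: "('m, 'e::euclidean_space) chart set \<Rightarrow> 'm tensor02 \<Rightarrow> bool" where
  "closed2 A \<Omega> \<longleftrightarrow> (\<forall>X\<in>vector_fields A. \<forall>Y\<in>vector_fields A. \<forall>Z\<in>vector_fields A.
     \<forall>p. d2 \<Omega> X Y Z p = 0)"

text \<open>A differential form of degree \<open>k\<close> is regarded as a multilinear map on vector fields; its
  arguments are the first \<open>k\<close> members of the sequence.\<close>

type_synonym 'm form = "(nat \<Rightarrow> 'm vfield) \<Rightarrow> 'm \<Rightarrow> real"

definition form_of_oneform :: "'m oneform \<Rightarrow> 'm form" where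
  "form_of_oneform \<eta> = (\<lambda>X p. \<eta> p (X 0 p))"

definition ext_d :: "'m oneform \<Rightarrow> 'm form" where
  "ext_d \<eta> = (\<lambda>X. d1 \<eta> (X 0) (X 1))"

text \<open>\<open>wedge k l \<omega> \<theta>\<close> is the product of a \<open>k\<close>-form and an \<open>l\<close>-form.\<close>

definition wedge :: "nat \<Rightarrow> nat \<Rightarrow> 'm form \<Rightarrow> 'm form \<Rightarrow> 'm form" where
  "wedge k l \<omega> \<theta> = (\<lambda>X p. 1 / fact (k + l) *
    (\<Sum>\<sigma> | \<sigma> permutes {..<k + l}.
       of_int (sign \<sigma>) * \<omega> (\<lambda>i. X (\<sigma> i)) p * \<theta> (\<lambda>i. X (\<sigma> (k + i))) p))"

text \<open>Powers of a \<open>2\<close>-form.\<close>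

fun wedge_power :: "'m form \<Rightarrow> nat \<Rightarrow> 'm form" where
  "wedge_power \<omega> 0 = (\<lambda>X p. 1)"
| "wedge_power \<omega> (Suc n) = wedge 2 (2 * n) \<omega> (wedge_power \<omega> n)"

text \<open>Since every tangent vector extends to a global vector field, a form is zero at a point iff it
  vanishes there on all vector fields.\<close>

definition form_zero_at :: "('m, 'e::euclidean_space) chart set \<Rightarrow> 'm form \<Rightarrow> 'm \<Rightarrow> bool" where
  "form_zero_at A \<omega> p \<longleftrightarrow> (\<forall>X. (\<forall>i. X i \<in> vector_fields A) \<longrightarrow> \<omega> X p = 0)"

definition has_rank :: "('m, 'e::euclidean_space) chart set \<Rightarrow> 'm oneform \<Rightarrow> nat \<Rightarrow> bool" where
  "has_rank A \<eta> r \<longleftrightarrow>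
    (\<exists>p. r = 2 * p \<and>
      (\<forall>x. \<not> form_zero_at A (wedge_power (ext_d \<eta>) p) x \<and>
           form_zero_at A (wedge 1 (2 * p) (form_of_oneform \<eta>) (wedge_power (ext_d \<eta>) p)) x)) \<or>
    (\<exists>p. r = 2 * p + 1 \<and>
      (\<forall>x. \<not> form_zero_at A (wedge 1 (2 * p) (form_of_oneform \<eta>) (wedge_power (ext_d \<eta>) p)) x \<and>
           form_zero_at A (wedge_power (ext_d \<eta>) (p + 1)) x))"

subsection \<open>3-quasi-Sasakian manifolds\<close>

definition almost_contact ::
  "('m, 'e::euclidean_space) chart set \<Rightarrow> 'm tensor11 \<Rightarrow> 'm vfield \<Rightarrow> 'm oneform \<Rightarrow> bool" where
  "almost_contact A \<phi> \<xi> \<eta> \<longleftrightarrow>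
    odd DIM('e) \<and> \<phi> \<in> tensors11 A \<and> \<xi> \<in> vector_fields A \<and> \<eta> \<in> one_forms A \<and>
    (\<forall>p. \<forall>u\<in>tangent_space A p. \<phi> p (\<phi> p u) = lincomb (-1) u (\<eta> p u) (\<xi> p)) \<and>
    (\<forall>p. \<eta> p (\<xi> p) = 1)"

definition nijenhuis :: "'m tensor11 \<Rightarrow> 'm vfield \<Rightarrow> 'm vfield \<Rightarrow> 'm vfield" where
  "nijenhuis \<phi> X Y = (\<lambda>p f.
     \<phi> p (\<phi> p (lie_bracket X Y p)) f
     + lie_bracket (\<lambda>q. \<phi> q (X q)) (\<lambda>q. \<phi> q (Y q)) p f
     - \<phi> p (lie_bracket (\<lambda>q. \<phi> q (X q)) Y p) f
     - \<phi> p (lie_bracket X (\<lambda>q. \<phi> q (Y q)) p) f)"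

definition normal_structure ::
  "('m, 'e::euclidean_space) chart set \<Rightarrow> 'm tensor11 \<Rightarrow> 'm vfield \<Rightarrow> 'm oneform \<Rightarrow> bool" where
  "normal_structure A \<phi> \<xi> \<eta> \<longleftrightarrow> (\<forall>X\<in>vector_fields A. \<forall>Y\<in>vector_fields A. \<forall>p.
     lincomb 1 (nijenhuis \<phi> X Y p) (2 * d1 \<eta> X Y p) (\<xi> p) = (\<lambda>f. 0))"

definition compatible_metric ::
  "('m, 'e::euclidean_space) chart set \<Rightarrow> 'm tensor11 \<Rightarrow> 'm oneform \<Rightarrow> 'm tensor02 \<Rightarrow> bool" where
  "compatible_metric A \<phi> \<eta> g \<longleftrightarrow> (\<forall>p. \<forall>u\<in>tangent_space A p. \<forall>v\<in>tangent_space A p.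
     g p (\<phi> p u) (\<phi> p v) = g p u v - \<eta> p u * \<eta> p v)"

definition fundamental_form :: "'m tensor11 \<Rightarrow> 'm tensor02 \<Rightarrow> 'm tensor02" where
  "fundamental_form \<phi> g = (\<lambda>p u v. g p u (\<phi> p v))"

text \<open>The even permutations of \<open>(1, 2, 3)\<close>. Only the indices \<open>1\<close>, \<open>2\<close>, \<open>3\<close> of the families below are
  meaningful.\<close>

definition even_perms3 :: "(nat \<times> nat \<times> nat) set" where
  "even_perms3 = {(1, 2, 3), (2, 3, 1), (3, 1, 2)}"

definition almost_3_contact_metric ::
  "('m::{t2_space, second_countable_topology}, 'e::euclidean_space) chart set \<Rightarrow>
   (nat \<Rightarrow> 'm tensor11) \<Rightarrow> (nat \<Rightarrow> 'm vfield) \<Rightarrow> (nat \<Rightarrow> 'm oneform) \<Rightarrow> 'm tensor02 \<Rightarrow> bool" where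
  "almost_3_contact_metric A \<phi> \<xi> \<eta> g \<longleftrightarrow>
    smooth_manifold A \<and> (\<exists>n. DIM('e) = 4 * n + 3) \<and> riemannian_metric A g \<and>
    (\<forall>\<alpha>\<in>{1, 2, 3}. almost_contact A (\<phi> \<alpha>) (\<xi> \<alpha>) (\<eta> \<alpha>) \<and> compatible_metric A (\<phi> \<alpha>) (\<eta> \<alpha>) g) \<and>
    (\<forall>(\<alpha>, \<beta>, \<gamma>)\<in>even_perms3. \<forall>p.
       (\<forall>u\<in>tangent_space A p.
          \<phi> \<gamma> p u = lincomb 1 (\<phi> \<alpha> p (\<phi> \<beta> p u)) (- \<eta> \<beta> p u) (\<xi> \<alpha> p) \<and>
          \<phi> \<gamma> p u = lincomb (-1) (\<phi> \<beta> p (\<phi> \<alpha> p u)) (\<eta> \<alpha> p u) (\<xi> \<beta> p) \<and>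
          \<eta> \<gamma> p u = \<eta> \<alpha> p (\<phi> \<beta> p u) \<and>
          \<eta> \<gamma> p u = - \<eta> \<beta> p (\<phi> \<alpha> p u)) \<and>
       \<xi> \<gamma> p = \<phi> \<alpha> p (\<xi> \<beta> p) \<and>
       \<xi> \<gamma> p = (\<lambda>f. - \<phi> \<beta> p (\<xi> \<alpha> p) f))"

definition hyper_normal ::
  "('m, 'e::euclidean_space) chart set \<Rightarrow>
   (nat \<Rightarrow> 'm tensor11) \<Rightarrow> (nat \<Rightarrow> 'm vfield) \<Rightarrow> (nat \<Rightarrow> 'm oneform) \<Rightarrow> bool" where
  "hyper_normal A \<phi> \<xi> \<eta> \<longleftrightarrow> (\<forall>\<alpha>\<in>{1, 2, 3}. normal_structure A (\<phi> \<alpha>) (\<xi> \<alpha>) (\<eta> \<alpha>))"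

definition three_quasi_sasakian ::
  "('m::{t2_space, second_countable_topology}, 'e::euclidean_space) chart set \<Rightarrow>
   (nat \<Rightarrow> 'm tensor11) \<Rightarrow> (nat \<Rightarrow> 'm vfield) \<Rightarrow> (nat \<Rightarrow> 'm oneform) \<Rightarrow> 'm tensor02 \<Rightarrow> bool" where
  "three_quasi_sasakian A \<phi> \<xi> \<eta> g \<longleftrightarrow>
    almost_3_contact_metric A \<phi> \<xi> \<eta> g \<and> hyper_normal A \<phi> \<xi> \<eta> \<and>
    (\<forall>\<alpha>\<in>{1, 2, 3}. closed2 A (fundamental_form (\<phi> \<alpha>) g))"

end

theory Submission
  imports Defs "HOL-Library.Function_Algebras"
begin

text \<open>Let \<open>(\<alpha>, \<beta>, \<gamma>)\<close> be an even permutation. Normality and \<open>d\<Phi> = 0\<close> make each \<open>\<xi>\<^sub>\<alpha>\<close> Killing and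
  preserve \<open>\<phi>\<^sub>\<alpha>\<close>, and Cartan's formula turns \<open>L\<close> along \<open>\<xi>\<^sub>\<alpha>\<close> of \<open>\<Phi>\<^sub>\<beta>\<close> into \<open>2 d\<eta>\<^sub>\<gamma>\<close>. Hence
  \<open>2 d\<eta>\<^sub>\<gamma> (X, Y) = g (X, B\<^sub>\<gamma> Y)\<close> where \<open>B\<^sub>\<gamma>\<close> is the Lie derivative of \<open>\<phi>\<^sub>\<beta>\<close> along \<open>\<xi>\<^sub>\<alpha>\<close>.
  Differentiating the quaternionic relations once and twice along the Reeb fields shows that on the
  horizontal distribution \<open>A = - B\<^sub>\<gamma> \<phi>\<^sub>\<gamma>\<close> does not depend on \<open>\<gamma>\<close>, is symmetric, commutes with the
  \<open>\<phi>\<close>'s and satisfies \<open>A\<^sup>2 = c A\<close>. If \<open>c = 0\<close> then \<open>A = 0\<close> and \<open>d\<eta>\<^sub>\<gamma> = 0\<close>. Otherwise the horizontal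
  space splits orthogonally into quaternionic subspaces, \<open>W\<close> of dimension \<open>4 l\<close> with \<open>B\<^sub>\<gamma> = c \<phi>\<^sub>\<gamma>\<close>, and
  \<open>K\<close> of dimension \<open>4 (n - l)\<close> with \<open>B\<^sub>\<gamma> = 0\<close>; together with \<open>\<xi>\<^sub>\<alpha>, \<xi>\<^sub>\<beta>\<close> this gives \<open>d\<eta>\<^sub>\<gamma>\<close> the rank
  \<open>4 l + 2\<close>. The form \<open>\<Phi>\<^sub>\<gamma> - (2 / c) d\<eta>\<^sub>\<gamma>\<close> has rank \<open>4 (n - l)\<close>, so both \<open>l\<close> and \<open>n - l\<close> are lower
  semicontinuous, and \<open>l\<close> is constant by connectedness.\<close>

subsection \<open>Smooth functions on Euclidean spaces\<close>

text \<open>Forms are tested on global vector fields, so a bridge to linear algebra on one tangent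
  space is required: every tangent vector must extend to a global field, and a derivation must be
  determined by its values on coordinates. Hence bump functions and the Hadamard lemma precede the
  geometry. The geometry uses only a ring of functions, fields acting on it by derivations, and a
  nondegenerate metric; it is carried out for such data and then evaluated at a point, which is
  legitimate for the operators B because they are skew. The square in \<open>A\<^sup>2 = c A\<close>
  arises as follows: the Lie derivative of \<phi>\<alpha> along \<xi>\<beta> is -B\<gamma>, while
  that of B\<gamma> is c B\<alpha>, because Lie derivatives commute with d. Nonvanishing of a power
  of a 2-form is an open condition and so bounds a rank only from below. The second form supplies
  the opposite bound; its coefficient \<open>2 / c\<close> cancels d\<eta>\<gamma> = (c / 2)
  \<Phi>\<gamma> on \<open>W\<close>.\<close>

lemma Ck_on_SucD:
  assumes "Ck_on (Suc k) f S" "open S"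
  shows "x \<in> S \<Longrightarrow> (f has_derivative frechet_derivative f (at x)) (at x)"
    and "Ck_on k (\<lambda>x. frechet_derivative f (at x) v) S"
  using assms by (auto simp: differentiable_on_eq_differentiable_at frechet_derivative_works)

lemma Ck_on_cong:
  assumes "Ck_on k f S" "open S" "\<And>x. x \<in> S \<Longrightarrow> f x = g x"
  shows "Ck_on k g S"
  using assms
proof (induction k arbitrary: f g)
  case 0
  then show ?case by (simp cong: continuous_on_cong)
next
  case (Suc k)
  have d: "(g has_derivative frechet_derivative f (at x)) (at x)" if "x \<in> S" for x
    using Ck_on_SucD(1)[OF Suc.prems(1,2) that] Suc.prems that
    by (auto intro: has_derivative_transform_within_open)
  then have "frechet_derivative f (at x) v = frechet_derivative g (at x) v" if "x \<in> S" for x v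
    using frechet_derivative_at that by metis
  then have "Ck_on k (\<lambda>x. frechet_derivative g (at x) v) S" for v
    by (rule Suc.IH[OF Ck_on_SucD(2)[OF Suc.prems(1,2)] Suc.prems(2)])
  with d Suc.prems(2) show ?case
    by (auto simp: differentiable_on_eq_differentiable_at differentiable_def)
qed

text \<open>Any family \<open>D\<close> of derivatives may be supplied: uniqueness identifies it
  with \<open>frechet_derivative\<close>. Closure properties thus reduce to writing down the product
  or chain rule.\<close>

lemma Ck_on_SucI:
  assumes "open S" "\<And>x. x \<in> S \<Longrightarrow> (f has_derivative D x) (at x)" "\<And>v. Ck_on k (\<lambda>x. D x v) S"
  shows "Ck_on (Suc k) f S"
proof -
  have "D x v = frechet_derivative f (at x) v" if "x \<in> S" for x v
    using frechet_derivative_at assms(2)[OF that] by metis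
  then have "Ck_on k (\<lambda>x. frechet_derivative f (at x) v) S" for v
    by (rule Ck_on_cong[OF assms(3) assms(1)])
  then show ?thesis
    using assms(1,2) by (auto simp: differentiable_on_eq_differentiable_at differentiable_def)
qed

lemma Ck_on_Suc_imp: "Ck_on (Suc k) f S \<Longrightarrow> Ck_on k f S"
proof (induction k arbitrary: f)
  case 0
  then show ?case by (simp add: differentiable_imp_continuous_on)
qed simp

lemma Ck_on_local:
  assumes "open S" "\<And>x. x \<in> S \<Longrightarrow> \<exists>T. open T \<and> x \<in> T \<and> Ck_on k f T"
  shows "Ck_on k f S"
  using assms(2)
proof (induction k arbitrary: f)
  case 0
  then have "continuous (at x) f" if "x \<in> S" for x
    using that continuous_on_eq_continuous_at by (metis Ck_on.simps(1))
  then show ?case by (simp add: continuous_at_imp_continuous_on)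
next
  case (Suc k)
  show ?case
  proof (rule Ck_on_SucI[OF assms(1)])
    show "(f has_derivative frechet_derivative f (at x)) (at x)" if "x \<in> S" for x
      using Suc.prems[OF that] Ck_on_SucD(1) by blast
    show "Ck_on k (\<lambda>x. frechet_derivative f (at x) v) S" for v
      using Suc.prems by (intro Suc.IH) (metis Ck_on_SucD(2))
  qed
qed

lemma Ck_on_subset:
  assumes "Ck_on k f T" "open S" "open T" "S \<subseteq> T"
  shows "Ck_on k f S"
  by (rule Ck_on_local[OF assms(2)]) (use assms in blast)

lemma Ck_on_const [simp]: "open S \<Longrightarrow> Ck_on k (\<lambda>x. c) S"
proof (induction k arbitrary: c)
  case (Suc k)
  then show ?case by (intro Ck_on_SucI[where D = "\<lambda>x v. 0"]) auto
qed simp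

lemma Ck_on_add:
  assumes "open S" "Ck_on k f S" "Ck_on k g S"
  shows "Ck_on k (\<lambda>x. f x + g x) S"
  using assms(2,3)
proof (induction k arbitrary: f g)
  case 0
  then show ?case by (simp add: continuous_on_add)
next
  case (Suc k)
  show ?case
  proof (rule Ck_on_SucI[OF assms(1)])
    fix x assume "x \<in> S"
    with Suc.prems assms(1) show "((\<lambda>x. f x + g x) has_derivative
        (\<lambda>v. frechet_derivative f (at x) v + frechet_derivative g (at x) v)) (at x)"
      by (intro has_derivative_add Ck_on_SucD(1))
  next
    fix v
    from Suc.prems assms(1)
    show "Ck_on k (\<lambda>x. frechet_derivative f (at x) v + frechet_derivative g (at x) v) S"
      by (intro Suc.IH Ck_on_SucD(2))
  qed
qed

lemma Ck_on_mult:
  fixes f g :: "'a::euclidean_space \<Rightarrow> real"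
  assumes "open S" "Ck_on k f S" "Ck_on k g S"
  shows "Ck_on k (\<lambda>x. f x * g x) S"
  using assms(2,3)
proof (induction k arbitrary: f g)
  case 0
  then show ?case by (simp add: continuous_on_mult)
next
  case (Suc k)
  show ?case
  proof (rule Ck_on_SucI[OF assms(1)])
    fix x assume "x \<in> S"
    with Suc.prems assms(1) show "((\<lambda>x. f x * g x) has_derivative
        (\<lambda>v. f x * frechet_derivative g (at x) v + frechet_derivative f (at x) v * g x)) (at x)"
      by (intro has_derivative_mult Ck_on_SucD(1))
  next
    fix v
    show "Ck_on k (\<lambda>x. f x * frechet_derivative g (at x) v + frechet_derivative f (at x) v * g x) S"
      by (intro Ck_on_add Suc.IH Ck_on_SucD(2)[OF Suc.prems(1) assms(1)]
        Ck_on_SucD(2)[OF Suc.prems(2) assms(1)] Suc.prems[THEN Ck_on_Suc_imp] assms(1))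
  qed
qed

lemma Ck_on_sum:
  assumes "open S" "\<And>i. i \<in> I \<Longrightarrow> Ck_on k (f i) S"
  shows "Ck_on k (\<lambda>x. \<Sum>i\<in>I. f i x) S"
  using assms by (induction I rule: infinite_finite_induct) (auto intro: Ck_on_add)

lemma Ck_on_bounded_linear:
  assumes "open S" "bounded_linear L" "Ck_on k f S"
  shows "Ck_on k (\<lambda>x. L (f x)) S"
  using assms(3)
proof (induction k arbitrary: f)
  case 0
  then show ?case using assms(2) by (simp add: bounded_linear.continuous_on)
next
  case (Suc k)
  show ?case
    by (rule Ck_on_SucI[OF assms(1) bounded_linear.has_derivative[OF assms(2)]])
      (use Suc.IH Ck_on_SucD[OF Suc.prems assms(1)] in auto)
qed

lemma Ck_on_id: "open S \<Longrightarrow> Ck_on k (\<lambda>x. x) S"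
  by (cases k) (auto intro!: Ck_on_SucI[where D = "\<lambda>x v. v"])

text \<open>In the chain rule the direction \<open>?g' x v\<close> varies with \<open>x\<close>,
  whereas \<open>Ck_on\<close> speaks of constant directions only. Expanding it in the basis gives a
  finite sum of products of functions already under control.\<close>

lemma Ck_on_compose:
  fixes f :: "'b::euclidean_space \<Rightarrow> real" and g :: "'a::euclidean_space \<Rightarrow> 'b"
  assumes "open S" "open T" "g ` S \<subseteq> T" "Ck_on k g S" "Ck_on k f T"
  shows "Ck_on k (\<lambda>x. f (g x)) S"
  using assms(4,5)
proof (induction k arbitrary: f)
  case 0
  then show ?case using assms(3) by (auto intro: continuous_on_compose2)
next
  case (Suc k)
  let ?f' = "\<lambda>x. frechet_derivative f (at x)" and ?g' = "\<lambda>x. frechet_derivative g (at x)"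
  have f: "(f has_derivative ?f' y) (at y)" if "y \<in> T" for y
    using Ck_on_SucD(1)[OF Suc.prems(2) assms(2) that] .
  have g: "(g has_derivative ?g' x) (at x)" if "x \<in> S" for x
    using Ck_on_SucD(1)[OF Suc.prems(1) assms(1) that] .
  show ?case
  proof (rule Ck_on_SucI[OF assms(1)])
    fix x assume x: "x \<in> S"
    have lin: "linear (?f' (g x))"
      using f[of "g x"] x assms(3) by (auto dest: has_derivative_linear)
    have "?f' (g x) (?g' x v) = (\<Sum>i\<in>Basis. (?g' x v \<bullet> i) * ?f' (g x) i)" for v
      using linear_sum[OF lin, of "\<lambda>i. (?g' x v \<bullet> i) *\<^sub>R i" Basis]
      by (simp add: euclidean_representation linear_cmul[OF lin])
    then show "((\<lambda>x. f (g x)) has_derivative (\<lambda>v. \<Sum>i\<in>Basis. (?g' x v \<bullet> i) * ?f' (g x) i)) (at x)"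
      using has_derivative_compose[OF g[OF x] f[of "g x"]] x assms(3) by auto
  next
    fix v
    have "Ck_on k (\<lambda>x. ?f' (g x) i) S" for i
      using Suc.IH[OF Ck_on_Suc_imp[OF Suc.prems(1)] Ck_on_SucD(2)[OF Suc.prems(2) assms(2)]] .
    moreover have "Ck_on k (\<lambda>x. ?g' x v \<bullet> i) S" for i
      by (rule Ck_on_bounded_linear[OF assms(1) bounded_linear_inner_left
          Ck_on_SucD(2)[OF Suc.prems(1) assms(1)]])
    ultimately show "Ck_on k (\<lambda>x. \<Sum>i\<in>Basis. (?g' x v \<bullet> i) * ?f' (g x) i) S"
      by (intro Ck_on_sum Ck_on_mult assms(1))
  qed
qed

lemma smooth_on_cong: "smooth_on S f \<Longrightarrow> open S \<Longrightarrow> (\<And>x. x \<in> S \<Longrightarrow> f x = g x) \<Longrightarrow> smooth_on S g"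
  unfolding smooth_on_def by (intro allI Ck_on_cong[of _ f S g]) auto

lemma smooth_on_local:
  assumes "open S" "\<And>x. x \<in> S \<Longrightarrow> \<exists>T. open T \<and> x \<in> T \<and> smooth_on T f"
  shows "smooth_on S f"
proof -
  have "\<exists>T. open T \<and> x \<in> T \<and> Ck_on k f T" if "x \<in> S" for x k
    using assms(2)[OF that] by (auto simp: smooth_on_def)
  then show ?thesis unfolding smooth_on_def by (intro allI Ck_on_local[OF assms(1)])
qed

lemma smooth_on_subset: "smooth_on T f \<Longrightarrow> open S \<Longrightarrow> open T \<Longrightarrow> S \<subseteq> T \<Longrightarrow> smooth_on S f"
  unfolding smooth_on_def by (intro allI Ck_on_subset[of _ f T S]) auto

lemma smooth_on_const: "open S \<Longrightarrow> smooth_on S (\<lambda>x. c)"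
  and smooth_on_id: "open S \<Longrightarrow> smooth_on S (\<lambda>x. x)"
  and smooth_on_add: "open S \<Longrightarrow> smooth_on S f \<Longrightarrow> smooth_on S g \<Longrightarrow> smooth_on S (\<lambda>x. f x + g x)"
  and smooth_on_bounded_linear:
    "open S \<Longrightarrow> bounded_linear L \<Longrightarrow> smooth_on S f \<Longrightarrow> smooth_on S (\<lambda>x. L (f x))"
  by (auto simp: smooth_on_def Ck_on_add Ck_on_bounded_linear Ck_on_id)

lemma smooth_on_mult:
  fixes f h :: "'a::euclidean_space \<Rightarrow> real"
  shows "open S \<Longrightarrow> smooth_on S f \<Longrightarrow> smooth_on S h \<Longrightarrow> smooth_on S (\<lambda>x. f x * h x)"
  by (auto simp: smooth_on_def Ck_on_mult)

lemma smooth_on_sum: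
  "open S \<Longrightarrow> (\<And>i. i \<in> I \<Longrightarrow> smooth_on S (f i)) \<Longrightarrow> smooth_on S (\<lambda>x. \<Sum>i\<in>I. f i x)"
  by (auto simp: smooth_on_def Ck_on_sum)

lemma smooth_on_compose:
  fixes f :: "'b::euclidean_space \<Rightarrow> real" and h :: "'a::euclidean_space \<Rightarrow> 'b"
  shows "open S \<Longrightarrow> open T \<Longrightarrow> h ` S \<subseteq> T \<Longrightarrow> smooth_on S h \<Longrightarrow> smooth_on T f \<Longrightarrow> smooth_on S (\<lambda>x. f (h x))"
  unfolding smooth_on_def by (intro allI Ck_on_compose[of S T h]) auto

lemma smooth_onD:
  assumes "smooth_on S f" "open S"
  shows "x \<in> S \<Longrightarrow> (f has_derivative frechet_derivative f (at x)) (at x)"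
    and "smooth_on S (\<lambda>x. frechet_derivative f (at x) v)"
    and "continuous_on S f"
proof -
  have Suc: "Ck_on (Suc k) f S" for k using assms by (simp only: smooth_on_def)
  show "x \<in> S \<Longrightarrow> (f has_derivative frechet_derivative f (at x)) (at x)"
    by (rule Ck_on_SucD(1)[OF Suc assms(2)])
  show "smooth_on S (\<lambda>x. frechet_derivative f (at x) v)"
    unfolding smooth_on_def by (intro allI Ck_on_SucD(2)[OF Suc assms(2)])
  have "Ck_on 0 f S" using assms by (simp only: smooth_on_def)
  then show "continuous_on S f" by simp
qed

subsection \<open>Bump functions\<close>

text \<open>The negative powers of \<open>t\<close> make the family closed under differentiation up
  to linear combinations, so one induction proves all members smooth.\<close>

definition flat_exp :: "nat \<Rightarrow> real \<Rightarrow> real" where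
  "flat_exp m t = (if t \<le> 0 then 0 else exp (- 1 / t) / t ^ m)"

lemma flat_exp_tendsto_0: "(flat_exp m \<longlongrightarrow> 0) (at 0)"
proof -
  have "((\<lambda>t::real. inverse t ^ m / exp (inverse t)) \<longlongrightarrow> 0) (at_right 0)"
    using filterlim_compose[OF tendsto_power_div_exp_0[of m] filterlim_inverse_at_top_right] .
  then have "(flat_exp m \<longlongrightarrow> 0) (at_right 0)"
    by (rule Lim_transform_eventually)
      (auto simp: eventually_at_filter flat_exp_def exp_minus divide_inverse power_inverse mult.commute)
  moreover have "(flat_exp m \<longlongrightarrow> 0) (at_left 0)"
    by (rule Lim_transform_eventually[OF tendsto_const])
      (auto simp: eventually_at_filter flat_exp_def)
  ultimately show ?thesis by (simp add: filterlim_split_at)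
qed

lemma flat_exp_deriv:
  "(flat_exp m has_real_derivative flat_exp (m + 2) t - m * flat_exp (m + 1) t) (at t)"
proof -
  consider "t < 0" | "t = 0" | "t > 0" by linarith
  then show ?thesis
  proof cases
    case 1
    have "((\<lambda>t. 0) has_real_derivative 0) (at t)" by simp
    then have "(flat_exp m has_real_derivative 0) (at t)"
      by (rule has_field_derivative_transform_within_open[of _ _ _ "{..<0}"])
        (use 1 in \<open>auto simp: flat_exp_def\<close>)
    then show ?thesis using 1 by (simp add: flat_exp_def)
  next
    case 2
    \<comment> \<open>Since \<open>flat_exp m 0 = 0\<close>, the difference quotient at 0 is
      \<open>flat_exp (Suc m)\<close> itself.\<close>
    have "((\<lambda>h. (flat_exp m (0 + h) - flat_exp m 0) / h) \<longlongrightarrow> 0) (at 0)"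
      by (rule Lim_transform_eventually[OF flat_exp_tendsto_0[of "Suc m"]])
        (auto simp: eventually_at_filter flat_exp_def)
    then show ?thesis using 2 by (simp add: DERIV_def flat_exp_def)
  next
    case 3
    have "((\<lambda>t. exp (- 1 / t) / t ^ m) has_real_derivative
        (exp (- 1 / t) * (1 / t ^ 2)) / t ^ m - exp (- 1 / t) * (m * t ^ (m - 1)) / (t ^ m * t ^ m)) (at t)"
      using 3 by (auto intro!: derivative_eq_intros simp: power2_eq_square field_simps)
    moreover have "(exp (- 1 / t) * (1 / t ^ 2)) / t ^ m - exp (- 1 / t) * (m * t ^ (m - 1)) / (t ^ m * t ^ m)
        = flat_exp (m + 2) t - m * flat_exp (m + 1) t"
      using 3 by (cases m) (simp_all add: flat_exp_def power2_eq_square power_add field_simps)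
    ultimately have "((\<lambda>t. exp (- 1 / t) / t ^ m) has_real_derivative
        flat_exp (m + 2) t - m * flat_exp (m + 1) t) (at t)" by simp
    then show ?thesis
      by (rule has_field_derivative_transform_within_open[of _ _ _ "{0<..}"])
        (use 3 in \<open>auto simp: flat_exp_def\<close>)
  qed
qed

lemma smooth_flat_exp: "smooth_on UNIV (flat_exp m)"
proof -
  have "Ck_on k (flat_exp m) UNIV" for k
  proof (induction k arbitrary: m)
    case 0
    have "isCont (flat_exp m) t" for t using DERIV_isCont[OF flat_exp_deriv] .
    then show ?case by (simp add: continuous_at_imp_continuous_on)
  next
    case (Suc k)
    show ?case
    proof (rule Ck_on_SucI)
      show "(flat_exp m has_derivative
          (\<lambda>v. (flat_exp (m + 2) t + (- real m) * flat_exp (m + 1) t) * v)) (at t)" for t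
        using flat_exp_deriv[of m t] by (simp add: has_field_derivative_def)
    qed (intro Ck_on_mult Ck_on_add Suc.IH Ck_on_const open_UNIV)+
  qed
  then show ?thesis by (simp add: smooth_on_def)
qed

text \<open>The argument is the polynomial r^2 - |x - a|^2, written in coordinates so that
  smoothness follows from closure under sums and products. For \<open>r > 0\<close> the value is
  positive exactly on the open ball.\<close>

definition bump :: "'a::euclidean_space \<Rightarrow> real \<Rightarrow> 'a \<Rightarrow> real" where
  "bump a r x = flat_exp 0 (r\<^sup>2 + (- 1) * (\<Sum>i\<in>Basis. ((x - a) \<bullet> i) * ((x - a) \<bullet> i)))"

lemma smooth_coordinate: "smooth_on UNIV (\<lambda>x. (x - a) \<bullet> i)"
proof -
  have "smooth_on UNIV (\<lambda>x. x \<bullet> i + (- (a \<bullet> i)))"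
    by (intro smooth_on_add smooth_on_const smooth_on_bounded_linear[OF _ bounded_linear_inner_left]
      smooth_on_id open_UNIV)
  then show ?thesis by (simp add: inner_diff_left)
qed

lemma smooth_bump: "smooth_on UNIV (bump a r)"
  unfolding bump_def
  by (rule smooth_on_compose[OF _ open_UNIV _ _ smooth_flat_exp])
    (intro smooth_on_add smooth_on_mult smooth_on_sum smooth_on_const smooth_coordinate open_UNIV | simp)+

lemma bump_eq: "bump a r x = flat_exp 0 (r\<^sup>2 - (dist a x)\<^sup>2)"
proof -
  have "(\<Sum>i\<in>Basis. ((x - a) \<bullet> i) * ((x - a) \<bullet> i)) = (dist a x)\<^sup>2"
    by (simp add: dist_norm norm_minus_commute[of a] power2_norm_eq_inner flip: euclidean_inner)
  then show ?thesis by (simp add: bump_def)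
qed

lemma bump_zero: "r > 0 \<Longrightarrow> x \<notin> cball a r \<Longrightarrow> bump a r x = 0"
  by (simp add: bump_eq flat_exp_def power_mono)

lemma bump_centre: "r > 0 \<Longrightarrow> bump a r a > 0"
  by (simp add: bump_eq flat_exp_def)

subsection \<open>The Hadamard lemma\<close>

lemma segment_in_ball:
  fixes a x :: "'a::real_normed_vector"
  assumes "x \<in> ball a R" "t \<in> {0..1}"
  shows "a + t *\<^sub>R (x - a) \<in> ball a R"
proof -
  have "norm (t *\<^sub>R (x - a)) \<le> 1 * norm (x - a)"
    using assms(2) unfolding norm_scaleR by (intro mult_right_mono) auto
  then show ?thesis using assms(1) by (simp add: dist_norm norm_minus_commute)
qed

text \<open>Differentiation in \<open>x\<close> under the integral produces a further factor
  \<open>t\<close> by the chain rule. With the weight \<open>t ^ m\<close> the class of these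
  integrals is closed under differentiation, and the induction runs over all \<open>f\<close> and
  \<open>m\<close> together.\<close>

lemma smooth_radial_mean:
  fixes f :: "'a::euclidean_space \<Rightarrow> real"
  assumes "smooth_on (ball a R) f"
  shows "smooth_on (ball a R) (\<lambda>x. integral {0..1} (\<lambda>t. t ^ m * f (a + t *\<^sub>R (x - a))))"
proof -
  have cont: "continuous_on (ball a R \<times> {0..1}) (\<lambda>(x, t). t ^ m * f (a + t *\<^sub>R (x - a)))"
    if "continuous_on (ball a R) f" for f :: "'a \<Rightarrow> real" and m
    unfolding case_prod_beta
    by (intro continuous_on_mult continuous_intros continuous_on_compose2[OF that])
      (use segment_in_ball[of _ a R] in force)
  have "Ck_on k (\<lambda>x. integral {0..1} (\<lambda>t. t ^ m * f (a + t *\<^sub>R (x - a)))) (ball a R)" for k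
    using assms
  proof (induction k arbitrary: f m)
    case 0
    have "continuous_on (ball a R) (\<lambda>x. integral (cbox 0 1) (\<lambda>t. t ^ m * f (a + t *\<^sub>R (x - a))))"
      by (rule integral_continuous_on_param)
        (use cont[OF smooth_onD(3)[OF 0 open_ball]] in \<open>simp add: case_prod_beta\<close>)
    then show ?case by simp
  next
    case (Suc k)
    let ?f' = "\<lambda>y. frechet_derivative f (at y)"
    have f': "(f has_derivative ?f' y) (at y)" if "y \<in> ball a R" for y
      using smooth_onD(1)[OF Suc.prems open_ball that] .
    \<comment> \<open>\<open>leibniz_rule\<close> wants the derivative as a bounded linear map
      depending continuously on the point and on \<open>t\<close>; continuity is then checked
      direction by direction.\<close>
    define F where "F x t = Blinfun (\<lambda>v. t ^ Suc m * ?f' (a + t *\<^sub>R (x - a)) v)" for x t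
    have F: "blinfun_apply (F x t) = (\<lambda>v. t ^ Suc m * ?f' (a + t *\<^sub>R (x - a)) v)"
      if "x \<in> ball a R" "t \<in> {0..1}" for x t
      unfolding F_def
      by (intro bounded_linear_Blinfun_apply bounded_linear_const_mult
          has_derivative_bounded_linear[OF f'] segment_in_ball that)
    have contF: "continuous_on (ball a R \<times> cbox 0 1) (\<lambda>(x, t). F x t)"
      unfolding case_prod_beta
    proof (rule continuous_on_blinfun_componentwise)
      fix i :: 'a
      have "continuous_on (ball a R \<times> {0..1}) (\<lambda>(x, t). t ^ Suc m * ?f' (a + t *\<^sub>R (x - a)) i)"
        by (rule cont[OF smooth_onD(3)[OF smooth_onD(2)[OF Suc.prems open_ball] open_ball]])
      then have "continuous_on (ball a R \<times> cbox 0 1) (\<lambda>(x, t). t ^ Suc m * ?f' (a + t *\<^sub>R (x - a)) i)"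
        by simp
      then show "continuous_on (ball a R \<times> cbox 0 1) (\<lambda>z. blinfun_apply (F (fst z) (snd z)) i)"
        by (rule continuous_on_eq) (auto simp: F simp del: power_Suc)
    qed
    have intF: "(F x) integrable_on {0..1}" if "x \<in> ball a R" for x
    proof -
      have "continuous_on (cbox 0 1) (\<lambda>t. (\<lambda>(x, t). F x t) (x, t))"
        by (rule continuous_on_compose2[OF contF]) (use that in \<open>auto intro!: continuous_intros\<close>)
      then show ?thesis using integrable_continuous[of 0 1 "F x"] by simp
    qed
    show ?case
    proof (rule Ck_on_SucI[OF open_ball,
          where D = "\<lambda>x v. integral {0..1} (\<lambda>t. t ^ Suc m * ?f' (a + t *\<^sub>R (x - a)) v)"])
      fix x assume x: "x \<in> ball a R"
      have 1: "((\<lambda>x. integral (cbox 0 1) (\<lambda>t. t ^ m * f (a + t *\<^sub>R (x - a)))) has_derivative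
          integral (cbox 0 1) (F x)) (at x within ball a R)"
      proof (rule leibniz_rule[OF _ _ contF x convex_ball])
        fix y and t :: real assume y: "y \<in> ball a R" and t: "t \<in> cbox 0 1"
        have "((\<lambda>y. f (a + t *\<^sub>R (y - a))) has_derivative (\<lambda>v. ?f' (a + t *\<^sub>R (y - a)) (t *\<^sub>R v)))
            (at y within ball a R)"
          by (rule has_derivative_compose[where g = f and f' = "\<lambda>v. t *\<^sub>R v"
            and f = "\<lambda>y. a + t *\<^sub>R (y - a)", OF _ f'[OF segment_in_ball]])
            (use y t in \<open>auto intro!: derivative_eq_intros\<close>)
        moreover have "?f' (a + t *\<^sub>R (y - a)) (t *\<^sub>R v) = t * ?f' (a + t *\<^sub>R (y - a)) v" for v
          using linear_cmul[OF has_derivative_linear[OF f'[OF segment_in_ball]]] y t by simp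
        ultimately have "((\<lambda>y. t ^ m * f (a + t *\<^sub>R (y - a))) has_derivative
            (\<lambda>v. t ^ m * (t * ?f' (a + t *\<^sub>R (y - a)) v))) (at y within ball a R)"
          by (intro has_derivative_mult_right) simp
        then show "((\<lambda>y. t ^ m * f (a + t *\<^sub>R (y - a))) has_derivative blinfun_apply (F y t))
            (at y within ball a R)"
          using F[of y t] y t by (simp add: mult_ac)
      next
        fix y assume y: "y \<in> ball a R"
        have "continuous_on (cbox 0 1) (\<lambda>t. (\<lambda>(x, t). t ^ m * f (a + t *\<^sub>R (x - a))) (y, t))"
          by (rule continuous_on_compose2[OF cont[OF smooth_onD(3)[OF Suc.prems open_ball]]])
            (use y in \<open>auto intro!: continuous_intros\<close>)
        then show "(\<lambda>t. t ^ m * f (a + t *\<^sub>R (y - a))) integrable_on cbox 0 1"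
          by (intro integrable_continuous) simp
      qed
      have 2: "blinfun_apply (integral {0..1} (F x)) =
          (\<lambda>v. integral {0..1} (\<lambda>t. t ^ Suc m * ?f' (a + t *\<^sub>R (x - a)) v))"
      proof
        fix v
        have "blinfun_apply (integral {0..1} (F x)) v = integral {0..1} (\<lambda>t. blinfun_apply (F x t) v)"
          using integral_linear[OF intF[OF x] blinfun.bounded_linear_left[of v]] by (simp add: o_def)
        also have "\<dots> = integral {0..1} (\<lambda>t. t ^ Suc m * ?f' (a + t *\<^sub>R (x - a)) v)"
          by (rule integral_cong) (simp only: F[OF x])
        finally show "blinfun_apply (integral {0..1} (F x)) v = \<dots>" .
      qed
      show "((\<lambda>x. integral {0..1} (\<lambda>t. t ^ m * f (a + t *\<^sub>R (x - a)))) has_derivative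
          (\<lambda>v. integral {0..1} (\<lambda>t. t ^ Suc m * ?f' (a + t *\<^sub>R (x - a)) v))) (at x)"
        using 1 unfolding at_within_open[OF x open_ball] box_real 2 .
    next
      show "Ck_on k (\<lambda>x. integral {0..1} (\<lambda>t. t ^ Suc m * ?f' (a + t *\<^sub>R (x - a)) v)) (ball a R)" for v
        by (rule Suc.IH[OF smooth_onD(2)[OF Suc.prems open_ball]])
    qed
  qed
  then show ?thesis by (simp add: smooth_on_def)
qed

text \<open>Integrate the derivative of \<open>f\<close> along the segment from \<open>a\<close> to
  \<open>x\<close>; the coefficients are the radial means, with weight \<open>t ^ 0\<close>, of the
  partial derivatives.\<close>

lemma hadamard:
  fixes f :: "'a::euclidean_space \<Rightarrow> real"
  assumes f: "smooth_on (ball a R) f" and R: "R > 0"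
  obtains h where "\<And>i. smooth_on (ball a R) (h i)"
    and "\<And>x. x \<in> ball a R \<Longrightarrow> f x = f a + (\<Sum>i\<in>Basis. ((x - a) \<bullet> i) * h i x)"
    and "\<And>i. h i a = frechet_derivative f (at a) i"
proof -
  let ?f' = "\<lambda>y. frechet_derivative f (at y)"
  define h where "h i x = integral {0..1} (\<lambda>t. t ^ 0 * ?f' (a + t *\<^sub>R (x - a)) i)" for i x
  have "f x = f a + (\<Sum>i\<in>Basis. ((x - a) \<bullet> i) * h i x)" if x: "x \<in> ball a R" for x
  proof -
    have d: "(f has_derivative ?f' (a + t *\<^sub>R (x - a))) (at (a + t *\<^sub>R (x - a)))" if "t \<in> {0..1}" for t
      by (rule smooth_onD(1)[OF f open_ball segment_in_ball[OF x that]])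
    have "((\<lambda>t. ?f' (a + t *\<^sub>R (x - a)) (x - a)) has_integral
        f (a + 1 *\<^sub>R (x - a)) - f (a + 0 *\<^sub>R (x - a))) {0..1}"
    proof (rule fundamental_theorem_of_calculus)
      fix t :: real assume t: "t \<in> {0..1}"
      have "((\<lambda>t. f (a + t *\<^sub>R (x - a))) has_derivative (\<lambda>s. ?f' (a + t *\<^sub>R (x - a)) (s *\<^sub>R (x - a))))
          (at t within {0..1})"
        by (rule has_derivative_compose[where g = f and f' = "\<lambda>s. s *\<^sub>R (x - a)"
            and f = "\<lambda>s. a + s *\<^sub>R (x - a)", OF _ d[OF t]])
          (auto intro!: derivative_eq_intros)
      then show "((\<lambda>t. f (a + t *\<^sub>R (x - a))) has_vector_derivative ?f' (a + t *\<^sub>R (x - a)) (x - a))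
          (at t within {0..1})"
        unfolding has_vector_derivative_def
        using linear_cmul[OF has_derivative_linear[OF d[OF t]]] by simp
    qed simp
    then have 1: "f x - f a = integral {0..1} (\<lambda>t. ?f' (a + t *\<^sub>R (x - a)) (x - a))"
      by (simp add: integral_unique)
    have int: "(\<lambda>t. ?f' (a + t *\<^sub>R (x - a)) i) integrable_on {0..1}" for i
    proof -
      have "continuous_on {0..1} (\<lambda>t. ?f' (a + t *\<^sub>R (x - a)) i)"
        by (rule continuous_on_compose2[OF smooth_onD(3)[OF smooth_onD(2)[OF f open_ball] open_ball]])
          (use segment_in_ball[OF x] in \<open>auto intro!: continuous_intros\<close>)
      then show ?thesis by (rule integrable_continuous_interval)
    qed
    have "integral {0..1} (\<lambda>t. ?f' (a + t *\<^sub>R (x - a)) (x - a)) =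
        integral {0..1} (\<lambda>t. \<Sum>i\<in>Basis. ((x - a) \<bullet> i) * ?f' (a + t *\<^sub>R (x - a)) i)"
    proof (rule integral_cong)
      fix t :: real assume t: "t \<in> {0..1}"
      note lin = has_derivative_linear[OF d[OF t]]
      show "?f' (a + t *\<^sub>R (x - a)) (x - a) = (\<Sum>i\<in>Basis. ((x - a) \<bullet> i) * ?f' (a + t *\<^sub>R (x - a)) i)"
        using linear_sum[OF lin, of "\<lambda>i. ((x - a) \<bullet> i) *\<^sub>R i" Basis]
        by (simp only: euclidean_representation linear_cmul[OF lin] real_scaleR_def)
    qed
    also have "\<dots> = (\<Sum>i\<in>Basis. ((x - a) \<bullet> i) * h i x)"
      by (subst integral_sum) (auto simp: h_def int intro!: integrable_on_mult_right)
    finally show ?thesis using 1 by simp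
  qed
  moreover have "smooth_on (ball a R) (h i)" for i
    unfolding h_def[abs_def] by (rule smooth_radial_mean[OF smooth_onD(2)[OF f open_ball]])
  moreover have "h i a = ?f' a i" for i by (simp add: h_def)
  ultimately show ?thesis using that[of h] by blast
qed

subsection \<open>Smooth functions on manifolds\<close>

lemma smooth_on_zero_extension:
  fixes F :: "'a::euclidean_space \<Rightarrow> real"
  assumes "open S" "compact K" "K \<subseteq> S" "smooth_on S F" "\<And>x. x \<notin> K \<Longrightarrow> F x = 0"
  shows "smooth_on UNIV F"
proof (rule smooth_on_local)
  fix x
  have "open (- K)" using assms(2) by (simp add: compact_imp_closed open_Compl)
  moreover from this have "smooth_on (- K) F"
    using assms(5) by (intro smooth_on_cong[OF smooth_on_const[of "- K" 0]]) auto
  ultimately show "\<exists>T. open T \<and> x \<in> T \<and> smooth_on T F"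
    using assms(1,3,4) by (cases "x \<in> K") (auto intro: exI[of _ S] exI[of _ "- K"])
qed simp

locale smooth_mfd =
  fixes A :: "('m::{t2_space, second_countable_topology}, 'e::euclidean_space) chart set"
  assumes mfd: "smooth_manifold A"
begin

lemma chart_at:
  obtains U \<kappa> where "(U, \<kappa>) \<in> A" "p \<in> U"
proof -
  have "p \<in> (\<Union>(U, \<kappa>)\<in>A. U)" using mfd unfolding smooth_manifold_def by simp
  then show ?thesis using that by auto
qed

lemma chart:
  assumes "(U, \<kappa>) \<in> A"
  shows "open U" "open (\<kappa> ` U)" "homeomorphism U (\<kappa> ` U) \<kappa> (inv_into U \<kappa>)"
    and "inj_on \<kappa> U" "x \<in> U \<Longrightarrow> inv_into U \<kappa> (\<kappa> x) = x"
proof -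
  show 1: "open U" "open (\<kappa> ` U)" "homeomorphism U (\<kappa> ` U) \<kappa> (inv_into U \<kappa>)"
    using mfd assms unfolding smooth_manifold_def by auto
  show 2: "x \<in> U \<Longrightarrow> inv_into U \<kappa> (\<kappa> x) = x" for x
    using homeomorphism_apply1[OF 1(3)] .
  show "inj_on \<kappa> U" using 2 by (rule inj_on_inverseI)
qed

lemma chart_open:
  assumes "(U, \<kappa>) \<in> A" "open W"
  shows "open (\<kappa> ` (U \<inter> W))"
proof -
  have "openin (top_of_set (\<kappa> ` U)) (\<kappa> ` (U \<inter> W))"
    using homeomorphism_imp_open_map[OF chart(3)[OF assms(1)]] assms(2)
    by (simp add: openin_open_Int)
  then show ?thesis using openin_open_trans chart(2)[OF assms(1)] by blast
qed

lemma transition_smooth: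
  assumes "(U, \<kappa>) \<in> A" "(V, \<mu>) \<in> A"
  shows "smooth_on (\<kappa> ` (U \<inter> V)) (\<mu> \<circ> inv_into U \<kappa>)"
proof -
  have "\<forall>(U, \<kappa>)\<in>A. \<forall>(V, \<mu>)\<in>A. smooth_on (\<kappa> ` (U \<inter> V)) (\<mu> \<circ> inv_into U \<kappa>)"
    using mfd unfolding smooth_manifold_def by simp
  from bspec[OF this assms(1)] assms(2) show ?thesis by auto
qed

lemma smooth_funsD: "f \<in> smooth_funs A \<Longrightarrow> (U, \<kappa>) \<in> A \<Longrightarrow> smooth_on (\<kappa> ` U) (f \<circ> inv_into U \<kappa>)"
  unfolding smooth_funs_def by auto

lemma smooth_funsI:
  "(\<And>U \<kappa>. (U, \<kappa>) \<in> A \<Longrightarrow> smooth_on (\<kappa> ` U) (f \<circ> inv_into U \<kappa>)) \<Longrightarrow> f \<in> smooth_funs A"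
  unfolding smooth_funs_def by auto

lemma smooth_funs_const [simp, intro]: "(\<lambda>x. c) \<in> smooth_funs A"
  by (rule smooth_funsI) (simp add: o_def smooth_on_const chart)

lemma smooth_funs_add [intro]:
  "f \<in> smooth_funs A \<Longrightarrow> h \<in> smooth_funs A \<Longrightarrow> (\<lambda>x. f x + h x) \<in> smooth_funs A"
proof (rule smooth_funsI)
  fix U \<kappa> assume f: "f \<in> smooth_funs A" and h: "h \<in> smooth_funs A" and c: "(U, \<kappa>) \<in> A"
  from smooth_on_add[OF chart(2)[OF c] smooth_funsD[OF f c] smooth_funsD[OF h c]]
  show "smooth_on (\<kappa> ` U) ((\<lambda>x. f x + h x) \<circ> inv_into U \<kappa>)" by (simp add: o_def)
qed

lemma smooth_funs_mult [intro]:
  "f \<in> smooth_funs A \<Longrightarrow> h \<in> smooth_funs A \<Longrightarrow> (\<lambda>x. f x * h x) \<in> smooth_funs A"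
proof (rule smooth_funsI)
  fix U \<kappa> assume f: "f \<in> smooth_funs A" and h: "h \<in> smooth_funs A" and c: "(U, \<kappa>) \<in> A"
  from smooth_on_mult[OF chart(2)[OF c] smooth_funsD[OF f c] smooth_funsD[OF h c]]
  show "smooth_on (\<kappa> ` U) ((\<lambda>x. f x * h x) \<circ> inv_into U \<kappa>)" by (simp add: o_def)
qed

lemma smooth_funs_diff [intro]:
  "f \<in> smooth_funs A \<Longrightarrow> h \<in> smooth_funs A \<Longrightarrow> (\<lambda>x. f x - h x) \<in> smooth_funs A"
  using smooth_funs_add[OF _ smooth_funs_mult[OF smooth_funs_const[of "-1"]], of f h] by simp

lemma smooth_funs_sum [intro]:
  "(\<And>i. i \<in> I \<Longrightarrow> f i \<in> smooth_funs A) \<Longrightarrow> (\<lambda>x. \<Sum>i\<in>I. f i x) \<in> smooth_funs A"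
  by (induction I rule: infinite_finite_induct) auto

lemma smooth_funs_continuous:
  assumes f: "f \<in> smooth_funs A"
  shows "continuous_on UNIV f"
proof -
  have "continuous (at p) f" for p
  proof -
    obtain U \<kappa> where c: "(U, \<kappa>) \<in> A" "p \<in> U" by (rule chart_at)
    have "continuous_on (\<kappa> ` U) (f \<circ> inv_into U \<kappa>)"
      using smooth_onD(3)[OF smooth_funsD[OF f c(1)] chart(2)[OF c(1)]] .
    then have "continuous_on U (\<lambda>x. (f \<circ> inv_into U \<kappa>) (\<kappa> x))"
      using homeomorphism_cont1[OF chart(3)[OF c(1)]] by (rule continuous_on_compose2) simp
    then have "continuous_on U f"
      by (rule continuous_on_eq) (simp add: chart(5)[OF c(1)])
    then show ?thesis using c chart(1)[OF c(1)] continuous_on_eq_continuous_at by blast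
  qed
  then show ?thesis by (simp add: continuous_at_imp_continuous_on)
qed

text \<open>At a point of \<open>U\<close> another chart sees \<open>F\<close> composed with a
  transition map. At a point outside \<open>U\<close> the function vanishes nearby: the part of
  \<open>U\<close> mapped to \<open>K\<close> is compact, hence closed in a Hausdorff space.\<close>

lemma lift_smooth:
  fixes F :: "'e \<Rightarrow> real"
  assumes c: "(U, \<kappa>) \<in> A" and F: "smooth_on (\<kappa> ` U) F"
    and K: "compact K" "K \<subseteq> \<kappa> ` U" "\<And>x. x \<notin> K \<Longrightarrow> F x = 0"
  shows "(\<lambda>q. if q \<in> U then F (\<kappa> q) else 0) \<in> smooth_funs A" (is "?f \<in> _")
proof (rule smooth_funsI)
  fix V \<mu> assume d: "(V, \<mu>) \<in> A"
  let ?g = "?f \<circ> inv_into V \<mu>"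
  define C where "C = inv_into U \<kappa> ` K"
  have "compact C" unfolding C_def
    using homeomorphism_cont2[OF chart(3)[OF c]] K continuous_on_subset
    by (intro compact_continuous_image) blast+
  then have C: "open (- C)" by (simp add: compact_imp_closed open_Compl)
  show "smooth_on (\<mu> ` V) ?g"
  proof (rule smooth_on_local[OF chart(2)[OF d]])
    fix y assume "y \<in> \<mu> ` V"
    then obtain q where q: "q \<in> V" "y = \<mu> q" by auto
    show "\<exists>T. open T \<and> y \<in> T \<and> smooth_on T ?g"
    proof (cases "q \<in> U")
      case True
      let ?T = "\<mu> ` (V \<inter> U)"
      have T: "open ?T" by (rule chart_open[OF d chart(1)[OF c]])
      have "smooth_on ?T (\<lambda>x. F ((\<kappa> \<circ> inv_into V \<mu>) x))"
        by (rule smooth_on_compose[OF T chart(2)[OF c] _ transition_smooth[OF d c] F])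
          (auto simp: chart(5)[OF d])
      then have "smooth_on ?T ?g"
        by (rule smooth_on_cong[OF _ T]) (auto simp: chart(5)[OF d])
      then show ?thesis using T q True by blast
    next
      case False
      let ?T = "\<mu> ` (V \<inter> - C)"
      have T: "open ?T" by (rule chart_open[OF d C])
      have "smooth_on ?T ?g"
      proof (rule smooth_on_cong[OF smooth_on_const[OF T, of 0] T])
        fix x assume "x \<in> ?T"
        then obtain r where r: "r \<in> V" "r \<notin> C" "x = \<mu> r" by auto
        have "\<kappa> r \<notin> K" if "r \<in> U"
          using r(2) chart(5)[OF c that] unfolding C_def by (metis image_eqI)
        then show "0 = ?g x" using K(3) r by (simp add: chart(5)[OF d])
      qed
      moreover have "q \<notin> C"
        using False K(2) chart(5)[OF c] unfolding C_def by (force dest!: subsetD)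
      ultimately show ?thesis using T q by blast
    qed
  qed
qed

subsection \<open>Tangent vectors and vector fields\<close>

lemma tangent_spaceD:
  assumes "v \<in> tangent_space A p"
  shows tangent_lin: "f \<in> smooth_funs A \<Longrightarrow> h \<in> smooth_funs A \<Longrightarrow>
      v (\<lambda>x. a * f x + b * h x) = a * v f + b * v h"
    and tangent_leibniz: "f \<in> smooth_funs A \<Longrightarrow> h \<in> smooth_funs A \<Longrightarrow>
      v (\<lambda>x. f x * h x) = f p * v h + h p * v f"
    and tangent_nonsmooth: "f \<notin> smooth_funs A \<Longrightarrow> v f = 0"
  using assms unfolding tangent_space_def by blast+

lemma tangent_const:
  assumes v: "v \<in> tangent_space A p"
  shows "v (\<lambda>x. c) = 0"
proof -
  have "v (\<lambda>x. 1) = 0" using tangent_leibniz[OF v, of "\<lambda>x. 1" "\<lambda>x. 1"] by simp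
  then show ?thesis using tangent_lin[OF v, of "\<lambda>x. 1" "\<lambda>x. 1" c 0] by simp
qed

lemma tangent_add:
  assumes "v \<in> tangent_space A p" "f \<in> smooth_funs A" "h \<in> smooth_funs A"
  shows "v (\<lambda>x. f x + h x) = v f + v h" "v (\<lambda>x. f x - h x) = v f - v h"
  using tangent_lin[OF assms, of 1 1] tangent_lin[OF assms, of 1 "-1"] by simp_all

lemma tangent_cmult:
  assumes "v \<in> tangent_space A p" "f \<in> smooth_funs A"
  shows "v (\<lambda>x. c * f x) = c * v f"
  using tangent_lin[OF assms assms(2), of c 0] by simp

lemma tangent_sum:
  assumes v: "v \<in> tangent_space A p" and "finite I" "\<And>i. i \<in> I \<Longrightarrow> f i \<in> smooth_funs A"
  shows "v (\<lambda>x. \<Sum>i\<in>I. f i x) = (\<Sum>i\<in>I. v (f i))"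
  using assms(2,3)
proof (induction I rule: finite_induct)
  case empty
  then show ?case by (simp add: tangent_const[OF v])
next
  case (insert i I)
  then show ?case by (simp add: tangent_add[OF v] smooth_funs_sum)
qed

lemma tangent_space_lincomb:
  "u \<in> tangent_space A p \<Longrightarrow> v \<in> tangent_space A p \<Longrightarrow> lincomb a u b v \<in> tangent_space A p"
  unfolding tangent_space_def lincomb_def by (auto simp: algebra_simps)

lemma vector_fieldsD:
  "X \<in> vector_fields A \<Longrightarrow> X p \<in> tangent_space A p"
  "X \<in> vector_fields A \<Longrightarrow> f \<in> smooth_funs A \<Longrightarrow> (\<lambda>p. X p f) \<in> smooth_funs A"
  unfolding vector_fields_def by auto

lemma vector_fields_lincomb:
  assumes "X \<in> vector_fields A" "Y \<in> vector_fields A" "f \<in> smooth_funs A" "h \<in> smooth_funs A"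
  shows "(\<lambda>p. lincomb (f p) (X p) (h p) (Y p)) \<in> vector_fields A"
  using assms unfolding vector_fields_def
  by (auto simp: lincomb_def[abs_def, symmetric] intro: tangent_space_lincomb)
    (auto simp: lincomb_def intro!: smooth_funs_add smooth_funs_mult)

lemma vector_fields_lie_bracket:
  assumes X: "X \<in> vector_fields A" and Y: "Y \<in> vector_fields A"
  shows "lie_bracket X Y \<in> vector_fields A"
proof -
  note Xt = vector_fieldsD(1)[OF X] and Yt = vector_fieldsD(1)[OF Y]
  note Xf = vector_fieldsD(2)[OF X] and Yf = vector_fieldsD(2)[OF Y]
  have "lie_bracket X Y p \<in> tangent_space A p" for p
    unfolding tangent_space_def lie_bracket_def
  proof (intro CollectI conjI ballI allI impI)
    fix f h a b assume f: "f \<in> smooth_funs A" and h: "h \<in> smooth_funs A"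
    show "X p (\<lambda>q. Y q (\<lambda>x. a * f x + b * h x)) - Y p (\<lambda>q. X q (\<lambda>x. a * f x + b * h x)) =
        a * (X p (\<lambda>q. Y q f) - Y p (\<lambda>q. X q f)) + b * (X p (\<lambda>q. Y q h) - Y p (\<lambda>q. X q h))"
      by (simp add: tangent_lin[OF Xt] tangent_lin[OF Yt] f h Xf Yf algebra_simps)
    show "X p (\<lambda>q. Y q (\<lambda>x. f x * h x)) - Y p (\<lambda>q. X q (\<lambda>x. f x * h x)) =
        f p * (X p (\<lambda>q. Y q h) - Y p (\<lambda>q. X q h)) + h p * (X p (\<lambda>q. Y q f) - Y p (\<lambda>q. X q f))"
      using f h Xf Yf by (simp add: tangent_leibniz[OF Xt] tangent_leibniz[OF Yt]
        tangent_add[OF Xt] tangent_add[OF Yt] smooth_funs_mult algebra_simps)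
  next
    fix f assume "f \<notin> smooth_funs A"
    then show "X p (\<lambda>q. Y q f) - Y p (\<lambda>q. X q f) = 0"
      by (simp add: tangent_nonsmooth[OF Xt] tangent_nonsmooth[OF Yt] tangent_const[OF Xt] tangent_const[OF Yt])
  qed
  moreover have "(\<lambda>p. lie_bracket X Y p f) \<in> smooth_funs A" if "f \<in> smooth_funs A" for f
    unfolding lie_bracket_def using Xf Yf that by auto
  ultimately show ?thesis unfolding vector_fields_def by auto
qed

text \<open>The coordinates are those of a chart around \<open>p\<close>, multiplied by a bump function in order to
  make them global.\<close>

lemma tangent_coordinates:
  obtains ev :: "'m tvec \<Rightarrow> 'e"
  where "\<And>u v a b. u \<in> tangent_space A p \<Longrightarrow> v \<in> tangent_space A p \<Longrightarrow>
      ev (lincomb a u b v) = a *\<^sub>R ev u + b *\<^sub>R ev v"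
    and "\<And>v. v \<in> tangent_space A p \<Longrightarrow> ev v = 0 \<Longrightarrow> v = (\<lambda>f. 0)"
    and "\<And>e. \<exists>X\<in>vector_fields A. ev (X p) = e"
proof -
  obtain U \<kappa> where c: "(U, \<kappa>) \<in> A" and p: "p \<in> U" by (rule chart_at)
  define a where "a = \<kappa> p"
  have "a \<in> \<kappa> ` U" using p by (simp add: a_def)
  then obtain R where R: "R > 0" "ball a R \<subseteq> \<kappa> ` U"
    using chart(2)[OF c] open_contains_ball by blast
  \<comment> \<open>Half the radius, so that the support lies in a compact ball inside
    \<open>ball a R\<close> and therefore inside the chart.\<close>
  define b where "b = bump a (R / 2)"
  define K where "K = cball a (R / 2)"
  have K: "compact K" "K \<subseteq> ball a R" "K \<subseteq> \<kappa> ` U" "\<And>x. x \<notin> K \<Longrightarrow> b x = 0"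
    using R bump_zero[of "R / 2" _ a] by (auto simp: K_def b_def)
  have b: "smooth_on UNIV b" and ba: "b a > 0"
    using smooth_bump bump_centre[of "R / 2" a] R by (auto simp: b_def)
  define lift where "lift F q = (if q \<in> U then b (\<kappa> q) * F (\<kappa> q) else 0)" for F q
  have lift: "lift F \<in> smooth_funs A" if "smooth_on (ball a R) F" for F
  proof -
    have "smooth_on (ball a R) (\<lambda>x. b x * F x)"
      by (intro smooth_on_mult that open_ball smooth_on_subset[OF b]) auto
    then have "smooth_on UNIV (\<lambda>x. b x * F x)"
      by (rule smooth_on_zero_extension[OF open_ball K(1,2)]) (simp add: K(4))
    then have "smooth_on (\<kappa> ` U) (\<lambda>x. b x * F x)"
      by (rule smooth_on_subset) (auto intro: chart(2)[OF c])
    from lift_smooth[OF c this K(1,3)] show ?thesis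
      unfolding lift_def[abs_def] by (simp add: K(4))
  qed
  define B where "B = lift (\<lambda>x. 1)"
  define x where "x i = lift (\<lambda>y. (y - a) \<bullet> i)" for i
  have B: "B \<in> smooth_funs A" unfolding B_def by (intro lift smooth_on_const open_ball)
  have x: "x i \<in> smooth_funs A" for i
    unfolding x_def by (intro lift smooth_on_subset[OF smooth_coordinate]) auto
  have Bp: "B p = b a" and xp: "x i p = 0" for i
    using p by (simp_all add: B_def x_def lift_def a_def)
  define ev where "ev v = (\<Sum>i\<in>Basis. v (x i) *\<^sub>R i)" for v :: "'m tvec"

  have ev_lin: "ev (lincomb s u t v) = s *\<^sub>R ev u + t *\<^sub>R ev v" for s u t v
    by (simp add: ev_def lincomb_def scaleR_sum_right sum.distrib scaleR_left_distrib)

  have ev_inj: "v = (\<lambda>f. 0)" if v: "v \<in> tangent_space A p" and ev0: "ev v = 0" for v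
  proof
    fix f
    show "v f = 0"
    proof (cases "f \<in> smooth_funs A")
      case True
      have f: "smooth_on (ball a R) (f \<circ> inv_into U \<kappa>)"
        by (rule smooth_on_subset[OF smooth_funsD[OF True c] open_ball chart(2)[OF c] R(2)])
      obtain h where h: "\<And>i. smooth_on (ball a R) (h i)"
        "\<And>y. y \<in> ball a R \<Longrightarrow> (f \<circ> inv_into U \<kappa>) y =
          (f \<circ> inv_into U \<kappa>) a + (\<Sum>i\<in>Basis. ((y - a) \<bullet> i) * h i y)"
        using hadamard[OF f R(1)] by metis
      have vx: "v (x i) = 0" if "i \<in> Basis" for i
      proof -
        have "v (x i) = ev v \<bullet> i"
          using that by (simp add: ev_def inner_sum_left_Basis)
        then show ?thesis by (simp add: ev0)
      qed
      \<comment> \<open>The Hadamard expansion holds only near \<open>p\<close>. Multiplied by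
        \<open>B\<close> twice it becomes an identity of global functions, one factor going to the
        coordinate and one to its coefficient. On applying \<open>v\<close> the sum drops out, since
        \<open>x i p = 0\<close> and \<open>v (x i) = 0\<close>, and the terms with
        \<open>v B\<close> cancel.\<close>
      have eq: "B q * (B q * f q) = f p * (B q * B q) + (\<Sum>i\<in>Basis. x i q * lift (h i) q)" for q
      proof (cases "q \<in> U \<and> \<kappa> q \<in> ball a R")
        case True
        then have "f q = f p + (\<Sum>i\<in>Basis. ((\<kappa> q - a) \<bullet> i) * h i (\<kappa> q))"
          using h(2)[of "\<kappa> q"] p by (simp add: a_def chart(5)[OF c])
        then show ?thesis
          using True by (simp add: B_def x_def lift_def algebra_simps sum_distrib_left)
      next
        case False
        then have "b (\<kappa> q) = 0 \<or> q \<notin> U" using K(2,4) by blast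
        then show ?thesis by (auto simp: B_def x_def lift_def)
      qed
      have "v (\<lambda>q. B q * (B q * f q)) =
          v (\<lambda>q. f p * (B q * B q) + (\<Sum>i\<in>Basis. x i q * lift (h i) q))"
        by (rule arg_cong[of _ _ v]) (rule ext, rule eq)
      moreover have "v (\<lambda>q. B q * (B q * f q)) = B p * (B p * v f + f p * v B) + B p * f p * v B"
        by (simp add: tangent_leibniz[OF v] B True smooth_funs_mult)
      moreover have "v (\<lambda>q. f p * (B q * B q) + (\<Sum>i\<in>Basis. x i q * lift (h i) q)) =
          f p * (B p * v B + B p * v B)"
        using vx by (simp add: tangent_add[OF v] tangent_cmult[OF v] tangent_sum[OF v]
          tangent_leibniz[OF v] smooth_funs_mult smooth_funs_sum B x lift[OF h(1)] xp)
      ultimately have "B p * (B p * v f) = 0" by (simp add: algebra_simps)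
      then show ?thesis using ba Bp by simp
    qed (rule tangent_nonsmooth[OF v])
  qed

  \<comment> \<open>The constant coordinate field \<open>e\<close> times the bump, set to 0 on
    non-smooth functions as \<open>tangent_space\<close> demands.\<close>
  define Y where "Y e q f = (if q \<in> U \<and> f \<in> smooth_funs A
    then b (\<kappa> q) * frechet_derivative (f \<circ> inv_into U \<kappa>) (at (\<kappa> q)) e else 0)" for e q f
  have Y: "Y e \<in> vector_fields A" for e
    unfolding vector_fields_def
  proof (intro CollectI conjI allI ballI)
    fix q
    show "Y e q \<in> tangent_space A q"
    proof (cases "q \<in> U")
      case True
      have D: "((f \<circ> inv_into U \<kappa>) has_derivative frechet_derivative (f \<circ> inv_into U \<kappa>) (at (\<kappa> q))) (at (\<kappa> q))"
        if "f \<in> smooth_funs A" for f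
        using smooth_onD(1)[OF smooth_funsD[OF that c] chart(2)[OF c]] True by blast
      show ?thesis
        unfolding tangent_space_def
      proof (intro CollectI conjI ballI allI impI)
        fix f h s t assume f: "f \<in> smooth_funs A" and h: "h \<in> smooth_funs A"
        have lc: "(\<lambda>x. s * f x + t * h x) \<in> smooth_funs A"
          by (intro smooth_funs_add smooth_funs_mult smooth_funs_const f h)
        have "frechet_derivative ((\<lambda>x. s * f x + t * h x) \<circ> inv_into U \<kappa>) (at (\<kappa> q)) =
          (\<lambda>e. s * frechet_derivative (f \<circ> inv_into U \<kappa>) (at (\<kappa> q)) e +
               t * frechet_derivative (h \<circ> inv_into U \<kappa>) (at (\<kappa> q)) e)"
          using D[OF f] D[OF h] unfolding o_def
          by (intro frechet_derivative_at[symmetric] has_derivative_add has_derivative_mult_right)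
        then show "Y e q (\<lambda>x. s * f x + t * h x) = s * Y e q f + t * Y e q h"
          using f h lc True by (simp add: Y_def algebra_simps)
        have "frechet_derivative ((\<lambda>x. f x * h x) \<circ> inv_into U \<kappa>) (at (\<kappa> q)) =
          (\<lambda>e. (f \<circ> inv_into U \<kappa>) (\<kappa> q) * frechet_derivative (h \<circ> inv_into U \<kappa>) (at (\<kappa> q)) e +
               frechet_derivative (f \<circ> inv_into U \<kappa>) (at (\<kappa> q)) e * (h \<circ> inv_into U \<kappa>) (\<kappa> q))"
          using D[OF f] D[OF h] unfolding o_def
          by (intro frechet_derivative_at[symmetric] has_derivative_mult)
        then show "Y e q (\<lambda>x. f x * h x) = f q * Y e q h + h q * Y e q f"
          using f h smooth_funs_mult[OF f h] True by (simp add: Y_def chart(5)[OF c] algebra_simps)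
      qed (simp add: Y_def)
    next
      case False
      then show ?thesis by (simp add: tangent_space_def Y_def)
    qed
  next
    fix f assume f: "f \<in> smooth_funs A"
    let ?F = "\<lambda>y. b y * frechet_derivative (f \<circ> inv_into U \<kappa>) (at y) e"
    have "smooth_on (\<kappa> ` U) ?F"
      by (intro smooth_on_mult smooth_onD(2)[OF smooth_funsD[OF f c]] chart(2)[OF c] smooth_on_subset[OF b]) auto
    from lift_smooth[OF c this K(1,3)]
    have "(\<lambda>q. if q \<in> U then ?F (\<kappa> q) else 0) \<in> smooth_funs A" by (simp add: K(4))
    then show "(\<lambda>q. Y e q f) \<in> smooth_funs A" using f by (simp add: Y_def)
  qed
  \<comment> \<open>One factor \<open>b a\<close> is the bump in \<open>Y\<close>. The other is what
    remains of the derivative of \<open>b y * ((y - a) \<bullet> i)\<close> at \<open>a\<close>,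
    where the coordinate vanishes.\<close>
  have evY: "ev (Y e p) = (b a * b a) *\<^sub>R e" for e
  proof -
    have "Y e p (x i) = b a * b a * (e \<bullet> i)" for i
    proof -
      have "((\<lambda>y. b y * ((y - a) \<bullet> i)) has_derivative
          (\<lambda>e. b a * (e \<bullet> i) + frechet_derivative b (at a) e * ((a - a) \<bullet> i))) (at a)"
        using smooth_onD(1)[OF b open_UNIV, of a]
        by (intro has_derivative_mult) (auto intro!: derivative_eq_intros)
      then have "((\<lambda>y. b y * ((y - a) \<bullet> i)) has_derivative (\<lambda>e. b a * (e \<bullet> i))) (at a)" by simp
      then have "((x i \<circ> inv_into U \<kappa>) has_derivative (\<lambda>e. b a * (e \<bullet> i))) (at a)"
        by (rule has_derivative_transform_within_open[OF _ chart(2)[OF c]])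
          (use p in \<open>auto simp: a_def x_def lift_def chart(5)[OF c]\<close>)
      then have "frechet_derivative (x i \<circ> inv_into U \<kappa>) (at a) = (\<lambda>e. b a * (e \<bullet> i))"
        using frechet_derivative_at by metis
      then show ?thesis using p x by (simp add: Y_def a_def)
    qed
    then show ?thesis
      by (simp add: ev_def euclidean_representation flip: scaleR_scaleR scaleR_sum_right)
  qed
  have "\<exists>X\<in>vector_fields A. ev (X p) = e" for e
    using Y[of "(1 / (b a * b a)) *\<^sub>R e"] evY[of "(1 / (b a * b a)) *\<^sub>R e"] ba by (intro bexI) auto
  then show ?thesis using that[of ev] ev_lin ev_inj by blast
qed

end

subsection \<open>Powers of an alternating bilinear form\<close>

text \<open>The value of \<open>wedge_power\<close> at one point, with a bilinear form for the
  2-form and vectors for fields. Recursion and normalisation are those of \<open>wedge\<close>, so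
  the two agree term by term under evaluation.\<close>

fun alt_power :: "('a \<Rightarrow> 'a \<Rightarrow> real) \<Rightarrow> nat \<Rightarrow> (nat \<Rightarrow> 'a) \<Rightarrow> real" where
  "alt_power w 0 u = 1"
| "alt_power w (Suc n) u = 1 / fact (2 + 2 * n) *
    (\<Sum>\<sigma> | \<sigma> permutes {..<2 + 2 * n}.
       of_int (sign \<sigma>) * w (u (\<sigma> 0)) (u (\<sigma> 1)) * alt_power w n (\<lambda>i. u (\<sigma> (2 + i))))"

lemma alt_power_cong:
  assumes "\<And>i j. i < 2 * n \<Longrightarrow> j < 2 * n \<Longrightarrow> w (u i) (u j) = w' (u' i) (u' j)"
  shows "alt_power w n u = alt_power w' n u'"
  using assms
proof (induction n arbitrary: u u')
  case (Suc n)
  show ?case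
    unfolding alt_power.simps
  proof (intro arg_cong2[where f = "(*)"] refl sum.cong)
    fix \<sigma> assume "\<sigma> \<in> {\<sigma>. \<sigma> permutes {..<2 + 2 * n}}"
    then have \<sigma>: "i < 2 + 2 * n \<Longrightarrow> \<sigma> i < 2 + 2 * n" for i
      using permutes_in_image[of \<sigma> "{..<2 + 2 * n}" i] by auto
    show "w (u (\<sigma> 0)) (u (\<sigma> 1)) = w' (u' (\<sigma> 0)) (u' (\<sigma> 1))"
      using Suc.prems[of "\<sigma> 0" "\<sigma> 1"] \<sigma>[of 0] \<sigma>[of 1] by simp
    show "alt_power w n (\<lambda>i. u (\<sigma> (2 + i))) = alt_power w' n (\<lambda>i. u' (\<sigma> (2 + i)))"
    proof (rule Suc.IH)
      fix i j assume "i < 2 * n" "j < 2 * n"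
      then show "w (u (\<sigma> (2 + i))) (u (\<sigma> (2 + j))) = w' (u' (\<sigma> (2 + i))) (u' (\<sigma> (2 + j)))"
        using Suc.prems[of "\<sigma> (2 + i)" "\<sigma> (2 + j)"] \<sigma>[of "2 + i"] \<sigma>[of "2 + j"] by simp
    qed
  qed
qed simp

text \<open>Composition with \<tau> permutes the summands, and the sign is multiplicative: the
  antisymmetry comes from the sum over all permutations.\<close>

lemma alt_power_permute:
  assumes "\<tau> permutes {..<2 * n}"
  shows "alt_power w n (\<lambda>i. u (\<tau> i)) = of_int (sign \<tau>) * alt_power w n u"
proof (cases n)
  case 0
  then show ?thesis using assms by simp
next
  case (Suc m)
  let ?S = "{..<2 + 2 * m}"
  let ?t = "\<lambda>\<sigma>. of_int (sign \<sigma>) * w (u (\<sigma> 0)) (u (\<sigma> 1)) * alt_power w m (\<lambda>i. u (\<sigma> (2 + i)))"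
  have \<tau>: "\<tau> permutes ?S" using assms Suc by simp
  have "(\<Sum>\<sigma> | \<sigma> permutes ?S. ?t \<sigma>) = (\<Sum>\<sigma> | \<sigma> permutes ?S. ?t (\<tau> \<circ> \<sigma>))"
    by (rule setum_permutations_compose_left[OF \<tau>])
  also have "\<dots> = (\<Sum>\<sigma> | \<sigma> permutes ?S. of_int (sign \<tau>) *
      (of_int (sign \<sigma>) * w (u (\<tau> (\<sigma> 0))) (u (\<tau> (\<sigma> 1))) * alt_power w m (\<lambda>i. u (\<tau> (\<sigma> (2 + i))))))"
    by (intro sum.cong refl)
      (use \<tau> in \<open>simp add: sign_compose permutes_imp_permutation[of ?S]\<close>)
  finally have "(\<Sum>\<sigma> | \<sigma> permutes ?S. ?t \<sigma>) = of_int (sign \<tau>) *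
      (\<Sum>\<sigma> | \<sigma> permutes ?S. of_int (sign \<sigma>) *
        w (u (\<tau> (\<sigma> 0))) (u (\<tau> (\<sigma> 1))) * alt_power w m (\<lambda>i. u (\<tau> (\<sigma> (2 + i)))))"
    by (simp only: sum_distrib_left)
  moreover have "of_int (sign \<tau>) * (of_int (sign \<tau>) * x) = (x :: real)" for x
    by (cases \<tau> rule: sign_cases) simp_all
  ultimately show ?thesis
    unfolding Suc alt_power.simps by (simp only: mult.left_commute[of "1 / _"])
qed

lemma alt_power_repeat:
  assumes "i < 2 * n" "j < 2 * n" "i \<noteq> j" "u i = u j"
  shows "alt_power w n u = 0"
proof -
  have "(\<lambda>k. u (Transposition.transpose i j k)) = u"
    using assms(4) by (auto simp: Transposition.transpose_def)
  then have "alt_power w n u = - alt_power w n u"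
    using alt_power_permute[of "Transposition.transpose i j" n w u] assms permutes_swap_id[of i "{..<2 * n}" j]
    by (simp add: sign_swap_id)
  then show ?thesis by simp
qed

text \<open>In each summand the slot \<open>j\<close> occurs exactly once: as first or second
  argument of \<open>w\<close>, or inside the smaller power.\<close>

lemma linear_alt_power:
  assumes "bilinear w" "j < 2 * n"
  shows "linear (\<lambda>x. alt_power w n (u(j := x)))"
  using assms(2)
proof (induction n arbitrary: u j)
  case (Suc n)
  have w: "linear (\<lambda>x. w x y)" "linear (w x)" for x y
    using assms(1) by (auto simp: bilinear_def)
  have "linear (\<lambda>x. of_int (sign \<sigma>) * w ((u(j := x)) (\<sigma> 0)) ((u(j := x)) (\<sigma> 1)) *
      alt_power w n (\<lambda>i. (u(j := x)) (\<sigma> (2 + i))))" if \<sigma>: "\<sigma> permutes {..<2 + 2 * n}" for \<sigma>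
  proof -
    have inj: "\<sigma> x = \<sigma> y \<longleftrightarrow> x = y" for x y
      using permutes_inj[OF \<sigma>] by (auto dest: injD)
    obtain k where k: "\<sigma> k = j" using permutes_surj[OF \<sigma>] by (metis surjD)
    have k': "k < 2 + 2 * n" using k Suc.prems permutes_in_image[OF \<sigma>, of k] by simp
    consider "k = 0" | "k = 1" | "k \<ge> 2" by linarith
    then show ?thesis
    proof cases
      case 1
      then have j: "j = \<sigma> 0" using k by simp
      show ?thesis unfolding j
        using linear_compose[OF linear_compose[OF w(1)[of "u (\<sigma> 1)"] linear_times[of "of_int (sign \<sigma>)"]]
            linear_times[of "alt_power w n (\<lambda>i. u (\<sigma> (2 + i)))"]]
        by (simp add: inj o_def mult_ac)
    next
      case 2
      then have j: "j = \<sigma> 1" using k by simp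
      show ?thesis unfolding j
        using linear_compose[OF linear_compose[OF w(2)[of "u (\<sigma> 0)"] linear_times[of "of_int (sign \<sigma>)"]]
            linear_times[of "alt_power w n (\<lambda>i. u (\<sigma> (2 + i)))"]]
        by (simp add: inj o_def mult_ac)
    next
      case 3
      define m where "m = k - 2"
      have j: "j = \<sigma> (2 + m)" using 3 k le_add_diff_inverse[OF 3] by (simp only: m_def)
      have m: "m < 2 * n" using k' 3 by (simp add: m_def)
      have eq: "(\<lambda>i. (u(j := x)) (\<sigma> (2 + i))) = (\<lambda>i. u (\<sigma> (2 + i)))(m := x)" for x
        by (auto simp: j inj)
      have ne: "\<sigma> 0 \<noteq> j" "\<sigma> 1 \<noteq> j" by (auto simp: j inj)
      show ?thesis unfolding eq
        using linear_compose[OF Suc.IH[OF m, of "\<lambda>i. u (\<sigma> (2 + i))"],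
            of "\<lambda>z. (of_int (sign \<sigma>) * w (u (\<sigma> 0)) (u (\<sigma> 1))) * z"] ne
        by (simp add: o_def linear_times fun_upd_def)
    qed
  qed
  then have "linear (\<lambda>x. \<Sum>\<sigma> | \<sigma> permutes {..<2 + 2 * n}. of_int (sign \<sigma>) *
      w ((u(j := x)) (\<sigma> 0)) ((u(j := x)) (\<sigma> 1)) * alt_power w n (\<lambda>i. (u(j := x)) (\<sigma> (2 + i))))"
    by (intro linear_compose_sum) auto
  from linear_compose[OF this linear_times[of "1 / fact (2 + 2 * n)"]]
  show ?case by (simp only: o_def alt_power.simps)
qed simp

text \<open>\<open>Z\<close> lies in the radical of \<open>w\<close>, so each argument may be
  replaced by its component in the span of \<open>R\<close>. More than \<open>card R\<close> such
  vectors are dependent, and an alternating multilinear function vanishes on them.\<close>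

lemma alt_power_eq_0:
  fixes w :: "'a::euclidean_space \<Rightarrow> 'a \<Rightarrow> real"
  assumes w: "bilinear w" and R: "finite R" "card R < 2 * n" "span (R \<union> Z) = UNIV"
    and Z: "\<And>z v. z \<in> Z \<Longrightarrow> w z v = 0" "\<And>z v. z \<in> Z \<Longrightarrow> w v z = 0"
  shows "alt_power w n u = 0"
proof -
  have lin: "linear (\<lambda>x. w x y)" "linear (w x)" for x y
    using w by (auto simp: bilinear_def)
  have Z': "w z v = 0 \<and> w v z = 0" if "z \<in> span Z" for z v
    using that
  proof (induction rule: span_induct_alt)
    case base
    then show ?case using linear_0[OF lin(1)] linear_0[OF lin(2)] by simp
  next
    case (step c x y)
    then show ?case
      using Z[of x v] by (simp add: linear_add[OF lin(1)] linear_add[OF lin(2)]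
        linear_cmul[OF lin(1)] linear_cmul[OF lin(2)])
  qed
  have "\<exists>r\<in>span R. u i - r \<in> span Z" for i
  proof -
    have "u i \<in> span (R \<union> Z)" using R(3) by simp
    then obtain r z where "u i = r + z" "r \<in> span R" "z \<in> span Z"
      by (auto simp: span_Un)
    then show ?thesis by (intro bexI[of _ r]) auto
  qed
  then obtain r where r: "r i \<in> span R" "u i - r i \<in> span Z" for i by metis
  have "w (u i) (u j) = w (r i) (r j)" for i j
  proof -
    have "w (u i) (u j) = w (r i + (u i - r i)) (r j + (u j - r j))" by simp
    also have "\<dots> = w (r i) (r j)"
      using Z'[OF r(2)[of i]] Z'[OF r(2)[of j]]
      by (simp only: linear_add[OF lin(1)] linear_add[OF lin(2)])
    finally show ?thesis .
  qed
  then have eq: "alt_power w n u = alt_power w n r" by (intro alt_power_cong)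
  let ?I = "{..<2 * n}"
  show ?thesis
  proof (cases "inj_on r ?I \<and> independent (r ` ?I)")
    case True
    then have "2 * n \<le> card R"
      using independent_span_bound[OF R(1), of "r ` ?I"] r(1) card_image[of r ?I] by auto
    then show ?thesis using R by simp
  next
    case False
    \<comment> \<open>Dependence of a family rather than of a set: a repeated value also lies in the
      span of the other members.\<close>
    have "\<exists>j<2 * n. r j \<in> span (r ` (?I - {j}))"
    proof (cases "inj_on r ?I")
      case True
      then have "dependent (r ` ?I)" using False by simp
      then obtain j where "j < 2 * n" "r j \<in> span (r ` ?I - {r j})" by (auto simp: dependent_def)
      moreover have "r ` ?I - {r j} \<subseteq> r ` (?I - {j})" by auto
      ultimately show ?thesis using span_mono by blast
    next
      case False
      then obtain i j where "i < 2 * n" "j < 2 * n" "i \<noteq> j" "r i = r j" by (auto simp: inj_on_def)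
      then show ?thesis by (intro exI[of _ j] conjI span_base) (auto intro!: image_eqI[of _ _ i])
    qed
    then obtain j where j: "j < 2 * n" "r j \<in> span (r ` (?I - {j}))" by auto
    let ?h = "\<lambda>x. alt_power w n (r(j := x))"
    have "?h x = 0" if "x \<in> span (r ` (?I - {j}))" for x
      using that
    proof (rule linear_eq_0_on_span[OF linear_alt_power[OF w j(1)], rotated])
      fix x assume "x \<in> r ` (?I - {j})"
      then obtain i where "i < 2 * n" "i \<noteq> j" "x = r i" by auto
      then show "?h x = 0" using j by (intro alt_power_repeat[of i n j]) auto
    qed
    from this[OF j(2)] show ?thesis by (simp add: eq)
  qed
qed

section \<open>Permutations fixing a point, and powers evaluated on symplectic sequences\<close>

definition shift_perm :: "(nat \<Rightarrow> nat) \<Rightarrow> nat \<Rightarrow> nat" where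
  "shift_perm \<tau> i = (case i of 0 \<Rightarrow> 0 | Suc j \<Rightarrow> Suc (\<tau> j))"

text \<open>Shifting turns a transposition into a transposition, so the sign survives an induction
  over transpositions.\<close>

lemma sign_shift_perm:
  assumes "\<tau> permutes {..<n}"
  shows "sign (shift_perm \<tau>) = sign \<tau>" "permutation (shift_perm \<tau>)"
proof -
  have "sign (shift_perm \<tau>) = sign \<tau> \<and> permutation (shift_perm \<tau>)"
    using assms finite_lessThan
  proof (induction rule: permutes_induct)
    case id
    have "shift_perm id = id" by (auto simp: shift_perm_def fun_eq_iff split: nat.split)
    then show ?case by (simp only: sign_id permutation_id)
  next
    case (swap a b p)
    have "shift_perm (Transposition.transpose a b \<circ> p) = Transposition.transpose (Suc a) (Suc b) \<circ> shift_perm p"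
      by (auto simp: shift_perm_def fun_eq_iff Transposition.transpose_def split: nat.split)
    moreover have "permutation p"
      using swap finite_lessThan permutation_permutes by blast
    ultimately show ?case
      using swap by (simp only: sign_compose permutation_swap_id sign_swap_id permutation_compose) simp
  qed
  then show "sign (shift_perm \<tau>) = sign \<tau>" "permutation (shift_perm \<tau>)" by auto
qed

lemma permutes_fix_0:
  assumes "\<sigma> permutes {..<Suc n}" "\<sigma> 0 = 0"
  obtains \<tau> where "\<tau> permutes {..<n}" "\<And>i. \<sigma> (Suc i) = Suc (\<tau> i)" "sign \<tau> = sign \<sigma>"
proof -
  have inj: "\<sigma> x = \<sigma> y \<longleftrightarrow> x = y" for x y
    using permutes_inj[OF assms(1)] by (auto dest: injD)
  define \<tau> where "\<tau> i = \<sigma> (Suc i) - 1" for i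
  have \<tau>: "\<sigma> (Suc i) = Suc (\<tau> i)" for i
    using inj[of "Suc i" 0] assms(2) by (simp add: \<tau>_def)
  have "\<tau> permutes {..<n}"
  proof (rule bij_imp_permutes)
    have "inj_on \<tau> {..<n}" using \<tau> inj by (metis inj_onI nat.inject)
    moreover have "\<tau> ` {..<n} \<subseteq> {..<n}"
      using \<tau> permutes_in_image[OF assms(1)] by (metis Suc_less_eq image_subsetI lessThan_iff)
    ultimately show "bij_betw \<tau> {..<n} {..<n}"
      by (simp add: bij_betw_def endo_inj_surj)
    show "\<tau> x = x" if "x \<notin> {..<n}" for x
      using that permutes_not_in[OF assms(1), of "Suc x"] \<tau>[of x] by simp
  qed
  moreover have "\<sigma> = shift_perm \<tau>"
    using assms(2) \<tau> by (auto simp: fun_eq_iff shift_perm_def split: nat.split)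
  ultimately show ?thesis using that[of \<tau>] sign_shift_perm[of \<tau> n] \<tau> by simp
qed

text \<open>A Darboux sequence scaled by \<open>s\<close>: consecutive entries form hyperbolic
  pairs, and different pairs are orthogonal. The scale may have either sign;
  \<open>- (k / 2)\<close> and \<open>- 1\<close> occur later.\<close>

definition symplectic_seq :: "('a \<Rightarrow> 'a \<Rightarrow> real) \<Rightarrow> real \<Rightarrow> nat \<Rightarrow> (nat \<Rightarrow> 'a) \<Rightarrow> bool" where
  "symplectic_seq w s n e \<longleftrightarrow> (\<forall>i<n. \<forall>j<n. w (e (2 * i)) (e (2 * j)) = 0 \<and>
     w (e (2 * i + 1)) (e (2 * j + 1)) = 0 \<and>
     w (e (2 * i)) (e (2 * j + 1)) = (if i = j then s else 0) \<and>
     w (e (2 * j + 1)) (e (2 * i)) = (if i = j then - s else 0))"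

lemma symplectic_seq_nonzero:
  assumes "symplectic_seq w s n e" "w (e x) (e y) \<noteq> 0" "x < 2 * n" "y < 2 * n"
  obtains m where "m < n" "x = 2 * m" "y = 2 * m + 1" | m where "m < n" "x = 2 * m + 1" "y = 2 * m"
proof -
  have *: "x div 2 < n" "y div 2 < n" using assms by auto
  have x: "x = 2 * (x div 2) \<or> x = 2 * (x div 2) + 1" and y: "y = 2 * (y div 2) \<or> y = 2 * (y div 2) + 1"
    by presburger+
  from assms(1) * have "w (e (2 * (x div 2))) (e (2 * (y div 2))) = 0"
     "w (e (2 * (x div 2) + 1)) (e (2 * (y div 2) + 1)) = 0"
     "w (e (2 * (x div 2))) (e (2 * (y div 2) + 1)) = (if x div 2 = y div 2 then s else 0)"
     "w (e (2 * (x div 2) + 1)) (e (2 * (y div 2))) = (if x div 2 = y div 2 then - s else 0)"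
    unfolding symplectic_seq_def by (blast, blast, blast, metis)
  then have "x div 2 = y div 2 \<and> (x = 2 * (x div 2) \<and> y = 2 * (y div 2) + 1
     \<or> x = 2 * (x div 2) + 1 \<and> y = 2 * (y div 2))"
    using x y assms(2) by metis
  then show ?thesis using that * by metis
qed

text \<open>Every term of the defining sum has the sign of \<open>s ^ n\<close>: a permutation whose term does not
  vanish maps the first pair to another pair, and moving that pair to the front is an even
  permutation.\<close>

lemma alt_power_symplectic_pos:
  assumes "symplectic_seq w s n e" "s \<noteq> 0"
  shows "s ^ n * alt_power w n e > 0"
  using assms(1)
proof (induction n arbitrary: e)
  case (Suc n)
  let ?S = "{..<2 + 2 * n}"
  \<comment> \<open>Distributing the factors of \<open>s ^ Suc n\<close> over each summand makes
    every nonzero summand positive, whatever the sign of \<open>s\<close>.\<close>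
  define t where "t \<sigma> = of_int (sign \<sigma>) * (s * w (e (\<sigma> 0)) (e (\<sigma> 1))) *
    (s ^ n * alt_power w n (\<lambda>i. e (\<sigma> (2 + i))))" for \<sigma>
  have front: "t \<sigma> > 0" if \<sigma>: "\<sigma> permutes ?S"
    and \<sigma>01: "\<sigma> 0 = 2 * m \<and> \<sigma> 1 = 2 * m + 1 \<or> \<sigma> 0 = 2 * m + 1 \<and> \<sigma> 1 = 2 * m"
    and m: "m < Suc n" for \<sigma> m
  proof -
    \<comment> \<open>Exchanges the pair at 0, 1 with the pair at \<open>2 * m\<close>,
      \<open>2 * m + 1\<close>; two transpositions, hence an even permutation.\<close>
    define \<pi> where "\<pi> = Transposition.transpose (0::nat) (2 * m) \<circ> Transposition.transpose 1 (2 * m + 1)"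
    \<comment> \<open>Undoes a reversal of the pair. The sign it costs is the sign that
      \<open>w\<close> picks up on the reversed pair, so the two cancel.\<close>
    define \<epsilon> where "\<epsilon> = (if \<sigma> 0 = 2 * m then id else Transposition.transpose (0::nat) 1)"
    have \<pi>_perm: "\<pi> permutes ?S" unfolding \<pi>_def
      using m by (intro permutes_compose permutes_swap_id) auto
    have \<epsilon>_perm: "\<epsilon> permutes ?S" unfolding \<epsilon>_def
      by (auto intro!: permutes_swap_id permutes_id)
    have perm: "permutation p" if "p permutes ?S" for p
      using that finite_lessThan permutation_permutes by blast
    have \<pi>_sign: "sign \<pi> = 1"
      unfolding \<pi>_def by (simp add: sign_compose permutation_swap_id sign_swap_id)
    have \<pi>\<pi>: "\<pi> (\<pi> i) = i" for i by (auto simp: \<pi>_def Transposition.transpose_def)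
    have \<epsilon>\<epsilon>: "\<epsilon> (\<epsilon> i) = i" for i by (auto simp: \<epsilon>_def)
    define \<tau> where "\<tau> = \<epsilon> \<circ> (\<pi> \<circ> \<sigma>)"
    have \<tau>_perm: "\<tau> permutes {..<Suc (Suc (2 * n))}"
      using permutes_compose[OF permutes_compose[OF \<sigma> \<pi>_perm] \<epsilon>_perm] by (simp add: \<tau>_def)
    have "\<tau> 0 = 0" "\<tau> 1 = 1"
      using \<sigma>01 by (auto simp: \<tau>_def \<epsilon>_def \<pi>_def Transposition.transpose_def)
    obtain \<tau>' where \<tau>': "\<tau>' permutes {..<Suc (2 * n)}" "\<And>i. \<tau> (Suc i) = Suc (\<tau>' i)" "sign \<tau>' = sign \<tau>"
      using permutes_fix_0[OF \<tau>_perm \<open>\<tau> 0 = 0\<close>] by metis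
    have "\<tau>' 0 = 0" using \<tau>'(2)[of 0] \<open>\<tau> 1 = 1\<close> by simp
    then obtain \<rho> where \<rho>: "\<rho> permutes {..<2 * n}" "\<And>i. \<tau>' (Suc i) = Suc (\<rho> i)" "sign \<rho> = sign \<tau>'"
      using permutes_fix_0[OF \<tau>'(1)] by metis
    have sgn: "sign \<sigma> = sign \<epsilon> * sign \<rho>"
    proof -
      have "sign \<tau> = sign \<epsilon> * sign \<sigma>"
        using perm[OF \<sigma>] perm[OF \<pi>_perm] perm[OF \<epsilon>_perm]
        by (simp add: \<tau>_def sign_compose permutation_compose \<pi>_sign)
      moreover have "sign \<epsilon> * sign \<epsilon> = 1" by (simp add: sign_idempotent)
      ultimately show ?thesis using \<rho>(3) \<tau>'(3) by (metis mult.assoc mult_1)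
    qed
    define e' where "e' i = e (\<pi> (2 + i))" for i
    have \<sigma>_eq: "e (\<sigma> (2 + i)) = e' (\<rho> i)" for i
    proof -
      have "\<tau> (2 + i) = 2 + \<rho> i" using \<tau>'(2)[of "Suc i"] \<rho>(2)[of i] by simp
      then have "\<epsilon> (\<epsilon> (\<pi> (\<sigma> (2 + i)))) = \<epsilon> (2 + \<rho> i)" by (simp add: \<tau>_def)
      then have "\<pi> (\<sigma> (2 + i)) = 2 + \<rho> i" unfolding \<epsilon>\<epsilon> by (simp add: \<epsilon>_def Transposition.transpose_def)
      then show ?thesis unfolding e'_def by (metis \<pi>\<pi>)
    qed
    have "symplectic_seq w s n e'"
    proof -
      \<comment> \<open>The permutation of pair numbers induced by \<pi>. Leaving out
        \<open>b 0 = m\<close> keeps the \<open>n\<close> other pairs.\<close>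
      define b where "b = Transposition.transpose 0 m"
      have 1: "\<pi> (2 * i) = 2 * b i" "\<pi> (2 * i + 1) = 2 * b i + 1" for i
        by (auto simp: \<pi>_def b_def Transposition.transpose_def) presburger+
      have "e' (2 * i) = e (2 * b (Suc i))" "e' (2 * i + 1) = e (2 * b (Suc i) + 1)" for i
        using 1[of "Suc i"] by (auto simp: e'_def)
      moreover have "b (Suc i) < Suc n" if "i < n" for i using that m by (auto simp: b_def Transposition.transpose_def)
      moreover have "b (Suc i) = b (Suc j) \<longleftrightarrow> i = j" for i j by (auto simp: b_def Transposition.transpose_def)
      ultimately show ?thesis using Suc.prems unfolding symplectic_seq_def by simp
    qed
    then have pos: "s ^ n * alt_power w n e' > 0" by (rule Suc.IH)
    have w_eq: "w (e (\<sigma> 0)) (e (\<sigma> 1)) = of_int (sign \<epsilon>) * s"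
      using Suc.prems m \<sigma>01 unfolding symplectic_seq_def
      by (auto simp: \<epsilon>_def sign_swap_id)
    have sq: "of_int (sign p) * of_int (sign p) = (1::real)" for p :: "nat \<Rightarrow> nat"
      by (metis of_int_1 of_int_mult sign_idempotent)
    have "t \<sigma> = (of_int (sign \<epsilon>) * of_int (sign \<epsilon>)) * (of_int (sign \<rho>) * of_int (sign \<rho>)) * (s * s) *
        (s ^ n * alt_power w n e')"
      unfolding t_def \<sigma>_eq alt_power_permute[OF \<rho>(1)] w_eq sgn by simp
    then show ?thesis using pos assms(2) unfolding sq
      by (metis mult_1 mult_pos_pos not_real_square_gt_zero)
  qed
  have nonneg: "t \<sigma> \<ge> 0" if "\<sigma> permutes ?S" for \<sigma>
  proof (cases "w (e (\<sigma> 0)) (e (\<sigma> 1)) = 0")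
    case False
    have "\<sigma> 0 < 2 * Suc n" "\<sigma> 1 < 2 * Suc n"
      using permutes_in_image[OF that, of 0] permutes_in_image[OF that, of 1] by auto
    then have "t \<sigma> > 0"
      by (rule symplectic_seq_nonzero[OF Suc.prems False]) (use front[OF that] in auto)
    then show ?thesis by simp
  qed (simp add: t_def)
  have "0 < t id" using front[of id 0] by (simp add: permutes_id)
  also have "t id \<le> (\<Sum>\<sigma> | \<sigma> permutes ?S. t \<sigma>)"
    by (rule member_le_sum) (use nonneg in \<open>simp_all only: mem_Collect_eq permutes_id finite_permutations finite_lessThan Diff_iff\<close>)
  finally have "0 < (\<Sum>\<sigma> | \<sigma> permutes ?S. t \<sigma>)" .
  moreover have "s ^ Suc n * alt_power w (Suc n) e = 1 / fact (2 + 2 * n) * (\<Sum>\<sigma> | \<sigma> permutes ?S. t \<sigma>)"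
    by (simp add: t_def sum_distrib_left mult_ac)
  ultimately show ?case by simp
qed simp

text \<open>Since \<open>h\<close> vanishes on all entries but the first, only permutations fixing 0
  contribute, and each contributes the same number. Multiplying the sum by that number makes every
  contribution a square.\<close>

lemma wedge_alt_power_nonzero:
  assumes "symplectic_seq w s n (\<lambda>i. e (Suc i))" "s \<noteq> 0"
    and h: "h (e 0) \<noteq> 0" "\<And>i. 0 < i \<Longrightarrow> i < 1 + 2 * n \<Longrightarrow> h (e i) = 0"
  shows "(\<Sum>\<sigma> | \<sigma> permutes {..<1 + 2 * n}.
    of_int (sign \<sigma>) * h (e (\<sigma> 0)) * alt_power w n (\<lambda>i. e (\<sigma> (1 + i)))) \<noteq> (0::real)"
proof -
  let ?S = "{..<1 + 2 * n}"
  define a where "a = alt_power w n (\<lambda>i. e (Suc i))"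
  have a: "a \<noteq> 0" using alt_power_symplectic_pos[OF assms(1,2)] by (auto simp: a_def)
  define t where "t \<sigma> = of_int (sign \<sigma>) * h (e (\<sigma> 0)) * alt_power w n (\<lambda>i. e (\<sigma> (1 + i))) * (h (e 0) * a)" for \<sigma>
  have t: "t \<sigma> = (if \<sigma> 0 = 0 then (h (e 0) * a)\<^sup>2 else 0)" if \<sigma>: "\<sigma> permutes ?S" for \<sigma>
  proof (cases "\<sigma> 0 = 0")
    case True
    obtain \<tau> where \<tau>: "\<tau> permutes {..<2 * n}" "\<And>i. \<sigma> (Suc i) = Suc (\<tau> i)" "sign \<tau> = sign \<sigma>"
      using permutes_fix_0[of \<sigma> "2 * n"] \<sigma> True by auto
    have "of_int (sign \<sigma>) * of_int (sign \<sigma>) = (1::real)"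
      by (metis of_int_1 of_int_mult sign_idempotent)
    then show ?thesis
      using alt_power_permute[OF \<tau>(1), of w "\<lambda>i. e (Suc i)"] True
      by (simp add: t_def \<tau> a_def power2_eq_square mult_ac)
  next
    case False
    moreover have "\<sigma> 0 < 1 + 2 * n" using permutes_in_image[OF \<sigma>, of 0] by simp
    ultimately show ?thesis using h(2)[of "\<sigma> 0"] by (simp add: t_def)
  qed
  have "0 < t id" using t[of id] a h(1) by (simp add: permutes_id)
  also have "t id \<le> (\<Sum>\<sigma> | \<sigma> permutes ?S. t \<sigma>)"
    by (rule member_le_sum) (simp_all only: mem_Collect_eq permutes_id finite_permutations finite_lessThan Diff_iff t, simp)
  finally show ?thesis by (auto simp: t_def simp flip: sum_distrib_right)
qed

subsection \<open>Quasi-Sasakian structures as an algebra of vector fields\<close>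

text \<open>Vector fields as a Lie-Rinehart algebra over a ring of functions, with carriers
  \<open>F\<close> and \<open>V\<close>. Nondegeneracy of the metric stands in for positivity, and
  the module laws of \<open>sm\<close> are derived from it (\<open>sm_simps\<close>). The ring need
  not allow division by 2 or 3, so exterior derivatives appear without their factors.\<close>

locale metric_lie =
  fixes F :: "'f::comm_ring_1 set" and V :: "'v::ab_group_add set"
    and sm :: "'f \<Rightarrow> 'v \<Rightarrow> 'v" and act :: "'v \<Rightarrow> 'f \<Rightarrow> 'f" and br :: "'v \<Rightarrow> 'v \<Rightarrow> 'v"
    and g :: "'v \<Rightarrow> 'v \<Rightarrow> 'f"
  assumes F_closed [simp]: "0 \<in> F" "1 \<in> F" "f \<in> F \<Longrightarrow> - f \<in> F"
      "f \<in> F \<Longrightarrow> h \<in> F \<Longrightarrow> f + h \<in> F" "f \<in> F \<Longrightarrow> h \<in> F \<Longrightarrow> f * h \<in> F"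
    and V_closed [simp]: "X \<in> V \<Longrightarrow> - X \<in> V" "X \<in> V \<Longrightarrow> Y \<in> V \<Longrightarrow> X + Y \<in> V"
      "f \<in> F \<Longrightarrow> X \<in> V \<Longrightarrow> sm f X \<in> V" "X \<in> V \<Longrightarrow> Y \<in> V \<Longrightarrow> br X Y \<in> V"
    and act_closed [simp]: "X \<in> V \<Longrightarrow> f \<in> F \<Longrightarrow> act X f \<in> F"
    and act_add: "X \<in> V \<Longrightarrow> f \<in> F \<Longrightarrow> h \<in> F \<Longrightarrow> act X (f + h) = act X f + act X h"
    and act_mult: "X \<in> V \<Longrightarrow> f \<in> F \<Longrightarrow> h \<in> F \<Longrightarrow> act X (f * h) = f * act X h + h * act X f"
    and act_br: "X \<in> V \<Longrightarrow> Y \<in> V \<Longrightarrow> f \<in> F \<Longrightarrow> act (br X Y) f = act X (act Y f) - act Y (act X f)"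
    and br_antisym: "X \<in> V \<Longrightarrow> Y \<in> V \<Longrightarrow> br X Y = - br Y X"
    and br_self: "X \<in> V \<Longrightarrow> br X X = 0"
    and br_add: "X \<in> V \<Longrightarrow> Y \<in> V \<Longrightarrow> Z \<in> V \<Longrightarrow> br X (Y + Z) = br X Y + br X Z"
    and jacobi: "X \<in> V \<Longrightarrow> Y \<in> V \<Longrightarrow> Z \<in> V \<Longrightarrow> br X (br Y Z) = br (br X Y) Z + br Y (br X Z)"
    and br_sm: "X \<in> V \<Longrightarrow> Y \<in> V \<Longrightarrow> f \<in> F \<Longrightarrow> br X (sm f Y) = sm (act X f) Y + sm f (br X Y)"
    and g_closed [simp]: "X \<in> V \<Longrightarrow> Y \<in> V \<Longrightarrow> g X Y \<in> F"
    and g_sym: "X \<in> V \<Longrightarrow> Y \<in> V \<Longrightarrow> g X Y = g Y X"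
    and g_add: "X \<in> V \<Longrightarrow> Y \<in> V \<Longrightarrow> Z \<in> V \<Longrightarrow> g (X + Y) Z = g X Z + g Y Z"
    and g_sm: "f \<in> F \<Longrightarrow> X \<in> V \<Longrightarrow> Z \<in> V \<Longrightarrow> g (sm f X) Z = f * g X Z"
    and g_nondeg: "X \<in> V \<Longrightarrow> (\<And>Y. Y \<in> V \<Longrightarrow> g X Y = 0) \<Longrightarrow> X = 0"
    and V_ne: "V \<noteq> {}"
begin

lemma zero_in_V [simp]: "0 \<in> V"
  using V_ne V_closed(1,2) by (metis all_not_in_conv add.right_inverse)

lemma diff_closed [simp]: "X \<in> V \<Longrightarrow> Y \<in> V \<Longrightarrow> X - Y \<in> V" "f \<in> F \<Longrightarrow> h \<in> F \<Longrightarrow> f - h \<in> F"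
  using V_closed(2)[of X "- Y"] F_closed(4)[of f "- h"] by simp_all

lemma act_0 [simp]: "X \<in> V \<Longrightarrow> act X 0 = 0"
  using act_add[of X 0 0] by simp

lemma act_1 [simp]: "X \<in> V \<Longrightarrow> act X 1 = 0"
  using act_mult[of X 1 1] by simp

lemma act_minus: "X \<in> V \<Longrightarrow> f \<in> F \<Longrightarrow> act X (- f) = - act X f"
  using act_add[of X f "- f"] by (simp add: eq_neg_iff_add_eq_0 add.commute)

lemma act_diff: "X \<in> V \<Longrightarrow> f \<in> F \<Longrightarrow> h \<in> F \<Longrightarrow> act X (f - h) = act X f - act X h"
  using act_add[of X f "- h"] act_minus[of X h] by simp

lemma g_add2: "X \<in> V \<Longrightarrow> Y \<in> V \<Longrightarrow> Z \<in> V \<Longrightarrow> g Z (X + Y) = g Z X + g Z Y"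
  using g_add[of X Y Z] by (simp add: g_sym[of Z])

lemma g_sm2: "f \<in> F \<Longrightarrow> X \<in> V \<Longrightarrow> Z \<in> V \<Longrightarrow> g Z (sm f X) = f * g Z X"
  using g_sm[of f X Z] by (simp add: g_sym[of Z])

lemma g_0 [simp]: "X \<in> V \<Longrightarrow> g 0 X = 0" "X \<in> V \<Longrightarrow> g X 0 = 0"
  using g_add[of 0 0 X] g_add2[of 0 0 X] by simp_all

lemma g_minus: "X \<in> V \<Longrightarrow> Z \<in> V \<Longrightarrow> g (- X) Z = - g X Z" "X \<in> V \<Longrightarrow> Z \<in> V \<Longrightarrow> g Z (- X) = - g Z X"
  using g_add[of X "- X" Z] g_add2[of X "- X" Z] by (simp_all add: eq_neg_iff_add_eq_0 add.commute)

lemma g_diff: "X \<in> V \<Longrightarrow> Y \<in> V \<Longrightarrow> Z \<in> V \<Longrightarrow> g (X - Y) Z = g X Z - g Y Z"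
    "X \<in> V \<Longrightarrow> Y \<in> V \<Longrightarrow> Z \<in> V \<Longrightarrow> g Z (X - Y) = g Z X - g Z Y"
  using g_add[of X "- Y" Z] g_add2[of X "- Y" Z] by (simp_all add: g_minus)

lemmas g_simps = g_add g_add2 g_sm g_sm2 g_minus g_diff

lemma g_eqI: "X \<in> V \<Longrightarrow> Y \<in> V \<Longrightarrow> (\<And>Z. Z \<in> V \<Longrightarrow> g Z X = g Z Y) \<Longrightarrow> X = Y"
  using g_nondeg[of "X - Y"] by (simp add: g_diff g_sym[of "X - Y"] g_sym[of X] g_sym[of Y])

lemma sm_simps:
  "X \<in> V \<Longrightarrow> sm 0 X = 0" "X \<in> V \<Longrightarrow> sm 1 X = X"
  "f \<in> F \<Longrightarrow> sm f 0 = 0"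
  "f \<in> F \<Longrightarrow> X \<in> V \<Longrightarrow> sm (- f) X = - sm f X"
  "f \<in> F \<Longrightarrow> X \<in> V \<Longrightarrow> sm f (- X) = - sm f X"
  "f \<in> F \<Longrightarrow> h \<in> F \<Longrightarrow> X \<in> V \<Longrightarrow> sm (f + h) X = sm f X + sm h X"
  "f \<in> F \<Longrightarrow> X \<in> V \<Longrightarrow> Y \<in> V \<Longrightarrow> sm f (X + Y) = sm f X + sm f Y"
  "f \<in> F \<Longrightarrow> h \<in> F \<Longrightarrow> X \<in> V \<Longrightarrow> sm f (sm h X) = sm (f * h) X"
  by (rule g_eqI; simp add: g_simps algebra_simps)+

lemma br_0 [simp]: "X \<in> V \<Longrightarrow> br X 0 = 0"
  using br_add[of X 0 0] by simp

lemma br_minus: "X \<in> V \<Longrightarrow> Y \<in> V \<Longrightarrow> br X (- Y) = - br X Y"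
  using br_add[of X Y "- Y"] by (simp add: eq_neg_iff_add_eq_0 add.commute)

lemma br_diff: "X \<in> V \<Longrightarrow> Y \<in> V \<Longrightarrow> Z \<in> V \<Longrightarrow> br X (Y - Z) = br X Y - br X Z"
  using br_add[of X Y "- Z"] by (simp add: br_minus)

text \<open>Twice the exterior derivative of the one-form \<open>g \<zeta>\<close>. Indexing by the
  dual field \<zeta> lets Lie derivatives act on it by brackets.\<close>

definition dd :: "'v \<Rightarrow> 'v \<Rightarrow> 'v \<Rightarrow> 'f" where
  "dd \<zeta> X Y = act X (g \<zeta> Y) - act Y (g \<zeta> X) - g \<zeta> (br X Y)"

lemma dd_closed [simp]: "\<zeta> \<in> V \<Longrightarrow> X \<in> V \<Longrightarrow> Y \<in> V \<Longrightarrow> dd \<zeta> X Y \<in> F"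
  by (simp add: dd_def)

lemma dd_antisym: "\<zeta> \<in> V \<Longrightarrow> X \<in> V \<Longrightarrow> Y \<in> V \<Longrightarrow> dd \<zeta> X Y = - dd \<zeta> Y X"
  by (simp add: dd_def br_antisym[of X Y] g_minus)

lemma dd_sm:
  "\<zeta> \<in> V \<Longrightarrow> X \<in> V \<Longrightarrow> Y \<in> V \<Longrightarrow> k \<in> F \<Longrightarrow> (\<And>Z. Z \<in> V \<Longrightarrow> act Z k = 0) \<Longrightarrow>
    dd (sm k \<zeta>) X Y = k * dd \<zeta> X Y"
  by (simp add: dd_def g_simps act_mult algebra_simps)

text \<open>The Lie derivative of the endomorphism \<phi> along \<open>Z\<close>.\<close>

definition lie_op :: "('v \<Rightarrow> 'v) \<Rightarrow> 'v \<Rightarrow> 'v \<Rightarrow> 'v" where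
  "lie_op \<phi> Z X = br Z (\<phi> X) - \<phi> (br Z X)"

definition quaternion_rel :: "('v \<Rightarrow> 'v) \<Rightarrow> 'v \<Rightarrow> ('v \<Rightarrow> 'v) \<Rightarrow> 'v \<Rightarrow> ('v \<Rightarrow> 'v) \<Rightarrow> 'v \<Rightarrow> 'f \<Rightarrow> bool" where
  "quaternion_rel \<phi>a \<xi>a \<phi>b \<xi>b \<phi>c \<xi>c \<kappa> \<longleftrightarrow>
    (\<forall>X\<in>V. \<phi>c X = \<phi>a (\<phi>b X) - sm (g \<xi>b X) \<xi>a \<and> \<phi>c X = - \<phi>b (\<phi>a X) + sm (g \<xi>a X) \<xi>b \<and>
      g \<xi>c X = g \<xi>a (\<phi>b X) \<and> g \<xi>c X = - g \<xi>b (\<phi>a X)) \<and>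
    \<xi>c = \<phi>a \<xi>b \<and> \<xi>c = - \<phi>b \<xi>a \<and> g \<xi>a \<xi>b = 0 \<and> br \<xi>a \<xi>b = sm \<kappa> \<xi>c"

definition killing :: "'v \<Rightarrow> bool" where
  "killing Z \<longleftrightarrow> Z \<in> V \<and> (\<forall>X\<in>V. \<forall>Y\<in>V. act Z (g X Y) = g (br Z X) Y + g X (br Z Y))"

lemma killingD: "killing Z \<Longrightarrow> X \<in> V \<Longrightarrow> Y \<in> V \<Longrightarrow> act Z (g X Y) = g (br Z X) Y + g X (br Z Y)"
  by (simp add: killing_def)

text \<open>Lie derivatives commute with d, and along a Killing field the one-form dual to \<zeta>
  goes to the one dual to \<open>br Z \<zeta>\<close>.\<close>

lemma lie_dd:
  assumes Z: "killing Z" and V: "\<zeta> \<in> V" "X \<in> V" "Y \<in> V"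
  shows "act Z (dd \<zeta> X Y) = dd (br Z \<zeta>) X Y + dd \<zeta> (br Z X) Y + dd \<zeta> X (br Z Y)"
proof -
  have ZV: "Z \<in> V" using Z by (simp add: killing_def)
  have *: "act Z (act W (g \<zeta> U)) = act (br Z W) (g \<zeta> U) + act W (g (br Z \<zeta>) U) + act W (g \<zeta> (br Z U))"
    if "W \<in> V" "U \<in> V" for W U
    using act_br[of Z W "g \<zeta> U"] killingD[OF Z, of \<zeta> U] V ZV that by (simp add: act_add algebra_simps)
  show ?thesis
    unfolding dd_def using V ZV killingD[OF Z, of \<zeta> "br X Y"] jacobi[of Z X Y]
    by (simp add: act_diff * g_add2)
qed

end

section \<open>A single quasi-Sasakian structure\<close>

locale quasi_sasaki = metric_lie F V sm act br g
  for F :: "'f::comm_ring_1 set" and V :: "'v::ab_group_add set" and sm act br g +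
  fixes \<phi> :: "'v \<Rightarrow> 'v" and \<xi> :: 'v
  assumes phi_closed [simp]: "X \<in> V \<Longrightarrow> \<phi> X \<in> V" and xi_closed [simp]: "\<xi> \<in> V"
    and phi_add: "X \<in> V \<Longrightarrow> Y \<in> V \<Longrightarrow> \<phi> (X + Y) = \<phi> X + \<phi> Y"
    and phi_phi: "X \<in> V \<Longrightarrow> \<phi> (\<phi> X) = - X + sm (g \<xi> X) \<xi>"
    and xi_unit: "g \<xi> \<xi> = 1" and phi_xi: "\<phi> \<xi> = 0"
    and xi_phi: "X \<in> V \<Longrightarrow> g \<xi> (\<phi> X) = 0"
    and compat: "X \<in> V \<Longrightarrow> Y \<in> V \<Longrightarrow> g (\<phi> X) (\<phi> Y) = g X Y - g \<xi> X * g \<xi> Y"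
    and normal: "X \<in> V \<Longrightarrow> Y \<in> V \<Longrightarrow> \<phi> (\<phi> (br X Y)) + br (\<phi> X) (\<phi> Y) - \<phi> (br (\<phi> X) Y)
      - \<phi> (br X (\<phi> Y)) + sm (dd \<xi> X Y) \<xi> = 0"
    and closed: "X \<in> V \<Longrightarrow> Y \<in> V \<Longrightarrow> Z \<in> V \<Longrightarrow>
      act X (g Y (\<phi> Z)) + act Y (g Z (\<phi> X)) + act Z (g X (\<phi> Y))
      - g (br X Y) (\<phi> Z) - g (br Y Z) (\<phi> X) - g (br Z X) (\<phi> Y) = 0"
begin

lemma phi_0 [simp]: "\<phi> 0 = 0"
  using phi_add[of 0 0] by simp

lemma phi_minus: "X \<in> V \<Longrightarrow> \<phi> (- X) = - \<phi> X"
  using phi_add[of X "- X"] by (simp add: eq_neg_iff_add_eq_0 add.commute)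

lemma phi_diff: "X \<in> V \<Longrightarrow> Y \<in> V \<Longrightarrow> \<phi> (X - Y) = \<phi> X - \<phi> Y"
  using phi_add[of X "- Y"] by (simp add: phi_minus)

lemma phi_skew: "X \<in> V \<Longrightarrow> Y \<in> V \<Longrightarrow> g (\<phi> X) Y = - g X (\<phi> Y)"
proof -
  assume V: "X \<in> V" "Y \<in> V"
  then have "- g (\<phi> X) Y = g X (\<phi> Y)"
    using compat[of X "\<phi> Y"] xi_phi[of X] by (simp add: phi_phi xi_phi g_simps g_sym[of _ \<xi>])
  then show "g (\<phi> X) Y = - g X (\<phi> Y)" by (metis minus_minus)
qed

lemma Phi_antisym: "X \<in> V \<Longrightarrow> Y \<in> V \<Longrightarrow> g X (\<phi> Y) = - g Y (\<phi> X)"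
  using phi_skew[of Y X] by (simp add: g_sym[of X])

lemma phi_sm: "f \<in> F \<Longrightarrow> X \<in> V \<Longrightarrow> \<phi> (sm f X) = sm f (\<phi> X)"
  by (rule g_eqI) (simp_all add: Phi_antisym[of _ "sm f X"] Phi_antisym[of _ X] g_simps)

lemma horizontal_zero: "X \<in> V \<Longrightarrow> \<phi> X = 0 \<Longrightarrow> g \<xi> X = 0 \<Longrightarrow> X = 0"
  using phi_phi[of X] by (simp add: sm_simps)

text \<open>This is the \<xi>-component of normality at \<open>X\<close> and \<xi>: each other
  summand is an image of \<phi> or contains \<open>\<phi> \<xi> = 0\<close>.\<close>

lemma dd_xi: "X \<in> V \<Longrightarrow> dd \<xi> \<xi> X = 0"
proof -
  assume X: "X \<in> V"
  have "g \<xi> (\<phi> (\<phi> (br X \<xi>)) + br (\<phi> X) (\<phi> \<xi>) - \<phi> (br (\<phi> X) \<xi>)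
      - \<phi> (br X (\<phi> \<xi>)) + sm (dd \<xi> X \<xi>) \<xi>) = 0"
    using X by (subst normal) simp_all
  then have "dd \<xi> X \<xi> = 0" using X by (simp add: phi_xi g_simps xi_phi xi_unit)
  then show ?thesis using dd_antisym[of \<xi> \<xi> X] X by simp
qed

lemma lie_eta: "X \<in> V \<Longrightarrow> act \<xi> (g \<xi> X) = g \<xi> (br \<xi> X)"
  using dd_xi[of X] by (simp add: dd_def g_sym[of X] xi_unit)

text \<open>Normality at \<xi> and \<open>X\<close> only says that \<phi> kills the Lie derivative
  of \<phi>. Its \<xi>-component vanishes because \<eta> is invariant
  (\<open>lie_eta\<close>).\<close>

lemma lie_phi: "X \<in> V \<Longrightarrow> br \<xi> (\<phi> X) = \<phi> (br \<xi> X)"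
proof -
  assume X: "X \<in> V"
  have "\<phi> (\<phi> (br \<xi> X)) - \<phi> (br \<xi> (\<phi> X)) = 0"
    using normal[of \<xi> X] X by (simp add: phi_xi dd_xi sm_simps br_antisym[of 0])
  then have "\<phi> (\<phi> (br \<xi> X) - br \<xi> (\<phi> X)) = 0" using X by (simp add: phi_diff)
  moreover have "g \<xi> (\<phi> (br \<xi> X) - br \<xi> (\<phi> X)) = 0"
    using X lie_eta[of "\<phi> X"] by (simp add: g_simps xi_phi)
  ultimately show ?thesis using horizontal_zero[of "\<phi> (br \<xi> X) - br \<xi> (\<phi> X)"] X by simp
qed

text \<open>Closedness with one argument \<open>Z\<close> singled out is Cartan's formula for the Lie derivative of the
  fundamental form along \<open>Z\<close>.\<close>

lemma lie_fundamental:
  assumes "Z \<in> V" "X \<in> V" "Y \<in> V"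
  shows "act Z (g X (\<phi> Y)) - g (br Z X) (\<phi> Y) - g X (\<phi> (br Z Y)) =
    act X (g Z (\<phi> Y)) - act Y (g Z (\<phi> X)) - g Z (\<phi> (br X Y))"
proof -
  have "act X (g Y (\<phi> Z)) = - act X (g Z (\<phi> Y))"
    using assms by (subst Phi_antisym) (simp_all add: act_minus)
  moreover have "g (br X Y) (\<phi> Z) = - g Z (\<phi> (br X Y))"
    using assms by (subst Phi_antisym) simp_all
  moreover have "g (br Y Z) (\<phi> X) = g X (\<phi> (br Z Y))"
    using assms by (subst Phi_antisym) (simp_all add: br_antisym[of Y Z] phi_minus g_minus)
  ultimately show ?thesis
    using closed[of Z X Y] assms by (simp add: algebra_simps)
qed

text \<open>The contraction of \<Phi> with \<xi> is 0, so Cartan's formula makes \<Phi> invariant.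
  With \<phi> and \<eta> invariant too, evaluating \<Phi> at \<open>\<phi> X\<close> and
  \<open>Y\<close> and using \<open>compat\<close> gives the invariance of \<open>g\<close>.\<close>

lemma killing_xi: "killing \<xi>"
  unfolding killing_def
proof (intro conjI ballI)
  fix X Y assume V: "X \<in> V" "Y \<in> V"
  have 1: "act \<xi> (g (\<phi> X) (\<phi> Y)) = g (br \<xi> (\<phi> X)) (\<phi> Y) + g (\<phi> X) (\<phi> (br \<xi> Y))"
    using lie_fundamental[of \<xi> "\<phi> X" Y] V by (simp add: xi_phi algebra_simps)
  show "act \<xi> (g X Y) = g (br \<xi> X) Y + g X (br \<xi> Y)"
    using 1 V by (simp add: lie_phi compat act_diff act_mult lie_eta algebra_simps)
qed simp

end

section \<open>Three structures bound by the quaternionic relations\<close>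

locale three_quasi_sasaki = metric_lie F V sm act br g +
  a: quasi_sasaki F V sm act br g \<phi>a \<xi>a + b: quasi_sasaki F V sm act br g \<phi>b \<xi>b +
  c: quasi_sasaki F V sm act br g \<phi>c \<xi>c
  for F :: "'f::comm_ring_1 set" and V :: "'v::ab_group_add set" and sm act br g
    and \<phi>a \<xi>a \<phi>b \<xi>b \<phi>c \<xi>c +
  fixes \<kappa> :: 'f
  assumes kappa [simp]: "\<kappa> \<in> F" "X \<in> V \<Longrightarrow> act X \<kappa> = 0"
    and rels: "quaternion_rel \<phi>a \<xi>a \<phi>b \<xi>b \<phi>c \<xi>c \<kappa>" "quaternion_rel \<phi>b \<xi>b \<phi>c \<xi>c \<phi>a \<xi>a \<kappa>"
      "quaternion_rel \<phi>c \<xi>c \<phi>a \<xi>a \<phi>b \<xi>b \<kappa>"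
begin

text \<open>Since the relations are assumed in all three cyclic positions, each result for one even
  permutation is available for the other two.\<close>

lemma rotate: "three_quasi_sasaki F V sm act br g \<phi>b \<xi>b \<phi>c \<xi>c \<phi>a \<xi>a \<kappa>"
  by unfold_locales (simp_all add: rels)

lemma rel:
  "X \<in> V \<Longrightarrow> \<phi>c X = \<phi>a (\<phi>b X) - sm (g \<xi>b X) \<xi>a"
  "X \<in> V \<Longrightarrow> \<phi>c X = - \<phi>b (\<phi>a X) + sm (g \<xi>a X) \<xi>b"
  "X \<in> V \<Longrightarrow> g \<xi>a (\<phi>b X) = g \<xi>c X"
  "X \<in> V \<Longrightarrow> g \<xi>b (\<phi>a X) = - g \<xi>c X"
  "\<phi>a \<xi>b = \<xi>c" "\<phi>b \<xi>a = - \<xi>c" "\<phi>b \<xi>c = \<xi>a" "br \<xi>a \<xi>b = sm \<kappa> \<xi>c" "br \<xi>b \<xi>c = sm \<kappa> \<xi>a"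
  "br \<xi>c \<xi>a = sm \<kappa> \<xi>b"
proof -
  note r = rels[unfolded quaternion_rel_def]
  show "X \<in> V \<Longrightarrow> \<phi>c X = \<phi>a (\<phi>b X) - sm (g \<xi>b X) \<xi>a"
    "X \<in> V \<Longrightarrow> \<phi>c X = - \<phi>b (\<phi>a X) + sm (g \<xi>a X) \<xi>b"
    "\<phi>a \<xi>b = \<xi>c" "\<phi>b \<xi>c = \<xi>a" "br \<xi>a \<xi>b = sm \<kappa> \<xi>c" "br \<xi>b \<xi>c = sm \<kappa> \<xi>a" "br \<xi>c \<xi>a = sm \<kappa> \<xi>b"
    using r by blast+
  show "g \<xi>a (\<phi>b X) = g \<xi>c X" "g \<xi>b (\<phi>a X) = - g \<xi>c X" if "X \<in> V"
    using r(1) that by (metis, metis minus_minus)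
  show "\<phi>b \<xi>a = - \<xi>c" using r(1) by (metis minus_minus)
qed

lemma lie_op_closed [simp]: "X \<in> V \<Longrightarrow> lie_op \<phi>b \<xi>a X \<in> V" "X \<in> V \<Longrightarrow> lie_op \<phi>a \<xi>b X \<in> V"
  "X \<in> V \<Longrightarrow> lie_op \<phi>c \<xi>b X \<in> V" "X \<in> V \<Longrightarrow> lie_op \<phi>a \<xi>c X \<in> V"
  by (simp_all add: lie_op_def)

lemma g_lie_op:
  assumes V: "X \<in> V" "Y \<in> V"
  shows "g X (lie_op \<phi>b \<xi>a Y) = dd \<xi>c X Y"
  using b.lie_fundamental[of \<xi>a X Y] killingD[OF a.killing_xi, of X "\<phi>b Y"] V
  by (simp add: lie_op_def g_diff rel dd_def algebra_simps)

text \<open>The computation of \<open>g_lie_op\<close> with the first two structures exchanged; the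
  sign is that of \<open>g \<xi>b (\<phi>a X) = - g \<xi>c X\<close>. One operator thus serves for
  both mixed Lie derivatives.\<close>

lemma lie_op_swap:
  assumes "Y \<in> V"
  shows "lie_op \<phi>a \<xi>b Y = - lie_op \<phi>b \<xi>a Y"
proof (rule g_eqI)
  fix X assume X: "X \<in> V"
  have "g X (lie_op \<phi>a \<xi>b Y) = - dd \<xi>c X Y"
    using a.lie_fundamental[of \<xi>b X Y] killingD[OF b.killing_xi, of X "\<phi>a Y"] X assms
    by (simp add: lie_op_def g_diff rel dd_def act_minus algebra_simps)
  then show "g X (lie_op \<phi>a \<xi>b Y) = g X (- lie_op \<phi>b \<xi>a Y)"
    using X assms by (simp add: g_minus g_lie_op)
qed (use assms in simp_all)

lemma lie_op_xi: "lie_op \<phi>b \<xi>a \<xi>c = 0" "lie_op \<phi>b \<xi>a \<xi>a = sm \<kappa> \<xi>b" "lie_op \<phi>b \<xi>a \<xi>b = - sm \<kappa> \<xi>a"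
  by (simp_all add: lie_op_def rel br_self br_minus br_antisym[of \<xi>a \<xi>c] b.phi_minus b.phi_sm b.phi_xi sm_simps)

text \<open>By the rotated \<open>lie_op_swap\<close> the left side is minus the Lie derivative of
  \<open>\<phi>c\<close> along \<open>\<xi>a\<close>. Expanding \<open>\<phi>c\<close> by its two
  product formulas, in which \<open>\<phi>a\<close> is invariant, gives the two identities; the
  vertical terms stem from the bracket of \<open>\<xi>a\<close> and \<open>\<xi>b\<close>.\<close>

lemma lie_op_phi:
  assumes X: "X \<in> V"
  shows "lie_op \<phi>a \<xi>c X = - \<phi>a (lie_op \<phi>b \<xi>a X) + sm (\<kappa> * g \<xi>c X) \<xi>a"
    and "lie_op \<phi>a \<xi>c X = lie_op \<phi>b \<xi>a (\<phi>a X) - sm (\<kappa> * g \<xi>a X) \<xi>c"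
proof -
  interpret r: three_quasi_sasaki F V sm act br g \<phi>b \<xi>b \<phi>c \<xi>c \<phi>a \<xi>a \<kappa> by (rule rotate)
  interpret rr: three_quasi_sasaki F V sm act br g \<phi>c \<xi>c \<phi>a \<xi>a \<phi>b \<xi>b \<kappa> by (rule r.rotate)
  have 0: "lie_op \<phi>a \<xi>c X = \<phi>c (br \<xi>a X) - br \<xi>a (\<phi>c X)"
    using rr.lie_op_swap[OF X] by (simp add: lie_op_def eq_neg_iff_add_eq_0 algebra_simps)
  have b: "act \<xi>a (g \<xi>b X) = \<kappa> * g \<xi>c X + g \<xi>b (br \<xi>a X)"
    using killingD[OF a.killing_xi, of \<xi>b X] X by (simp add: rel g_simps)
  show "lie_op \<phi>a \<xi>c X = - \<phi>a (lie_op \<phi>b \<xi>a X) + sm (\<kappa> * g \<xi>c X) \<xi>a"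
    unfolding 0 unfolding lie_op_def using X
    by (simp add: rel(1) br_diff br_sm b br_self sm_simps a.lie_phi a.phi_diff algebra_simps)
  show "lie_op \<phi>a \<xi>c X = lie_op \<phi>b \<xi>a (\<phi>a X) - sm (\<kappa> * g \<xi>a X) \<xi>c"
    unfolding 0 unfolding lie_op_def using X
    by (simp add: rel(2,8) br_add br_minus br_diff br_sm a.lie_eta sm_simps a.lie_phi algebra_simps)
qed

text \<open>The operators represent the forms \<open>dd\<close>, which \<open>lie_dd\<close>
  differentiates: along \<open>\<xi>b\<close>, \<open>dd \<xi>c\<close> becomes \<kappa> times
  \<open>dd \<xi>a\<close>, and \<open>dd \<xi>b\<close> becomes 0 because
  \<open>br \<xi>b \<xi>b = 0\<close>.\<close>

lemma lie_lie_op: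
  assumes Y: "Y \<in> V"
  shows "br \<xi>b (lie_op \<phi>b \<xi>a Y) = lie_op \<phi>b \<xi>a (br \<xi>b Y) + sm \<kappa> (lie_op \<phi>c \<xi>b Y)"
    and "br \<xi>b (lie_op \<phi>a \<xi>c Y) = lie_op \<phi>a \<xi>c (br \<xi>b Y)"
proof -
  interpret r: three_quasi_sasaki F V sm act br g \<phi>b \<xi>b \<phi>c \<xi>c \<phi>a \<xi>a \<kappa> by (rule rotate)
  interpret rr: three_quasi_sasaki F V sm act br g \<phi>c \<xi>c \<phi>a \<xi>a \<phi>b \<xi>b \<kappa> by (rule r.rotate)
  show "br \<xi>b (lie_op \<phi>b \<xi>a Y) = lie_op \<phi>b \<xi>a (br \<xi>b Y) + sm \<kappa> (lie_op \<phi>c \<xi>b Y)"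
  proof (rule g_eqI)
    fix X assume X: "X \<in> V"
    show "g X (br \<xi>b (lie_op \<phi>b \<xi>a Y)) = g X (lie_op \<phi>b \<xi>a (br \<xi>b Y) + sm \<kappa> (lie_op \<phi>c \<xi>b Y))"
      using killingD[OF b.killing_xi, of X "lie_op \<phi>b \<xi>a Y"] lie_dd[OF b.killing_xi, of \<xi>c X Y] X Y
      by (simp add: g_simps g_lie_op r.g_lie_op rel dd_sm) (metis add.commute)
  qed (use Y in simp_all)
  show "br \<xi>b (lie_op \<phi>a \<xi>c Y) = lie_op \<phi>a \<xi>c (br \<xi>b Y)"
  proof (rule g_eqI)
    fix X assume X: "X \<in> V"
    have "dd 0 X Y = 0" using X Y by (simp add: dd_def)
    then show "g X (br \<xi>b (lie_op \<phi>a \<xi>c Y)) = g X (lie_op \<phi>a \<xi>c (br \<xi>b Y))"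
      using killingD[OF b.killing_xi, of X "lie_op \<phi>a \<xi>c Y"] lie_dd[OF b.killing_xi, of \<xi>b X Y] X Y
      by (simp add: g_simps rr.g_lie_op br_self)
  qed (use Y in simp_all)
qed

text \<open>The Lie derivative along \<open>\<xi>b\<close> of the first identity of \<open>lie_op_phi\<close>.\<close>

lemma lie_op_lie_op:
  assumes X: "X \<in> V"
  shows "lie_op \<phi>b \<xi>a (lie_op \<phi>b \<xi>a X) = sm \<kappa> (\<phi>a (lie_op \<phi>c \<xi>b X))
    + sm (\<kappa> * \<kappa> * g \<xi>c X) \<xi>c - sm (\<kappa> * \<kappa> * g \<xi>a X) \<xi>a"
proof -
  let ?B = "lie_op \<phi>b \<xi>a"
  \<comment> \<open>The Lie derivative of \<open>\<phi>a\<close> along \<open>\<xi>b\<close> is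
    \<open>- ?B\<close>; moving \<open>br \<xi>b\<close> past \<open>\<phi>a\<close> is what creates
    \<open>?B (?B X)\<close>.\<close>
  have 1: "br \<xi>b (\<phi>a Z) = \<phi>a (br \<xi>b Z) - ?B Z" if "Z \<in> V" for Z
    using lie_op_swap[OF that] by (simp add: lie_op_def[of \<phi>a] algebra_simps)
  have 2: "act \<xi>b (g \<xi>c X) = \<kappa> * g \<xi>a X + g \<xi>c (br \<xi>b X)"
    using killingD[OF b.killing_xi, of \<xi>c X] X by (simp add: rel g_simps)
  have 3: "br \<xi>b \<xi>a = - sm \<kappa> \<xi>c"
    using br_antisym[of \<xi>b \<xi>a] by (simp add: rel)
  have "br \<xi>b (lie_op \<phi>a \<xi>c X) = br \<xi>b (- \<phi>a (?B X) + sm (\<kappa> * g \<xi>c X) \<xi>a)"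
    using lie_op_phi(1)[OF X] by simp
  also have "\<dots> = - \<phi>a (br \<xi>b (?B X)) + ?B (?B X) + sm (\<kappa> * act \<xi>b (g \<xi>c X)) \<xi>a
      - sm (\<kappa> * \<kappa> * g \<xi>c X) \<xi>c"
  proof -
    have "br \<xi>b (sm (\<kappa> * g \<xi>c X) \<xi>a) = sm (\<kappa> * act \<xi>b (g \<xi>c X)) \<xi>a - sm (\<kappa> * \<kappa> * g \<xi>c X) \<xi>c"
      using X by (simp add: br_sm act_mult 3 sm_simps) (simp add: mult_ac)
    moreover have "br \<xi>b (- \<phi>a (?B X)) = - \<phi>a (br \<xi>b (?B X)) + ?B (?B X)"
      using X by (simp add: br_minus 1)
    moreover have "br \<xi>b (- \<phi>a (?B X) + sm (\<kappa> * g \<xi>c X) \<xi>a) =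
        br \<xi>b (- \<phi>a (?B X)) + br \<xi>b (sm (\<kappa> * g \<xi>c X) \<xi>a)"
      using X by (intro br_add) simp_all
    ultimately show ?thesis by (metis add_diff_eq)
  qed
  finally have "lie_op \<phi>a \<xi>c (br \<xi>b X) = - \<phi>a (?B (br \<xi>b X) + sm \<kappa> (lie_op \<phi>c \<xi>b X)) + ?B (?B X)
      + sm (\<kappa> * (\<kappa> * g \<xi>a X + g \<xi>c (br \<xi>b X))) \<xi>a - sm (\<kappa> * \<kappa> * g \<xi>c X) \<xi>c"
    using X by (simp add: lie_lie_op 2)
  moreover have "lie_op \<phi>a \<xi>c (br \<xi>b X) = - \<phi>a (?B (br \<xi>b X)) + sm (\<kappa> * g \<xi>c (br \<xi>b X)) \<xi>a"
    using X by (intro lie_op_phi(1)) simp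
  moreover have "\<phi>a (?B (br \<xi>b X) + sm \<kappa> (lie_op \<phi>c \<xi>b X)) =
      \<phi>a (?B (br \<xi>b X)) + sm \<kappa> (\<phi>a (lie_op \<phi>c \<xi>b X))"
    using X by (simp add: a.phi_add a.phi_sm)
  moreover have "sm (\<kappa> * (\<kappa> * g \<xi>a X + g \<xi>c (br \<xi>b X))) \<xi>a =
      sm (\<kappa> * \<kappa> * g \<xi>a X) \<xi>a + sm (\<kappa> * g \<xi>c (br \<xi>b X)) \<xi>a"
    using X by (simp add: distrib_left sm_simps mult.assoc)
  ultimately show ?thesis by (simp add: algebra_simps)
qed

end

subsection \<open>The structure on a single tangent space\<close>

text \<open>Interleave the members \<open>x\<close> of \<open>L\<close> with \<open>J x\<close>. The
  scale is \<open>- t\<close> because \<open>w x (J x) = t * G x (J (J x)) = - t\<close>.\<close>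

lemma symplectic_seq_of_lagrangian:
  fixes G :: "'e::euclidean_space \<Rightarrow> 'e \<Rightarrow> real"
  assumes L: "finite L" "\<And>x y. x \<in> L \<Longrightarrow> y \<in> L \<Longrightarrow> G x y = of_bool (x = y)"
      "\<And>x y. x \<in> L \<Longrightarrow> y \<in> L \<Longrightarrow> G x (J y) = 0" "\<And>x. x \<in> L \<Longrightarrow> J (J x) = - x"
    and G: "bilinear G" "\<And>x y. G (J x) y = - G x (J y)"
    and w: "\<And>x y. y \<in> L \<union> J ` L \<Longrightarrow> w x y = t * G x (J y)"
  obtains e where "symplectic_seq w (- t) (card L) e" "\<And>i. i < 2 * card L \<Longrightarrow> e i \<in> L \<union> J ` L"
proof -
  obtain h where h: "bij_betw h {..<card L} L"
    using ex_bij_betw_nat_finite[OF L(1)] by (auto simp: atLeast0LessThan)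
  then have hL: "i < card L \<Longrightarrow> h i \<in> L" for i by (auto simp: bij_betw_def)
  have hi: "i < card L \<Longrightarrow> j < card L \<Longrightarrow> h i = h j \<longleftrightarrow> i = j" for i j
    using h by (auto simp: bij_betw_def inj_on_def)
  define e where "e i = (if even i then h (i div 2) else J (h (i div 2)))" for i
  have "G x (- y) = - G x y" for x y using bilinear_rneg[OF G(1)] by simp
  then have "symplectic_seq w (- t) (card L) e"
    unfolding symplectic_seq_def
    by (auto simp: e_def hL hi w L(2,3,4) G(2))
  moreover have "e i \<in> L \<union> J ` L" if "i < 2 * card L" for i
    using hL[of "i div 2"] that by (auto simp: e_def)
  ultimately show ?thesis using that by blast
qed

text \<open>What one tangent space retains: \<open>fa\<close>, \<open>fb\<close>, \<open>fc\<close>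
  are the values of the endomorphisms, \<open>Ba\<close>, \<open>Bb\<close>, \<open>Bc\<close> those
  of the operators representing twice the derivatives of the one-forms, and \<open>k\<close> is the
  bracket constant. With the axioms in cyclic triples, rotation is a mere reordering.\<close>

locale contact3 =
  fixes G :: "'e::euclidean_space \<Rightarrow> 'e \<Rightarrow> real" and k :: real
    and fa xa Ba fb xb Bb fc xc Bc
  assumes G: "bilinear G" "\<And>u v. G u v = G v u" "\<And>u. u \<noteq> 0 \<Longrightarrow> 0 < G u u"
    and lin: "linear fa" "linear fb" "linear fc" "linear Ba" "linear Bb" "linear Bc"
    and unit: "G xa xa = 1" "G xb xb = 1" "G xc xc = 1"
      "G xa xb = 0" "G xb xc = 0" "G xa xc = 0"
    and ff: "\<And>u. fa (fa u) = - u + G xa u *\<^sub>R xa" "\<And>u. fb (fb u) = - u + G xb u *\<^sub>R xb"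
      "\<And>u. fc (fc u) = - u + G xc u *\<^sub>R xc"
    and skew: "\<And>u v. G (fa u) v = - G u (fa v)" "\<And>u v. G (fb u) v = - G u (fb v)"
      "\<And>u v. G (fc u) v = - G u (fc v)"
    and fx: "fa xa = 0" "fa xb = xc" "fa xc = - xb" "fb xa = - xc" "fb xb = 0" "fb xc = xa"
      "fc xa = xb" "fc xb = - xa" "fc xc = 0"
    and fab: "\<And>u. fa (fb u) = fc u + G xb u *\<^sub>R xa" "\<And>u. fb (fc u) = fa u + G xc u *\<^sub>R xb"
      "\<And>u. fc (fa u) = fb u + G xa u *\<^sub>R xc"
    and fba: "\<And>u. fb (fa u) = - fc u + G xa u *\<^sub>R xb" "\<And>u. fc (fb u) = - fa u + G xb u *\<^sub>R xc"
      "\<And>u. fa (fc u) = - fb u + G xc u *\<^sub>R xa"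
    and Bskew: "\<And>u v. G (Ba u) v = - G u (Ba v)" "\<And>u v. G (Bb u) v = - G u (Bb v)"
      "\<And>u v. G (Bc u) v = - G u (Bc v)"
    and Bx: "Ba xa = 0" "Ba xb = k *\<^sub>R xc" "Ba xc = - k *\<^sub>R xb"
      "Bb xb = 0" "Bb xc = k *\<^sub>R xa" "Bb xa = - k *\<^sub>R xc"
      "Bc xc = 0" "Bc xa = k *\<^sub>R xb" "Bc xb = - k *\<^sub>R xa"
    and Bf1: "\<And>u. Bb u = - fa (Bc u) + (k * G xc u) *\<^sub>R xa" "\<And>u. Bc u = - fb (Ba u) + (k * G xa u) *\<^sub>R xb"
      "\<And>u. Ba u = - fc (Bb u) + (k * G xb u) *\<^sub>R xc"
    and Bf2: "\<And>u. Bb u = Bc (fa u) - (k * G xa u) *\<^sub>R xc" "\<And>u. Bc u = Ba (fb u) - (k * G xb u) *\<^sub>R xa"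
      "\<And>u. Ba u = Bb (fc u) - (k * G xc u) *\<^sub>R xb"
    and BB: "\<And>u. Bc (Bc u) = k *\<^sub>R fa (Ba u) + (k * k * G xc u) *\<^sub>R xc - (k * k * G xa u) *\<^sub>R xa"
      "\<And>u. Ba (Ba u) = k *\<^sub>R fb (Bb u) + (k * k * G xa u) *\<^sub>R xa - (k * k * G xb u) *\<^sub>R xb"
      "\<And>u. Bb (Bb u) = k *\<^sub>R fc (Bc u) + (k * k * G xb u) *\<^sub>R xb - (k * k * G xc u) *\<^sub>R xc"
begin

lemma rotate: "contact3 G k fb xb Bb fc xc Bc fa xa Ba"
proof -
  have *: "G xb xa = 0" "G xc xa = 0" using G(2)[of xb xa] G(2)[of xc xa] unit by simp_all
  show ?thesis
    by (rule contact3.intro[OF G lin(2,3,1,5,6,4) unit(2,3,1,5) *(2,1) ff(2,3,1) skew(2,3,1)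
        fx(5,6,4,8,9,7,2,3,1) fab(2,3,1) fba(2,3,1) Bskew(2,3,1) Bx(4-9,1-3) Bf1(2,3,1) Bf2(2,3,1)
        BB(2,3,1)])
qed

lemma G_simps: "G (u + v) z = G u z + G v z" "G z (u + v) = G z u + G z v"
    "G (u - v) z = G u z - G v z" "G z (u - v) = G z u - G z v"
    "G (r *\<^sub>R u) z = r * G u z" "G z (r *\<^sub>R u) = r * G z u"
    "G (- u) z = - G u z" "G z (- u) = - G z u" "G 0 z = 0" "G z 0 = 0"
  by (simp_all only: bilinear_ladd[OF G(1)] bilinear_radd[OF G(1)] bilinear_lsub[OF G(1)]
    bilinear_rsub[OF G(1)] bilinear_lmul[OF G(1)] bilinear_rmul[OF G(1)] bilinear_lneg[OF G(1)]
    bilinear_rneg[OF G(1)] bilinear_lzero[OF G(1)] bilinear_rzero[OF G(1)] real_scaleR_def)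

lemma unit': "G xa xa = 1" "G xb xb = 1" "G xc xc = 1"
    "G xa xb = 0" "G xb xc = 0" "G xa xc = 0" "G xb xa = 0" "G xc xb = 0" "G xc xa = 0"
  by (simp_all only: unit G(2)[of xb xa] G(2)[of xc xb] G(2)[of xc xa])

definition hor :: "'e set" where "hor = {u. G xa u = 0 \<and> G xb u = 0 \<and> G xc u = 0}"

lemma subspace_hor: "subspace hor"
  by (auto simp: subspace_def hor_def G_simps)

lemma Gx_f: "G xa (fb u) = G xc u" "G xa (fc u) = - G xb u" "G xb (fa u) = - G xc u"
  "G xb (fc u) = G xa u" "G xc (fa u) = G xb u" "G xc (fb u) = - G xa u"
  "G xa (fa u) = 0" "G xb (fb u) = 0" "G xc (fc u) = 0"
proof -
  have *: "G v (fa u) = - G (fa v) u" "G v (fb u) = - G (fb v) u" "G v (fc u) = - G (fc v) u" for v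
    by (simp_all add: skew)
  show "G xa (fb u) = G xc u" "G xa (fc u) = - G xb u" "G xb (fa u) = - G xc u"
    "G xb (fc u) = G xa u" "G xc (fa u) = G xb u" "G xc (fb u) = - G xa u"
    "G xa (fa u) = 0" "G xb (fb u) = 0" "G xc (fc u) = 0"
    by (simp_all only: * fx G_simps minus_minus minus_zero)
qed

lemma hor_f [simp]: "u \<in> hor \<Longrightarrow> fa u \<in> hor" "u \<in> hor \<Longrightarrow> fb u \<in> hor" "u \<in> hor \<Longrightarrow> fc u \<in> hor"
  by (simp_all add: hor_def Gx_f)

lemma hor_B [simp]: "u \<in> hor \<Longrightarrow> Ba u \<in> hor" "u \<in> hor \<Longrightarrow> Bb u \<in> hor" "u \<in> hor \<Longrightarrow> Bc u \<in> hor"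
  using Bskew[of xa u] Bskew[of xb u] Bskew[of xc u]
  by (simp_all add: hor_def Bx G_simps)

lemma hor_simps:
  assumes "u \<in> hor"
  shows "G xa u = 0" "G xb u = 0" "G xc u = 0" "fa (fa u) = - u" "fb (fb u) = - u" "fc (fc u) = - u"
    "fa (fb u) = fc u" "fb (fc u) = fa u" "fc (fa u) = fb u"
    "fb (fa u) = - fc u" "fc (fb u) = - fa u" "fa (fc u) = - fb u"
  using assms by (simp_all add: hor_def ff fab fba)

lemma lin_simps: "fa (u + v) = fa u + fa v" "fb (u + v) = fb u + fb v" "fc (u + v) = fc u + fc v"
    "fa (u - v) = fa u - fa v" "fb (u - v) = fb u - fb v" "fc (u - v) = fc u - fc v"
    "fa (r *\<^sub>R u) = r *\<^sub>R fa u" "fb (r *\<^sub>R u) = r *\<^sub>R fb u" "fc (r *\<^sub>R u) = r *\<^sub>R fc u"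
    "fa (- u) = - fa u" "fb (- u) = - fb u" "fc (- u) = - fc u" "fa 0 = 0" "fb 0 = 0" "fc 0 = 0"
    "Ba (u + v) = Ba u + Ba v" "Bb (u + v) = Bb u + Bb v" "Bc (u + v) = Bc u + Bc v"
    "Ba (u - v) = Ba u - Ba v" "Bb (u - v) = Bb u - Bb v" "Bc (u - v) = Bc u - Bc v"
    "Ba (r *\<^sub>R u) = r *\<^sub>R Ba u" "Bb (r *\<^sub>R u) = r *\<^sub>R Bb u" "Bc (r *\<^sub>R u) = r *\<^sub>R Bc u"
    "Ba (- u) = - Ba u" "Bb (- u) = - Bb u" "Bc (- u) = - Bc u" "Ba 0 = 0" "Bb 0 = 0" "Bc 0 = 0"
  by (simp_all only: lin[THEN linear_add] lin[THEN linear_diff] lin[THEN linear_cmul]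
    lin[THEN linear_neg] lin[THEN linear_0])

subsubsection \<open>Quaternionic orthonormal systems\<close>

text \<open>Orthonormality over the quaternions. \<open>frame U\<close> is the real orthonormal
  system generated by such a \<open>U\<close>.\<close>

definition quat :: "'e set \<Rightarrow> bool" where
  "quat U \<longleftrightarrow> (\<forall>u\<in>U. \<forall>v\<in>U. G u v = of_bool (u = v) \<and> G u (fa v) = 0 \<and> G u (fb v) = 0 \<and> G u (fc v) = 0)"

definition frame :: "'e set \<Rightarrow> 'e set" where
  "frame U = U \<union> fa ` U \<union> fb ` U \<union> fc ` U"

text \<open>Gram-Schmidt over the quaternions: a unit vector and its three images span a
  quaternionic line, and the part of \<open>S\<close> orthogonal to that line is again invariant
  because the endomorphisms are skew.\<close>

lemma ex_quat:
  assumes "subspace S" "S \<subseteq> hor" "fa ` S \<subseteq> S" "fb ` S \<subseteq> S" "fc ` S \<subseteq> S"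
  shows "\<exists>U. finite U \<and> U \<subseteq> S \<and> quat U \<and> S \<subseteq> span (frame U)"
  using assms
proof (induction "dim S" arbitrary: S rule: less_induct)
  case less
  note S = less.prems
  show ?case
  proof (cases "S \<subseteq> {0}")
    case True
    then show ?thesis by (intro exI[of _ "{}"]) (auto simp: quat_def span_zero)
  next
    case False
    then obtain s where s: "s \<in> S" "s \<noteq> 0" by auto
    define u where "u = (1 / sqrt (G s s)) *\<^sub>R s"
    have uS: "u \<in> S" unfolding u_def using S(1) s by (simp add: subspace_scale)
    then have u: "u \<in> hor" using S by auto
    have Guu: "G u u = 1"
      using G(3)[OF s(2)] by (simp add: u_def G_simps flip: power2_eq_square)
    have self: "G v (fa v) = 0" "G v (fb v) = 0" "G v (fc v) = 0" for v
      using skew[of v v] G(2)[of v "fa v"] G(2)[of v "fb v"] G(2)[of v "fc v"] by simp_all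
    define T where "T = {v \<in> S. G u v = 0 \<and> G (fa u) v = 0 \<and> G (fb u) v = 0 \<and> G (fc u) v = 0}"
    have T: "subspace T"
      using S(1) by (auto simp: T_def subspace_def G_simps)
    have TS: "T \<subseteq> S" by (auto simp: T_def)
    have inv: "fa v \<in> T \<and> fb v \<in> T \<and> fc v \<in> T" if v: "v \<in> T" for v
    proof -
      have h: "v \<in> hor" using v TS S(2) by auto
      have "fa v \<in> S" "fb v \<in> S" "fc v \<in> S" using v TS S(3-5) by blast+
      moreover have "G u v = 0" "G u (fa v) = 0" "G u (fb v) = 0" "G u (fc v) = 0"
        using v by (simp_all add: T_def skew)
      ultimately show ?thesis by (simp add: T_def skew hor_simps[OF h] G_simps)
    qed
    have "u \<notin> T" using Guu by (auto simp: T_def)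
    then have "T \<subset> S" using TS uS by auto
    then have "dim T < dim S"
      using dim_psubset[of T S] T S(1) by (simp add: span_eq_iff[THEN iffD2])
    from less.hyps[OF this T] obtain U where U: "finite U" "U \<subseteq> T" "quat U" "T \<subseteq> span (frame U)"
      using TS S(2) inv by blast
    have orth: "G u v = 0 \<and> G v u = 0 \<and> G u (fa v) = 0 \<and> G u (fb v) = 0 \<and> G u (fc v) = 0 \<and>
        G v (fa u) = 0 \<and> G v (fb u) = 0 \<and> G v (fc u) = 0 \<and> v \<noteq> u" if "v \<in> U" for v
    proof -
      have v: "v \<in> T" using that U(2) by auto
      have "G u v = 0" "G (fa u) v = 0" "G (fb u) v = 0" "G (fc u) v = 0"
        using v by (simp_all add: T_def)
      moreover have "G u (fa v) = 0" "G u (fb v) = 0" "G u (fc v) = 0"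
        using v by (simp_all add: T_def skew)
      ultimately show ?thesis
        using Guu G(2)[of v u] G(2)[of v "fa u"] G(2)[of v "fb u"] G(2)[of v "fc u"] by auto
    qed
    have "quat (insert u U)"
      using U(3) orth Guu self unfolding quat_def by auto
    moreover have "S \<subseteq> span (frame (insert u U))"
    proof
      fix w assume w: "w \<in> S"
      define z where "z = G u w *\<^sub>R u + G (fa u) w *\<^sub>R fa u + G (fb u) w *\<^sub>R fb u + G (fc u) w *\<^sub>R fc u"
      have "z \<in> S" unfolding z_def using S(1,3-5) uS
        by (intro subspace_add subspace_scale) auto
      then have "w - z \<in> T"
        using w S(1) by (simp add: T_def subspace_diff)
          (simp add: z_def G_simps skew hor_simps[OF u] Guu self)
      then have 1: "w - z \<in> span (frame (insert u U))"
        using U(4) span_mono[of "frame U" "frame (insert u U)"] by (auto simp: frame_def)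
      have 2: "z \<in> span (frame (insert u U))"
        unfolding z_def by (intro span_add span_scale span_base) (auto simp: frame_def)
      show "w \<in> span (frame (insert u U))"
        using span_add[OF 1 2] by simp
    qed
    ultimately show ?thesis
      using U uS TS by (intro exI[of _ "insert u U"]) auto
  qed
qed

lemma quat_frame:
  assumes "quat U" "U \<subseteq> hor"
  shows "x \<in> frame U \<Longrightarrow> y \<in> frame U \<Longrightarrow> G x y = of_bool (x = y)"
    and "finite U \<Longrightarrow> card (frame U) = 4 * card U"
proof -
  have h: "u \<in> U \<Longrightarrow> u \<in> hor" for u using assms(2) by auto
  have q: "G u v = of_bool (u = v)" "G u (fa v) = 0" "G u (fb v) = 0" "G u (fc v) = 0"
    if "u \<in> U" "v \<in> U" for u v using assms(1) that by (auto simp: quat_def)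
  have inj: "fa u = fa v \<longleftrightarrow> u = v" "fb u = fb v \<longleftrightarrow> u = v" "fc u = fc v \<longleftrightarrow> u = v"
    if "u \<in> U" "v \<in> U" for u v
    using hor_simps(4-6)[OF h[OF that(1)]] hor_simps(4-6)[OF h[OF that(2)]] by (metis neg_equal_iff_equal)+
  have ne: "fa u \<noteq> v" "fb u \<noteq> v" "fc u \<noteq> v" "fa u \<noteq> fb v" "fa u \<noteq> fc v" "fb u \<noteq> fc v"
    if "u \<in> U" "v \<in> U" for u v
  proof -
    have neq: "x \<noteq> y" if "G x y = 0" "G y y = 1" for x y using that by auto
    show "fa u \<noteq> v" "fb u \<noteq> v" "fc u \<noteq> v" "fa u \<noteq> fb v" "fa u \<noteq> fc v" "fb u \<noteq> fc v"
      by (rule neq; use that in \<open>simp add: skew q hor_simps h G_simps\<close>)+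
  qed
  show "x \<in> frame U \<Longrightarrow> y \<in> frame U \<Longrightarrow> G x y = of_bool (x = y)"
    unfolding frame_def
    by (elim UnE imageE; simp add: skew q hor_simps h G_simps inj ne ne[THEN not_sym])
  assume fin: "finite U"
  have "card (frame U) = card U + card (fa ` U) + card (fb ` U) + card (fc ` U)"
  proof -
    have "U \<inter> fa ` U = {}" "(U \<union> fa ` U) \<inter> fb ` U = {}" "(U \<union> fa ` U \<union> fb ` U) \<inter> fc ` U = {}"
      using ne by blast+
    then show ?thesis unfolding frame_def using fin by (simp add: card_Un_disjoint)
  qed
  then show "card (frame U) = 4 * card U"
    using inj by (simp add: card_image inj_on_def)
qed

lemma orthonormal_independent:
  assumes "finite N" "\<And>x y. x \<in> N \<Longrightarrow> y \<in> N \<Longrightarrow> G x y = of_bool (x = y)"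
  shows "independent N"
proof (rule independent_if_scalars_zero[OF assms(1)])
  fix r y assume 0: "(\<Sum>x\<in>N. r x *\<^sub>R x) = 0" and y: "y \<in> N"
  have "0 = G (\<Sum>x\<in>N. r x *\<^sub>R x) y" by (simp add: 0 G_simps)
  also have "\<dots> = (\<Sum>x\<in>N. r x * G x y)"
    using linear_sum[of "\<lambda>z. G z y" "\<lambda>x. r x *\<^sub>R x" N] G(1) by (simp add: bilinear_def G_simps)
  also have "\<dots> = (\<Sum>x\<in>N. if x = y then r x else 0)"
    using assms(2)[OF _ y] by (intro sum.cong) auto
  also have "\<dots> = r y" using assms(1) y by simp
  finally show "r y = 0" by simp
qed

subsubsection \<open>The eigenspaces of the structure operator\<close>

text \<open>The eigenspace of \<open>Aop\<close> for \<open>k\<close>, as \<open>K\<close> is that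
  for 0 (\<open>W_iff\<close>, \<open>K_iff\<close>). \<open>Aop\<close> is defined through the
  third structure; conditions on all three operators make the invariance under rotation
  visible.\<close>

definition W :: "'e set" where
  "W = {u \<in> hor. Ba u = k *\<^sub>R fa u \<and> Bb u = k *\<^sub>R fb u \<and> Bc u = k *\<^sub>R fc u}"

definition K :: "'e set" where "K = {u \<in> hor. Ba u = 0 \<and> Bb u = 0 \<and> Bc u = 0}"

definition adapted :: "'e set \<Rightarrow> 'e set \<Rightarrow> bool" where
  "adapted U U' \<longleftrightarrow> finite U \<and> finite U' \<and> U \<subseteq> W \<and> U' \<subseteq> K \<and> quat U \<and> quat U' \<and>
     span ({xa, xb, xc} \<union> frame U \<union> frame U') = UNIV"

definition Aop :: "'e \<Rightarrow> 'e" where "Aop u = - Bc (fc u)"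

text \<open>On horizontal vectors the vertical terms of \<open>Bf1\<close>, \<open>Bf2\<close> and
  \<open>BB\<close> vanish. What remains are multiplication rules such as
  \<open>Bc (fa v) = Bb v\<close> and \<open>fa (Bc v) = - Bb v\<close>, as if each \<open>B\<close>
  were \<open>Aop\<close> times the matching endomorphism.\<close>

lemma Aop:
  assumes u: "u \<in> hor"
  shows "Aop u \<in> hor" "Aop u = - Ba (fa u)" "Aop u = - Bb (fb u)"
    "Ba u = Aop (fa u)" "Bb u = Aop (fb u)" "Bc u = Aop (fc u)"
    "fa (Aop u) = Aop (fa u)" "fb (Aop u) = Aop (fb u)" "fc (Aop u) = Aop (fc u)"
    "Aop (Aop u) = k *\<^sub>R Aop u"
    and "v \<in> hor \<Longrightarrow> G (Aop u) v = G u (Aop v)"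
proof -
  \<comment> \<open>\<open>Bf2\<close> at \<open>fb v\<close> and at \<open>fc v\<close>; this is
    the independence of the index.\<close>
  have ef: "Ba (fa v) = Bc (fc v)" "Bb (fb v) = Bc (fc v)" if v: "v \<in> hor" for v
    using Bf2(1)[of "fb v"] Bf2(2)[of "fc v"] v by (simp_all add: hor_simps)
  have fB: "fa (Bc v) = - Bb v" "fb (Ba v) = - Bc v" "fc (Bb v) = - Ba v" if "v \<in> hor" for v
    using Bf1(1)[of v] Bf1(2)[of v] Bf1(3)[of v] hor_simps(1-3)[OF that] by (metis mult_zero_right scaleR_zero_left add_0_right minus_minus)+
  have fB': "fb (Bc v) = Ba v" "fc (Ba v) = Bb v" "fa (Bb v) = Bc v" if v: "v \<in> hor" for v
    using fB[OF v] v hor_simps(4-6)[OF hor_B(1)[OF v]] hor_simps(4-6)[OF hor_B(2)[OF v]]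
      hor_simps(4-6)[OF hor_B(3)[OF v]] by (metis lin_simps(10-12) minus_minus)+
  have Bf: "Bc (fa v) = Bb v" "Ba (fb v) = Bc v" "Bb (fc v) = Ba v" if "v \<in> hor" for v
    using Bf2[of v] that by (simp_all add: hor_simps)
  have Bf': "Bc (fb v) = - Ba v" "Ba (fc v) = - Bb v" "Bb (fa v) = - Bc v" if v: "v \<in> hor" for v
    using Bf(2)[of "fb v"] Bf(3)[of "fc v"] Bf(1)[of "fa v"] v by (simp_all add: hor_simps lin_simps)
  have comm: "fc (Bc v) = Bc (fc v)" if v: "v \<in> hor" for v
  proof -
    have "fc (Bc v) = fa (fb (Bc v))" using v by (simp add: hor_simps)
    also have "\<dots> = fa (Ba v)" using v by (simp add: fB')
    also have "\<dots> = - fa (Bc (fb v))" using v by (simp add: Bf' lin_simps)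
    also have "\<dots> = Bb (fb v)" using v by (simp add: fB)
    finally show ?thesis using ef[OF v] by simp
  qed
  show "Aop u \<in> hor" using u subspace_neg[OF subspace_hor] by (simp add: Aop_def)
  have A: "Aop v = - Ba (fa v)" "Aop v = - Bb (fb v)" if "v \<in> hor" for v
    using ef[OF that] by (simp_all add: Aop_def)
  show "Aop u = - Ba (fa u)" "Aop u = - Bb (fb u)" using A[OF u] .
  have AA: "Ba u = Aop (fa u)" "Bb u = Aop (fb u)" "Bc u = Aop (fc u)"
    using A(1)[OF hor_f(1)[OF u]] A(2)[OF hor_f(2)[OF u]] Aop_def[of "fc u"]
    by (simp_all add: hor_simps(4-6)[OF u] lin_simps)
  then show "Ba u = Aop (fa u)" "Bb u = Aop (fb u)" "Bc u = Aop (fc u)" .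
  have "fa (Aop u) = Ba u"
    using fB(1)[OF hor_f(3)[OF u]] Bf(3)[OF u] by (simp add: Aop_def lin_simps)
  moreover have "fb (Aop u) = Bb u"
    using fB'(1)[OF hor_f(3)[OF u]] Bf'(2)[OF u] by (simp add: Aop_def lin_simps)
  moreover have "fc (Aop u) = Bc u"
    using comm[OF hor_f(3)[OF u]] by (simp add: Aop_def lin_simps hor_simps(6)[OF u])
  ultimately show "fa (Aop u) = Aop (fa u)" "fb (Aop u) = Aop (fb u)" "fc (Aop u) = Aop (fc u)"
    using AA by simp_all
  show "Aop (Aop u) = k *\<^sub>R Aop u"
  proof -
    have "Aop (Aop u) = Bc (fc (Bc (fc u)))" by (simp add: Aop_def lin_simps)
    \<comment> \<open>\<open>fc\<close> commutes with \<open>Bc\<close> and has square -1 on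
      horizontal vectors, so the square of \<open>Aop\<close> becomes one that \<open>BB\<close>
      computes.\<close>
    also have "\<dots> = - Bc (Bc u)" using u by (simp add: comm hor_simps lin_simps)
    also have "\<dots> = - k *\<^sub>R fa (Ba u)" using BB(1)[of u] u by (simp add: hor_simps)
    also have "fa (Ba u) = Bc (fc u)"
      using u fB(1)[of "fb u"] ef(2)[OF u] by (simp add: Bf' lin_simps)
    finally show ?thesis by (simp add: Aop_def)
  qed
  show "G (Aop u) v = G u (Aop v)" if "v \<in> hor"
    using that by (simp add: Aop_def G_simps Bskew skew comm)
qed

lemma Aop_lin: "Aop (u + v) = Aop u + Aop v" "Aop (u - v) = Aop u - Aop v" "Aop (r *\<^sub>R u) = r *\<^sub>R Aop u"
  by (simp_all add: Aop_def lin_simps)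

lemma W_iff: "u \<in> W \<longleftrightarrow> u \<in> hor \<and> Aop u = k *\<^sub>R u"
proof
  assume u: "u \<in> W"
  then have "fc u \<in> hor" "u \<in> hor" "Bc u = k *\<^sub>R fc u" by (auto simp: W_def)
  then have "fc (Aop u) = k *\<^sub>R fc u" using Aop(6,9)[of u] by simp
  then have "fc (fc (Aop u)) = k *\<^sub>R fc (fc u)" by (simp add: lin_simps)
  then show "u \<in> hor \<and> Aop u = k *\<^sub>R u" using \<open>u \<in> hor\<close> Aop(1)[of u] by (simp add: hor_simps)
next
  assume u: "u \<in> hor \<and> Aop u = k *\<^sub>R u"
  then show "u \<in> W"
    using Aop(4-9)[of u] by (simp add: W_def flip: Aop(7-9)) (simp add: lin_simps)
qed

lemma K_iff: "u \<in> K \<longleftrightarrow> u \<in> hor \<and> Aop u = 0"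
proof
  assume u: "u \<in> K"
  then have "u \<in> hor" "Bc u = 0" by (auto simp: K_def)
  then have "fc (fc (Aop u)) = 0" using Aop(6,9)[of u] by (simp add: lin_simps)
  then show "u \<in> hor \<and> Aop u = 0" using \<open>u \<in> hor\<close> Aop(1)[of u] by (simp add: hor_simps)
next
  assume u: "u \<in> hor \<and> Aop u = 0"
  then show "u \<in> K"
    using Aop(4-9)[of u] by (simp add: K_def flip: Aop(7-9)) (simp add: lin_simps)
qed

lemma vertical_decomp: "u - (G xa u *\<^sub>R xa + G xb u *\<^sub>R xb + G xc u *\<^sub>R xc) \<in> hor"
  by (simp add: hor_def G_simps unit')

lemma ex_adapted:
  assumes k: "k \<noteq> 0"
  shows "\<exists>U U'. adapted U U'"
proof -
  have "subspace W" "subspace K"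
    using subspace_hor by (auto simp: subspace_def W_def K_def lin_simps scaleR_add_right)
  moreover have "f ` W \<subseteq> W \<and> f ` K \<subseteq> K" if "f \<in> {fa, fb, fc}" for f
    using that by (auto simp: W_iff K_iff lin_simps simp flip: Aop(7-9))
  ultimately obtain U U' where U: "finite U" "U \<subseteq> W" "quat U" "W \<subseteq> span (frame U)"
    "finite U'" "U' \<subseteq> K" "quat U'" "K \<subseteq> span (frame U')"
    using ex_quat[of W] ex_quat[of K] by (auto simp: W_def K_def)
  let ?S = "{xa, xb, xc} \<union> frame U \<union> frame U'"
  have "u \<in> span ?S" for u
  proof -
    define h where "h = u - (G xa u *\<^sub>R xa + G xb u *\<^sub>R xb + G xc u *\<^sub>R xc)"
    \<comment> \<open>Because \<open>Aop (Aop h) = k *\<^sub>R Aop h\<close>, division by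
      \<open>k\<close> turns \<open>Aop\<close> into a projection of the horizontal space onto
      \<open>W\<close> along \<open>K\<close>.\<close>
    define w where "w = (1 / k) *\<^sub>R Aop h"
    have h: "h \<in> hor" unfolding h_def by (rule vertical_decomp)
    have "w \<in> W" "h - w \<in> K"
      using h Aop(1,10)[OF h] k subspace_hor
      by (auto simp: W_iff K_iff w_def Aop_lin subspace_scale subspace_diff)
    then have "w \<in> span ?S" "h - w \<in> span ?S"
      using U(4,8) span_mono[of "frame U" ?S] span_mono[of "frame U'" ?S] by auto
    moreover have "G xa u *\<^sub>R xa + G xb u *\<^sub>R xb + G xc u *\<^sub>R xc \<in> span ?S"
      by (intro span_add span_scale span_base) auto
    moreover have "u = (w + (h - w)) + (G xa u *\<^sub>R xa + G xb u *\<^sub>R xb + G xc u *\<^sub>R xc)"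
      by (simp add: h_def)
    ultimately show ?thesis by (metis span_add)
  qed
  then show ?thesis using U unfolding adapted_def by blast
qed

lemma adapted_hor: "adapted U U' \<Longrightarrow> U \<subseteq> hor \<and> U' \<subseteq> hor"
  by (auto simp: adapted_def W_def K_def)


lemma W_f: "u \<in> W \<Longrightarrow> fa u \<in> W" "u \<in> W \<Longrightarrow> fb u \<in> W" "u \<in> W \<Longrightarrow> fc u \<in> W"
  and K_f: "u \<in> K \<Longrightarrow> fa u \<in> K" "u \<in> K \<Longrightarrow> fb u \<in> K" "u \<in> K \<Longrightarrow> fc u \<in> K"
  by (auto simp: W_iff K_iff lin_simps simp flip: Aop(7-9))

lemma adapted_frame:
  assumes "adapted U U'"
  shows "frame U \<subseteq> W" "frame U' \<subseteq> K" "frame U \<subseteq> hor" "frame U' \<subseteq> hor"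
    "finite (frame U)" "finite (frame U')"
    "card (frame U) = 4 * card U" "card (frame U') = 4 * card U'"
proof -
  note d = assms[unfolded adapted_def]
  have h: "U \<subseteq> hor" "U' \<subseteq> hor" using adapted_hor[OF assms] by auto
  show W: "frame U \<subseteq> W" and K: "frame U' \<subseteq> K"
    using d W_f K_f unfolding frame_def by blast+
  show "frame U \<subseteq> hor" "frame U' \<subseteq> hor" using W K by (auto simp: W_def K_def)
  show "finite (frame U)" "finite (frame U')" using d by (auto simp: frame_def)
  show "card (frame U) = 4 * card U" "card (frame U') = 4 * card U'"
    using quat_frame(2)[OF _ h(1)] quat_frame(2)[OF _ h(2)] d by auto
qed

text \<open>\<open>W\<close> and \<open>K\<close> are orthogonal as eigenspaces of the symmetric
  \<open>Aop\<close> for distinct eigenvalues. Hence the Reeb vectors and both frames form an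
  orthonormal basis, whose size is the dimension.\<close>

lemma adapted_card:
  assumes ad: "adapted U U'" and k: "k \<noteq> 0"
  shows "4 * card U + 4 * card U' + 3 = DIM('e)"
proof -
  note d = ad[unfolded adapted_def] and f = adapted_frame[OF ad]
  have h: "U \<subseteq> hor" "U' \<subseteq> hor" using adapted_hor[OF ad] by auto
  have 1: "G x y = 0" "G y x = 0" if "x \<in> frame U" "y \<in> frame U'" for x y
  proof -
    have "x \<in> W" "y \<in> K" using that f by auto
    then have "k * G x y = 0" using Aop(11)[of x y] by (simp add: W_iff K_iff G_simps)
    then show "G x y = 0" "G y x = 0" using k G(2)[of x y] by auto
  qed
  define T where "T = {xa, xb, xc}"
  have 2: "G x y = 0" "G y x = 0" if "x \<in> T" "y \<in> frame U \<union> frame U'" for x y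
  proof -
    have "y \<in> hor" using that f by auto
    then show "G x y = 0" "G y x = 0"
      using that(1) hor_simps(1-3)[of y] G(2)[of x y] by (auto simp: T_def)
  qed
  have 3: "G x y = of_bool (x = y)" if "x \<in> T" "y \<in> T" for x y
    using that unit' by (auto simp: T_def)
  have 4: "G x y = of_bool (x = y)" if "x \<in> frame U" "y \<in> frame U" for x y
    using quat_frame(1)[OF _ h(1) that] d by auto
  have 5: "G x y = of_bool (x = y)" if "x \<in> frame U'" "y \<in> frame U'" for x y
    using quat_frame(1)[OF _ h(2) that] d by auto
  have dis1: "frame U \<inter> frame U' = {}"
    using 1(1) 4 by (metis disjoint_iff of_bool_eq(2) zero_neq_one)
  have dis2: "T \<inter> (frame U \<union> frame U') = {}"
    using 2(1) 3 by (metis disjoint_iff of_bool_eq(2) zero_neq_one)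
  let ?N = "T \<union> (frame U \<union> frame U')"
  have 6: "G x y = of_bool (x = y)" "G y x = of_bool (y = x)" if "x \<in> frame U" "y \<in> frame U'" for x y
    using 1[OF that] that dis1 by auto
  have 7: "G x y = of_bool (x = y)" "G y x = of_bool (y = x)" if "x \<in> T" "y \<in> frame U \<union> frame U'" for x y
    using 2[OF that] that dis2 by auto
  have "G x y = of_bool (x = y)" if "x \<in> ?N" "y \<in> ?N" for x y
    using that by (elim UnE) (simp_all only: 3 4 5 6 7 Un_iff simp_thms)
  then have "independent ?N"
    using f by (intro orthonormal_independent) (auto simp: T_def)
  then have "card ?N = dim (span ?N)" by (rule dim_span_eq_card_independent[symmetric])
  also have "span ?N = UNIV" using d by (simp add: Un_assoc T_def)
  finally have "card ?N = DIM('e)" by simp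
  moreover have "card T = 3" "finite T"
    using unit' by (auto simp: T_def card_insert_if)
  moreover have "card ?N = card T + (card (frame U) + card (frame U'))"
    using f dis1 dis2 \<open>finite T\<close> by (simp add: card_Un_disjoint)
  ultimately show ?thesis using f by simp
qed

text \<open>Since \<open>fc (fa u) = fb u\<close>, the endomorphism \<open>fc\<close> sends
  \<open>L\<close> to the other half of the real frame, which is orthogonal to \<open>L\<close>. So
  \<open>L\<close> is Lagrangian for \<open>G x (fc y)\<close> on the span of that frame.\<close>

lemma lagrangian:
  assumes V: "finite V" "V \<subseteq> hor" "quat V"
  defines "L \<equiv> V \<union> fa ` V"
  shows "finite L" "card L = 2 * card V" "L \<subseteq> hor"
    "x \<in> L \<Longrightarrow> y \<in> L \<Longrightarrow> G x y = of_bool (x = y)" "x \<in> L \<Longrightarrow> y \<in> L \<Longrightarrow> G x (fc y) = 0"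
proof -
  have h: "v \<in> V \<Longrightarrow> v \<in> hor" for v using V(2) by auto
  have q: "G u v = of_bool (u = v)" "G u (fa v) = 0" "G u (fb v) = 0" "G u (fc v) = 0"
    if "u \<in> V" "v \<in> V" for u v using V(3) that by (auto simp: quat_def)
  show "finite L" "L \<subseteq> hor" using V by (auto simp: L_def)
  show orth: "G x y = of_bool (x = y)" if "x \<in> L" "y \<in> L" for x y
    using quat_frame(1)[OF V(3,2), of x y] that by (auto simp: L_def frame_def)
  show "G x (fc y) = 0" if "x \<in> L" "y \<in> L"
    using that unfolding L_def
    by (elim UnE imageE) (simp_all add: skew(1) q hor_simps[OF h] G_simps)
  have "fa u \<noteq> v" if "u \<in> V" "v \<in> V" for u v
    using q(1)[of v v] q(2)[of v u] that by auto
  then have "V \<inter> fa ` V = {}" by blast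
  moreover have "inj_on fa V"
    by (intro inj_onI) (metis h hor_simps(4) neg_equal_iff_equal)
  ultimately show "card L = 2 * card V"
    using V(1) by (simp add: L_def card_Un_disjoint card_image)
qed

text \<open>The value of d\<eta> for the third structure; the factor 1/2 is there because
  \<open>Bc\<close> represents twice that form. Accordingly the \<open>1 / k\<close> in
  \<open>psi\<close> amounts to \<open>2 / k\<close> times \<open>wc\<close>, and \<open>psi\<close>
  vanishes where \<open>Bc\<close> is \<open>k\<close> times \<open>fc\<close>.\<close>

definition wc :: "'e \<Rightarrow> 'e \<Rightarrow> real" where "wc u v = 1 / 2 * G u (Bc v)"

definition psi :: "'e \<Rightarrow> 'e \<Rightarrow> real" where "psi u v = G u (fc v) - 1 / k * G u (Bc v)"

lemma bilinear_wc: "bilinear wc" and bilinear_psi: "bilinear psi"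
  by (auto simp: bilinear_def wc_def psi_def G_simps lin_simps algebra_simps add_divide_distrib intro!: linearI)

text \<open>On \<open>W\<close> and on the plane of \<open>xa\<close>, \<open>xb\<close> the form is
  \<open>k / 2\<close> times \<open>G u (fc v)\<close>. A Lagrangian in \<open>n\<close>
  quaternionic lines has \<open>2 * n\<close> members, and \<open>xa\<close>, with partner
  \<open>fc xa = xb\<close>, adds one more. All entries lie in the kernel of the one-form
  \<open>G xc\<close>, as the wedge product with it will require.\<close>

lemma wc_symplectic:
  assumes ad: "adapted U U'" and k: "k \<noteq> 0" and n: "n \<le> card U"
  obtains e where "symplectic_seq wc (- (k / 2)) (2 * n + 1) e" "\<And>i. i < 2 * (2 * n + 1) \<Longrightarrow> G xc (e i) = 0"
proof -
  note d = ad[unfolded adapted_def]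
  obtain V where V: "V \<subseteq> U" "card V = n" "finite V" using obtain_subset_with_card_n[OF n] by auto
  have Vh: "V \<subseteq> hor" using V adapted_hor[OF ad] by auto
  have qV: "quat V" using d V(1) unfolding quat_def by blast
  define L where "L = V \<union> fa ` V"
  note L = lagrangian[OF V(3) Vh qV, folded L_def]
  let ?M = "insert xa L"
  have hL: "y \<in> hor" if "y \<in> L" for y using that L(3) by auto
  have Gh: "G xa y = 0" "G y xa = 0" "G y xb = 0" if "y \<in> hor" for y
    using hor_simps(1-2)[OF that] G(2)[of y] by simp_all
  have ne: "xa \<noteq> y" "y \<noteq> xa" if "y \<in> L" for y
    using Gh(1)[OF hL[OF that]] unit(1) by auto
  have card: "card ?M = 2 * n + 1" using L(1,2) ne V(2) by (subst card_insert_disjoint) auto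
  have LW: "y \<in> W" if "y \<in> L" for y using that d V(1) W_f(1) unfolding L_def by blast
  have M: "y = xa \<or> y = xb \<or> y \<in> W" if "y \<in> ?M \<union> fc ` ?M" for y
    using that LW W_f(3) fx(7) by blast
  have Bf: "Bc y = k *\<^sub>R fc y" if y: "y \<in> ?M \<union> fc ` ?M" for y
    using M[OF y] by (elim disjE) (simp_all add: Bx fx W_def)
  obtain e where e: "symplectic_seq wc (- (k / 2)) (card ?M) e"
    "\<And>i. i < 2 * card ?M \<Longrightarrow> e i \<in> ?M \<union> fc ` ?M"
  proof (rule symplectic_seq_of_lagrangian[of ?M G fc wc "k / 2"])
    show "G x y = of_bool (x = y)" if "x \<in> ?M" "y \<in> ?M" for x y
      using that by (elim insertE) (simp_all add: unit L(4) Gh[OF hL] ne)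
    show "G x (fc y) = 0" if "x \<in> ?M" "y \<in> ?M" for x y
      using that by (elim insertE) (simp_all add: unit L(5) Gh[OF hL] Gh[OF hor_f(3)[OF hL]] fx)
    show "fc (fc x) = - x" if "x \<in> ?M" for x
      using that by (elim insertE) (simp_all add: fx hor_simps(6)[OF hL])
    show "wc x y = k / 2 * G x (fc y)" if "y \<in> ?M \<union> fc ` ?M" for x y
      using Bf[OF that] by (simp add: wc_def G_simps)
    show "finite ?M" using L(1) by simp
  qed (rule G(1) skew(3) | blast)+
  have "G xc (e i) = 0" if "i < 2 * (2 * n + 1)" for i
  proof -
    have "e i = xa \<or> e i = xb \<or> e i \<in> W" using M e(2)[of i] that card by metis
    then show ?thesis using unit' hor_simps(3)[of "e i"] unfolding W_def by auto
  qed
  then show ?thesis using that e(1) card by metis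
qed

text \<open>\<open>xc\<close> and \<open>K\<close> lie in the radical, and at most
  \<open>4 * card U + 2\<close> frame vectors lie outside it, too few for \<open>2 * n\<close>
  independent arguments.\<close>

lemma wc_vanish:
  assumes ad: "adapted U U'" and n: "2 * card U + 1 < n"
  shows "alt_power wc n u = 0"
proof (rule alt_power_eq_0[OF bilinear_wc, of "frame U \<union> {xa, xb}" _ "{xc} \<union> frame U'"])
  note d = ad[unfolded adapted_def] and f = adapted_frame[OF ad]
  show "finite (frame U \<union> {xa, xb})" using f by simp
  have "card (frame U \<union> {xa, xb}) \<le> card (frame U) + card {xa, xb}" by (rule card_Un_le)
  also have "card {xa, xb} \<le> 2" by (simp add: card_insert_if)
  finally show "card (frame U \<union> {xa, xb}) < 2 * n" using f n by simp
  have "frame U \<union> {xa, xb} \<union> ({xc} \<union> frame U') = {xa, xb, xc} \<union> frame U \<union> frame U'" by auto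
  then show "span (frame U \<union> {xa, xb} \<union> ({xc} \<union> frame U')) = UNIV" using d by simp
  fix z v assume "z \<in> {xc} \<union> frame U'"
  then have "z = xc \<or> z \<in> K" using f(2) by blast
  then have "Bc z = 0" by (elim disjE) (simp_all add: Bx K_def)
  then show "wc z v = 0" "wc v z = 0" using Bskew(3)[of z v] by (simp_all add: wc_def G_simps)
qed

text \<open>On \<open>K\<close> the operator \<open>Bc\<close> vanishes, so \<open>psi\<close> is
  \<open>G u (fc v)\<close> there.\<close>

lemma psi_symplectic:
  assumes ad: "adapted U U'" and n: "n \<le> card U'"
  obtains e where "symplectic_seq psi (- 1) (2 * n) e"
proof -
  note d = ad[unfolded adapted_def]
  obtain V where V: "V \<subseteq> U'" "card V = n" "finite V" using obtain_subset_with_card_n[OF n] by auto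
  have Vh: "V \<subseteq> hor" using V adapted_hor[OF ad] by auto
  have qV: "quat V" using d V(1) unfolding quat_def by blast
  note L = lagrangian[OF V(3) Vh qV]
  let ?L = "V \<union> fa ` V"
  have LK: "y \<in> K" if "y \<in> ?L \<union> fc ` ?L" for y
  proof -
    have "?L \<subseteq> K" using d V K_f by auto
    then show ?thesis using that K_f(3) by auto
  qed
  obtain e where e: "symplectic_seq psi (- 1) (card ?L) e"
  proof (rule symplectic_seq_of_lagrangian[of ?L G fc psi 1])
    show "fc (fc x) = - x" if "x \<in> ?L" for x using that L(3) hor_simps(6) by auto
    show "psi x y = 1 * G x (fc y)" if "y \<in> ?L \<union> fc ` ?L" for x y
      using LK[OF that] by (simp add: psi_def K_def G_simps)
  qed (rule G(1) skew(3) L(1) L(4) L(5) | assumption | blast)+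
  then show ?thesis using that L(2) V(2) by metis
qed

text \<open>\<open>Bc\<close> is \<open>k\<close> times \<open>fc\<close> on \<open>W\<close> and on
  all three Reeb vectors, so these lie in the radical and only the \<open>4 * card U'\<close>
  vectors of \<open>frame U'\<close> are left.\<close>

lemma psi_vanish:
  assumes ad: "adapted U U'" and k: "k \<noteq> 0" and n: "2 * card U' < n"
  shows "alt_power psi n u = 0"
proof (rule alt_power_eq_0[OF bilinear_psi, of "frame U'" _ "{xa, xb, xc} \<union> frame U"])
  note d = ad[unfolded adapted_def] and f = adapted_frame[OF ad]
  show "finite (frame U')" "card (frame U') < 2 * n" using f n by simp_all
  show "span (frame U' \<union> ({xa, xb, xc} \<union> frame U)) = UNIV" using d by (simp add: Un_commute)
  fix z v assume "z \<in> {xa, xb, xc} \<union> frame U"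
  then have "z = xa \<or> z = xb \<or> z = xc \<or> z \<in> W" using f(1) by blast
  then have B: "Bc z = k *\<^sub>R fc z" by (elim disjE) (simp_all add: Bx fx W_def)
  have "G z (Bc v) = - G (Bc z) v" unfolding Bskew(3) by simp
  also have "\<dots> = k * G z (fc v)" unfolding B G_simps skew(3) by simp
  finally show "psi z v = 0" using k by (simp add: psi_def)
  show "psi v z = 0" using k by (simp add: psi_def B G_simps)
qed

text \<open>For \<open>k = 0\<close> the symmetric operator \<open>Aop\<close> has square 0, and
  positivity of \<open>G\<close> forces it to vanish on horizontal vectors. On the Reeb vectors
  \<open>Bc\<close> is a multiple of \<open>k\<close>.\<close>

lemma Bc_zero:
  assumes k: "k = 0"
  shows "Bc u = 0"
proof -
  define h where "h = u - (G xa u *\<^sub>R xa + G xb u *\<^sub>R xb + G xc u *\<^sub>R xc)"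
  have h: "h \<in> hor" unfolding h_def by (rule vertical_decomp)
  have A: "Aop v = 0" if v: "v \<in> hor" for v
  proof -
    have "G (Aop v) (Aop v) = 0"
      using Aop(11)[OF v Aop(1)[OF v]] Aop(10)[OF v] k by (simp add: G_simps)
    then show ?thesis using G(3)[of "Aop v"] by force
  qed
  have "Bc h = 0" using Aop(6)[OF h] A[of "fc h"] h by simp
  moreover have "Bc u = Bc (h + (G xa u *\<^sub>R xa + G xb u *\<^sub>R xb + G xc u *\<^sub>R xc))" by (simp add: h_def)
  ultimately show ?thesis by (simp only: lin_simps Bx k) simp
qed

text \<open>The source of the common rank: the same \<open>U\<close> and \<open>U'\<close> serve all
  three structures.\<close>

lemma adapted_rotate: "contact3.adapted G k fb xb Bb fc xc Bc fa xa Ba U U' \<longleftrightarrow> adapted U U'"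
proof -
  interpret r: contact3 G k fb xb Bb fc xc Bc fa xa Ba by (rule rotate)
  have hor: "r.hor = hor" unfolding r.hor_def hor_def by blast
  have "r.W = W" "r.K = K" unfolding r.W_def W_def r.K_def K_def hor by blast+
  moreover have "r.quat = quat" by (rule ext) (unfold r.quat_def quat_def, blast)
  moreover have "r.frame = frame" by (rule ext) (unfold r.frame_def frame_def, blast)
  moreover have "{xb, xc, xa} = {xa, xb, xc}" by auto
  ultimately show ?thesis by (simp add: r.adapted_def adapted_def)
qed

end

subsection \<open>Evaluation at a point\<close>

text \<open>\<open>ev\<close> reads a field at the point in linear coordinates, \<open>val\<close>
  reads a function there, and \<open>G\<close> is the metric in these coordinates.\<close>

locale point_evaluation = metric_lie F V sm act br g
  for F :: "'f::comm_ring_1 set" and V :: "'v::ab_group_add set" and sm act br g +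
  fixes ev :: "'v \<Rightarrow> 'e::euclidean_space" and val :: "'f \<Rightarrow> real" and G :: "'e \<Rightarrow> 'e \<Rightarrow> real"
  assumes ev_surj: "\<exists>X\<in>V. ev X = u"
    and ev_add: "X \<in> V \<Longrightarrow> Y \<in> V \<Longrightarrow> ev (X + Y) = ev X + ev Y"
    and ev_sm: "f \<in> F \<Longrightarrow> X \<in> V \<Longrightarrow> ev (sm f X) = val f *\<^sub>R ev X"
    and val: "val 0 = 0" "val 1 = 1" "f \<in> F \<Longrightarrow> val (- f) = - val f"
      "f \<in> F \<Longrightarrow> h \<in> F \<Longrightarrow> val (f * h) = val f * val h"
    and G: "bilinear G" "G u v = G v u" "u \<noteq> 0 \<Longrightarrow> 0 < G u u"
    and G_ev: "X \<in> V \<Longrightarrow> Y \<in> V \<Longrightarrow> G (ev X) (ev Y) = val (g X Y)"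
begin

lemma ev_0: "ev 0 = 0"
  using ev_add[of 0 0] by simp

lemma ev_minus: "X \<in> V \<Longrightarrow> ev (- X) = - ev X"
  using ev_add[of X "- X"] by (simp add: ev_0 eq_neg_iff_add_eq_0 add.commute)

lemma ev_diff: "X \<in> V \<Longrightarrow> Y \<in> V \<Longrightarrow> ev (X - Y) = ev X - ev Y"
  using ev_add[of X "- Y"] by (simp add: ev_minus)

lemma G_eqI:
  assumes "\<And>w. G u w = G v w"
  shows "u = v"
proof (rule ccontr)
  assume "u \<noteq> v"
  then have "0 < G (u - v) (u - v)" using G(3)[of "u - v"] by simp
  then show False using assms by (simp add: bilinear_lsub[OF G(1)])
qed

definition lift_op :: "('v \<Rightarrow> 'v) \<Rightarrow> 'e \<Rightarrow> 'e" where
  "lift_op T u = ev (T (SOME X. X \<in> V \<and> ev X = u))"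

definition skew_op :: "('v \<Rightarrow> 'v) \<Rightarrow> bool" where
  "skew_op T \<longleftrightarrow> (\<forall>X\<in>V. T X \<in> V) \<and> (\<forall>X\<in>V. \<forall>Y\<in>V. g (T X) Y = - g X (T Y))"

text \<open>A skew operator is tensorial: \<open>G (ev (T X)) (ev Y) = - G (ev X) (ev (T Y))\<close> depends on \<open>X\<close>
  only through \<open>ev X\<close>.\<close>

lemma lift_op:
  assumes T: "skew_op T"
  shows "X \<in> V \<Longrightarrow> lift_op T (ev X) = ev (T X)"
    and "G (lift_op T u) v = - G u (lift_op T v)"
    and "linear (lift_op T)"
proof -
  have TV: "X \<in> V \<Longrightarrow> T X \<in> V" for X using T by (simp add: skew_op_def)
  have sk: "G (ev (T X)) (ev Y) = - G (ev X) (ev (T Y))" if "X \<in> V" "Y \<in> V" for X Y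
    using T that TV by (simp add: skew_op_def G_ev val)
  show lift: "lift_op T (ev X) = ev (T X)" if X: "X \<in> V" for X
  proof -
    define X' where "X' = (SOME Y. Y \<in> V \<and> ev Y = ev X)"
    have X': "X' \<in> V" "ev X' = ev X"
      using someI[of "\<lambda>Y. Y \<in> V \<and> ev Y = ev X" X] X unfolding X'_def by auto
    have "ev (T X') = ev (T X)"
    proof (rule G_eqI)
      fix w
      obtain Y where Y: "Y \<in> V" "w = ev Y" using ev_surj[of w] by auto
      then show "G (ev (T X')) w = G (ev (T X)) w" using sk X X' by simp
    qed
    then show ?thesis by (simp add: lift_op_def X'_def)
  qed
  show sk': "G (lift_op T u) v = - G u (lift_op T v)" for u v
  proof -
    obtain X Y where "X \<in> V" "u = ev X" "Y \<in> V" "v = ev Y" using ev_surj[of u] ev_surj[of v] by auto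
    then show ?thesis by (simp add: lift sk)
  qed
  show "linear (lift_op T)"
  proof (rule linearI)
    show "lift_op T (u + v) = lift_op T u + lift_op T v" for u v
      by (rule G_eqI) (simp add: sk' bilinear_ladd[OF G(1)])
    show "lift_op T (r *\<^sub>R u) = r *\<^sub>R lift_op T u" for r u
      by (rule G_eqI) (simp add: sk' bilinear_lmul[OF G(1)])
  qed
qed

end

locale three_quasi_sasaki_point =
  three_quasi_sasaki F V sm act br g \<phi>a \<xi>a \<phi>b \<xi>b \<phi>c \<xi>c \<kappa> + point_evaluation F V sm act br g ev val G
  for F :: "'f::comm_ring_1 set" and V :: "'v::ab_group_add set" and sm act br g
    and \<phi>a \<xi>a \<phi>b \<xi>b \<phi>c \<xi>c \<kappa> and ev :: "'v \<Rightarrow> 'e::euclidean_space" and val G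
begin

lemma rotate_point: "three_quasi_sasaki_point F V sm act br g \<phi>b \<xi>b \<phi>c \<xi>c \<phi>a \<xi>a \<kappa> ev val G"
  using rotate point_evaluation_axioms by (rule three_quasi_sasaki_point.intro)

lemma rel': "\<phi>c \<xi>a = \<xi>b" "\<phi>c \<xi>b = - \<xi>a" "\<phi>a \<xi>c = - \<xi>b"
proof -
  interpret r: three_quasi_sasaki F V sm act br g \<phi>b \<xi>b \<phi>c \<xi>c \<phi>a \<xi>a \<kappa> by (rule rotate)
  interpret rr: three_quasi_sasaki F V sm act br g \<phi>c \<xi>c \<phi>a \<xi>a \<phi>b \<xi>b \<kappa> by (rule r.rotate)
  show "\<phi>c \<xi>a = \<xi>b" by (rule r.rel(7))
  show "\<phi>c \<xi>b = - \<xi>a" by (rule r.rel(6))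
  show "\<phi>a \<xi>c = - \<xi>b" by (rule rr.rel(6))
qed

lemma skew_op_phi: "skew_op \<phi>a" "skew_op \<phi>b" "skew_op \<phi>c"
  by (simp_all add: skew_op_def a.phi_skew b.phi_skew c.phi_skew)

lemma skew_op_lie_op: "skew_op (lie_op \<phi>b \<xi>a)"
  unfolding skew_op_def
proof (intro conjI ballI)
  fix X Y assume V: "X \<in> V" "Y \<in> V"
  then have "g (lie_op \<phi>b \<xi>a X) Y = dd \<xi>c Y X" by (simp add: g_sym[of _ Y] g_lie_op)
  then show "g (lie_op \<phi>b \<xi>a X) Y = - g X (lie_op \<phi>b \<xi>a Y)"
    using V dd_antisym[of \<xi>c Y X] by (simp add: g_lie_op)
qed simp

lemma phi_point:
  "lift_op \<phi>a (ev \<xi>a) = 0" "lift_op \<phi>a (ev \<xi>b) = ev \<xi>c" "lift_op \<phi>a (ev \<xi>c) = - ev \<xi>b"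
  "lift_op \<phi>a (lift_op \<phi>a u) = - u + G (ev \<xi>a) u *\<^sub>R ev \<xi>a"
  "lift_op \<phi>a (lift_op \<phi>b u) = lift_op \<phi>c u + G (ev \<xi>b) u *\<^sub>R ev \<xi>a"
  "lift_op \<phi>b (lift_op \<phi>a u) = - lift_op \<phi>c u + G (ev \<xi>a) u *\<^sub>R ev \<xi>b"
  "G (ev \<xi>a) (ev \<xi>a) = 1" "G (ev \<xi>a) (ev \<xi>b) = 0"
proof -
  note L = skew_op_phi[THEN lift_op(1)]
  show "lift_op \<phi>a (ev \<xi>a) = 0" "lift_op \<phi>a (ev \<xi>b) = ev \<xi>c" "lift_op \<phi>a (ev \<xi>c) = - ev \<xi>b"
    by (simp_all add: L a.phi_xi rel rel' ev_0 ev_minus)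
  obtain X where X: "X \<in> V" "u = ev X" using ev_surj[of u] by auto
  show "lift_op \<phi>a (lift_op \<phi>a u) = - u + G (ev \<xi>a) u *\<^sub>R ev \<xi>a"
    using X by (simp add: L a.phi_phi ev_add ev_diff ev_sm ev_minus G_ev)
  show "lift_op \<phi>a (lift_op \<phi>b u) = lift_op \<phi>c u + G (ev \<xi>b) u *\<^sub>R ev \<xi>a"
    using X by (simp add: L rel(1) ev_diff ev_sm G_ev)
  show "lift_op \<phi>b (lift_op \<phi>a u) = - lift_op \<phi>c u + G (ev \<xi>a) u *\<^sub>R ev \<xi>b"
    using X by (simp add: L rel(2) ev_add ev_diff ev_minus ev_sm G_ev)
  show "G (ev \<xi>a) (ev \<xi>a) = 1" by (simp add: G_ev a.xi_unit val)
  have "g \<xi>a \<xi>b = 0" using rels(1) unfolding quaternion_rel_def by blast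
  then show "G (ev \<xi>a) (ev \<xi>b) = 0" by (simp add: G_ev val)
qed

lemma lie_op_point:
  "lift_op (lie_op \<phi>b \<xi>a) (ev \<xi>c) = 0" "lift_op (lie_op \<phi>b \<xi>a) (ev \<xi>a) = val \<kappa> *\<^sub>R ev \<xi>b"
  "lift_op (lie_op \<phi>b \<xi>a) (ev \<xi>b) = - val \<kappa> *\<^sub>R ev \<xi>a"
  "lift_op (lie_op \<phi>a \<xi>c) u = - lift_op \<phi>a (lift_op (lie_op \<phi>b \<xi>a) u) + (val \<kappa> * G (ev \<xi>c) u) *\<^sub>R ev \<xi>a"
  "lift_op (lie_op \<phi>a \<xi>c) u = lift_op (lie_op \<phi>b \<xi>a) (lift_op \<phi>a u) - (val \<kappa> * G (ev \<xi>a) u) *\<^sub>R ev \<xi>c"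
  "lift_op (lie_op \<phi>b \<xi>a) (lift_op (lie_op \<phi>b \<xi>a) u) = val \<kappa> *\<^sub>R lift_op \<phi>a (lift_op (lie_op \<phi>c \<xi>b) u)
    + (val \<kappa> * val \<kappa> * G (ev \<xi>c) u) *\<^sub>R ev \<xi>c - (val \<kappa> * val \<kappa> * G (ev \<xi>a) u) *\<^sub>R ev \<xi>a"
proof -
  interpret r: three_quasi_sasaki_point F V sm act br g \<phi>b \<xi>b \<phi>c \<xi>c \<phi>a \<xi>a \<kappa> ev val G
    by (rule rotate_point)
  interpret rr: three_quasi_sasaki_point F V sm act br g \<phi>c \<xi>c \<phi>a \<xi>a \<phi>b \<xi>b \<kappa> ev val G
    by (rule r.rotate_point)
  note L = skew_op_phi[THEN lift_op(1)] skew_op_lie_op[THEN lift_op(1)] r.skew_op_lie_op[THEN lift_op(1)]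
    rr.skew_op_lie_op[THEN lift_op(1)]
  show "lift_op (lie_op \<phi>b \<xi>a) (ev \<xi>c) = 0" "lift_op (lie_op \<phi>b \<xi>a) (ev \<xi>a) = val \<kappa> *\<^sub>R ev \<xi>b"
    "lift_op (lie_op \<phi>b \<xi>a) (ev \<xi>b) = - val \<kappa> *\<^sub>R ev \<xi>a"
    by (simp_all add: L lie_op_xi ev_0 ev_sm ev_minus)
  obtain X where X: "X \<in> V" "u = ev X" using ev_surj[of u] by auto
  show "lift_op (lie_op \<phi>a \<xi>c) u = - lift_op \<phi>a (lift_op (lie_op \<phi>b \<xi>a) u) + (val \<kappa> * G (ev \<xi>c) u) *\<^sub>R ev \<xi>a"
    using X lie_op_phi(1)[OF X(1)] by (simp add: L ev_add[of "- _"] ev_minus ev_sm G_ev val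
      del: add_uminus_conv_diff uminus_add_conv_diff)
  show "lift_op (lie_op \<phi>a \<xi>c) u = lift_op (lie_op \<phi>b \<xi>a) (lift_op \<phi>a u) - (val \<kappa> * G (ev \<xi>a) u) *\<^sub>R ev \<xi>c"
    using X lie_op_phi(2)[OF X(1)] by (simp add: L ev_diff ev_sm G_ev val)
  show "lift_op (lie_op \<phi>b \<xi>a) (lift_op (lie_op \<phi>b \<xi>a) u) = val \<kappa> *\<^sub>R lift_op \<phi>a (lift_op (lie_op \<phi>c \<xi>b) u)
    + (val \<kappa> * val \<kappa> * G (ev \<xi>c) u) *\<^sub>R ev \<xi>c - (val \<kappa> * val \<kappa> * G (ev \<xi>a) u) *\<^sub>R ev \<xi>a"
    using X lie_op_lie_op[OF X(1)] by (simp add: L ev_diff ev_add ev_sm G_ev val)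
qed

lemma contact3:
  "contact3 G (val \<kappa>) (lift_op \<phi>a) (ev \<xi>a) (lift_op (lie_op \<phi>c \<xi>b)) (lift_op \<phi>b) (ev \<xi>b) (lift_op (lie_op \<phi>a \<xi>c))
    (lift_op \<phi>c) (ev \<xi>c) (lift_op (lie_op \<phi>b \<xi>a))"
proof -
  interpret r: three_quasi_sasaki_point F V sm act br g \<phi>b \<xi>b \<phi>c \<xi>c \<phi>a \<xi>a \<kappa> ev val G
    by (rule rotate_point)
  interpret rr: three_quasi_sasaki_point F V sm act br g \<phi>c \<xi>c \<phi>a \<xi>a \<phi>b \<xi>b \<kappa> ev val G
    by (rule r.rotate_point)
  have ac: "G (ev \<xi>a) (ev \<xi>c) = 0" using rr.phi_point(8) G(2)[of "ev \<xi>a"] by simp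
  note lifts = skew_op_phi[THEN lift_op(3)] r.skew_op_lie_op[THEN lift_op(3)]
    rr.skew_op_lie_op[THEN lift_op(3)] skew_op_lie_op[THEN lift_op(3)]
  show ?thesis
    by (rule contact3.intro[OF G lifts phi_point(7) r.phi_point(7) rr.phi_point(7)
        phi_point(8) r.phi_point(8) ac phi_point(4) r.phi_point(4) rr.phi_point(4)
        skew_op_phi[THEN lift_op(2)] phi_point(1-3) r.phi_point(3,1,2) rr.phi_point(2,3,1)
        phi_point(5) r.phi_point(5) rr.phi_point(5) phi_point(6) r.phi_point(6) rr.phi_point(6)
        r.skew_op_lie_op[THEN lift_op(2)] rr.skew_op_lie_op[THEN lift_op(2)] skew_op_lie_op[THEN lift_op(2)]
        r.lie_op_point(1-3) rr.lie_op_point(1-3) lie_op_point(1-3)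
        lie_op_point(4) r.lie_op_point(4) rr.lie_op_point(4)
        lie_op_point(5) r.lie_op_point(5) rr.lie_op_point(5)
        lie_op_point(6) r.lie_op_point(6) rr.lie_op_point(6)])
qed

lemma G_lift_lie_op: "X \<in> V \<Longrightarrow> Y \<in> V \<Longrightarrow> G (ev X) (lift_op (lie_op \<phi>b \<xi>a) (ev Y)) = val (dd \<xi>c X Y)"
  using g_lie_op[of X Y] by (simp add: skew_op_lie_op[THEN lift_op(1)] G_ev)

end

subsection \<open>Manifolds with a Riemannian metric\<close>

definition fsmult :: "('m \<Rightarrow> real) \<Rightarrow> 'm vfield \<Rightarrow> 'm vfield" where
  "fsmult f X = (\<lambda>p h. f p * X p h)"

definition fderiv :: "'m vfield \<Rightarrow> ('m \<Rightarrow> real) \<Rightarrow> 'm \<Rightarrow> real" where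
  "fderiv X f = (\<lambda>p. X p f)"

definition fmetric :: "'m tensor02 \<Rightarrow> 'm vfield \<Rightarrow> 'm vfield \<Rightarrow> 'm \<Rightarrow> real" where
  "fmetric g X Y = (\<lambda>p. g p (X p) (Y p))"

definition fendo :: "'m tensor11 \<Rightarrow> 'm vfield \<Rightarrow> 'm vfield" where
  "fendo \<phi> X = (\<lambda>p. \<phi> p (X p))"

lemma field_eqs:
  "X + Y = (\<lambda>p. lincomb 1 (X p) 1 (Y p))" "- X = (\<lambda>p. lincomb (-1) (X p) 0 (X p))"
  "fsmult f X = (\<lambda>p. lincomb (f p) (X p) 0 (X p))"
  by (simp_all add: fun_eq_iff lincomb_def fsmult_def)

locale riemannian_mfd = smooth_mfd A
  for A :: "('m::{t2_space, second_countable_topology}, 'e::euclidean_space) chart set" +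
  fixes g :: "'m tensor02"
  assumes riem: "riemannian_metric A g"
begin

lemma metricD:
  "u \<in> tangent_space A p \<Longrightarrow> v \<in> tangent_space A p \<Longrightarrow> g p u v = g p v u"
  "u \<in> tangent_space A p \<Longrightarrow> v \<in> tangent_space A p \<Longrightarrow> w \<in> tangent_space A p \<Longrightarrow>
    g p (lincomb a u b v) w = a * g p u w + b * g p v w"
  "u \<in> tangent_space A p \<Longrightarrow> u \<noteq> (\<lambda>f. 0) \<Longrightarrow> 0 < g p u u"
  "X \<in> vector_fields A \<Longrightarrow> Y \<in> vector_fields A \<Longrightarrow> (\<lambda>p. g p (X p) (Y p)) \<in> smooth_funs A"
  using riem unfolding riemannian_metric_def by blast+

lemma metric_lincomb2:
  "u \<in> tangent_space A p \<Longrightarrow> v \<in> tangent_space A p \<Longrightarrow> w \<in> tangent_space A p \<Longrightarrow>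
    g p w (lincomb a u b v) = a * g p w u + b * g p w v"
  using metricD(2)[of u p v w a b] metricD(1)[of w p] by (simp add: tangent_space_lincomb)

lemma fields_closed:
  "X \<in> vector_fields A \<Longrightarrow> - X \<in> vector_fields A"
  "X \<in> vector_fields A \<Longrightarrow> Y \<in> vector_fields A \<Longrightarrow> X + Y \<in> vector_fields A"
  "f \<in> smooth_funs A \<Longrightarrow> X \<in> vector_fields A \<Longrightarrow> fsmult f X \<in> vector_fields A"
  unfolding field_eqs
  by (rule vector_fields_lincomb; (assumption | rule smooth_funs_const))+

lemma field_apply_nonsmooth: "X \<in> vector_fields A \<Longrightarrow> f \<notin> smooth_funs A \<Longrightarrow> X p f = 0"
  using tangent_nonsmooth[OF vector_fieldsD(1)] .

text \<open>Linearity and the Leibniz rule are at hand only on smooth functions; on the others all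
  fields are 0 by convention.\<close>

lemma field_eqI:
  assumes "X \<in> vector_fields A" "Y \<in> vector_fields A"
    "\<And>p f. f \<in> smooth_funs A \<Longrightarrow> X p f = Y p f"
  shows "X = Y"
proof (intro ext)
  show "X p f = Y p f" for p f
    using assms(3)[of f p] field_apply_nonsmooth[OF assms(1), of f p] field_apply_nonsmooth[OF assms(2), of f p]
    by (cases "f \<in> smooth_funs A") simp_all
qed

sublocale metric_lie "smooth_funs A" "vector_fields A" fsmult fderiv lie_bracket "fmetric g"
proof
  note T = vector_fieldsD(1) and S = vector_fieldsD(2)
  show "0 \<in> smooth_funs A" "1 \<in> smooth_funs A" by (simp_all add: zero_fun_def one_fun_def)
  show "- f \<in> smooth_funs A" if "f \<in> smooth_funs A" for f
    using smooth_funs_diff[OF smooth_funs_const[of 0] that] by (simp add: fun_Compl_def)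
  show "f + h \<in> smooth_funs A" "f * h \<in> smooth_funs A" if "f \<in> smooth_funs A" "h \<in> smooth_funs A" for f h
    using smooth_funs_add[OF that] smooth_funs_mult[OF that] by (simp_all add: plus_fun_def times_fun_def)
  fix X Y Z assume X: "X \<in> vector_fields A"
  show "- X \<in> vector_fields A" by (rule fields_closed(1)[OF X])
  show "fsmult f X \<in> vector_fields A" if "f \<in> smooth_funs A" for f by (rule fields_closed(3)[OF that X])
  show "fderiv X f \<in> smooth_funs A" if "f \<in> smooth_funs A" for f
    unfolding fderiv_def by (rule S[OF X that])
  show "fderiv X (f + h) = fderiv X f + fderiv X h" "fderiv X (f * h) = f * fderiv X h + h * fderiv X f"
    if "f \<in> smooth_funs A" "h \<in> smooth_funs A" for f h
    using tangent_add(1)[OF T[OF X] that] tangent_leibniz[OF T[OF X] that]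
    by (simp_all add: fun_eq_iff fderiv_def plus_fun_def times_fun_def)
  show "lie_bracket X X = 0" by (simp add: fun_eq_iff lie_bracket_def)
  show "X = 0" if "\<And>Y. Y \<in> vector_fields A \<Longrightarrow> fmetric g X Y = 0"
  proof -
    have "g p (X p) (X p) = 0" for p
      using fun_cong[OF that[OF X], of p] by (simp add: fmetric_def)
    then have "X p = (\<lambda>f. 0)" for p using metricD(3)[OF T[OF X], of p] by (metis less_irrefl)
    then show ?thesis by (simp add: fun_eq_iff)
  qed
  assume Y: "Y \<in> vector_fields A"
  show "X + Y \<in> vector_fields A" by (rule fields_closed(2)[OF X Y])
  show "lie_bracket X Y \<in> vector_fields A" by (rule vector_fields_lie_bracket[OF X Y])
  show "fderiv (lie_bracket X Y) f = fderiv X (fderiv Y f) - fderiv Y (fderiv X f)" for f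
    by (simp add: fun_eq_iff fderiv_def lie_bracket_def)
  show "lie_bracket X Y = - lie_bracket Y X" by (simp add: fun_eq_iff lie_bracket_def)
  show "fmetric g X Y \<in> smooth_funs A" unfolding fmetric_def by (rule metricD(4)[OF X Y])
  show "fmetric g X Y = fmetric g Y X" using metricD(1)[OF T[OF X] T[OF Y]] by (simp add: fmetric_def)
  show "lie_bracket X (fsmult f Y) = fsmult (fderiv X f) Y + fsmult f (lie_bracket X Y)"
    if f: "f \<in> smooth_funs A" for f
  proof (rule field_eqI)
    show "lie_bracket X (fsmult f Y) \<in> vector_fields A"
      "fsmult (fderiv X f) Y + fsmult f (lie_bracket X Y) \<in> vector_fields A"
      unfolding fderiv_def
      by (intro vector_fields_lie_bracket fields_closed S[OF X f] X Y f)+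
    fix p h assume h: "h \<in> smooth_funs A"
    show "lie_bracket X (fsmult f Y) p h = (fsmult (fderiv X f) Y + fsmult f (lie_bracket X Y)) p h"
      using tangent_leibniz[OF T[OF X] f S[OF Y h], of p]
      by (simp add: lie_bracket_def fsmult_def fderiv_def algebra_simps)
  qed
  show "fmetric g (fsmult f X) Y = f * fmetric g X Y" if "f \<in> smooth_funs A" for f
    unfolding field_eqs by (simp add: fun_eq_iff fmetric_def metricD(2)[OF T[OF X] T[OF X] T[OF Y]])
  assume Z: "Z \<in> vector_fields A"
  show "lie_bracket X (Y + Z) = lie_bracket X Y + lie_bracket X Z"
  proof (rule field_eqI)
    show "lie_bracket X (Y + Z) \<in> vector_fields A" "lie_bracket X Y + lie_bracket X Z \<in> vector_fields A"
      by (intro vector_fields_lie_bracket fields_closed X Y Z)+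
    fix p h assume h: "h \<in> smooth_funs A"
    show "lie_bracket X (Y + Z) p h = (lie_bracket X Y + lie_bracket X Z) p h"
      using tangent_add(1)[OF T[OF X] S[OF Y h] S[OF Z h], of p]
      by (simp add: lie_bracket_def)
  qed
  show "lie_bracket X (lie_bracket Y Z) = lie_bracket (lie_bracket X Y) Z + lie_bracket Y (lie_bracket X Z)"
  proof (rule field_eqI)
    show "lie_bracket X (lie_bracket Y Z) \<in> vector_fields A"
      "lie_bracket (lie_bracket X Y) Z + lie_bracket Y (lie_bracket X Z) \<in> vector_fields A"
      by (intro vector_fields_lie_bracket fields_closed X Y Z)+
    fix p h assume h: "h \<in> smooth_funs A"
    note s = S[OF X h] S[OF Y h] S[OF Z h]
    note s2 = s(1)[THEN S[OF Y]] s(1)[THEN S[OF Z]] s(2)[THEN S[OF X]] s(2)[THEN S[OF Z]]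
      s(3)[THEN S[OF X]] s(3)[THEN S[OF Y]]
    show "lie_bracket X (lie_bracket Y Z) p h =
        (lie_bracket (lie_bracket X Y) Z + lie_bracket Y (lie_bracket X Z)) p h"
      by (simp add: lie_bracket_def tangent_add(2)[OF T[OF X]] tangent_add(2)[OF T[OF Y]]
        tangent_add(2)[OF T[OF Z]] s2)
  qed
  show "fmetric g (X + Y) Z = fmetric g X Z + fmetric g Y Z"
    unfolding field_eqs by (simp add: fun_eq_iff fmetric_def metricD(2)[OF T[OF X] T[OF Y] T[OF Z]])
next
  obtain p :: 'm where True by simp
  obtain ev :: "'m tvec \<Rightarrow> 'e" where "\<And>e. \<exists>X\<in>vector_fields A. ev (X p) = e"
    using tangent_coordinates[of p] by metis
  then show "vector_fields A \<noteq> {}" by auto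
qed

lemma dd_eq:
  assumes "\<And>X. X \<in> vector_fields A \<Longrightarrow> fmetric g \<zeta> X = (\<lambda>q. \<eta> q (X q))"
    and "X \<in> vector_fields A" "Y \<in> vector_fields A"
  shows "dd \<zeta> X Y p = 2 * d1 \<eta> X Y p"
  using assms vector_fields_lie_bracket[OF assms(2,3)]
  by (simp add: dd_def d1_def fderiv_def)

text \<open>Computing \<phi>^3 in two ways gives \<eta>(\<phi> u) \<xi> = \<eta>(u) \<phi> \<xi>.
  Applying \<eta> with u = \<phi> \<xi>, where \<phi> \<phi> \<xi> = 0, shows that \<eta>(\<phi>
  \<xi>) has square 0. Then u = \<xi> gives \<phi> \<xi> = 0, and compatibility at \<xi> makes
  \<eta> dual to \<xi>.\<close>

lemma almost_contactD:
  assumes ac: "almost_contact A \<phi> \<xi> \<eta>" and cm: "compatible_metric A \<phi> \<eta> g"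
    and u: "u \<in> tangent_space A p"
  shows "\<phi> p (\<xi> p) = (\<lambda>f. 0)" "\<eta> p (\<phi> p u) = 0" "g p (\<xi> p) u = \<eta> p u"
proof -
  have \<phi>: "u \<in> tangent_space A p \<Longrightarrow> \<phi> p u \<in> tangent_space A p"
    "u \<in> tangent_space A p \<Longrightarrow> v \<in> tangent_space A p \<Longrightarrow>
      \<phi> p (lincomb a u b v) = lincomb a (\<phi> p u) b (\<phi> p v)"
    "u \<in> tangent_space A p \<Longrightarrow> \<phi> p (\<phi> p u) = lincomb (-1) u (\<eta> p u) (\<xi> p)" for u v a b
    using ac unfolding almost_contact_def tensors11_def by blast+
  have \<eta>: "u \<in> tangent_space A p \<Longrightarrow> v \<in> tangent_space A p \<Longrightarrow>
      \<eta> p (lincomb a u b v) = a * \<eta> p u + b * \<eta> p v" for u v a b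
    using ac unfolding almost_contact_def one_forms_def by blast
  have \<eta>\<xi>: "\<eta> p (\<xi> p) = 1" using ac unfolding almost_contact_def by blast
  have \<xi>: "\<xi> p \<in> tangent_space A p"
    using ac vector_fieldsD(1) unfolding almost_contact_def by blast
  have eq: "lincomb (-1) (\<phi> p u) (\<eta> p (\<phi> p u)) (\<xi> p) = lincomb (-1) (\<phi> p u) (\<eta> p u) (\<phi> p (\<xi> p))"
    if "u \<in> tangent_space A p" for u
    using \<phi>(3)[OF \<phi>(1)[OF that]] \<phi>(2)[OF that \<xi>] \<phi>(3)[OF that] by simp
  then have eq': "\<eta> p (\<phi> p u) * \<xi> p f = \<eta> p u * \<phi> p (\<xi> p) f" if "u \<in> tangent_space A p" for u f
    using fun_cong[OF eq[OF that], of f] by (simp add: lincomb_def)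
  have \<eta>': "\<eta> p (\<phi> p u) = \<eta> p u * \<eta> p (\<phi> p (\<xi> p))" if "u \<in> tangent_space A p" for u
  proof -
    have "lincomb (\<eta> p (\<phi> p u)) (\<xi> p) 0 (\<xi> p) = lincomb (\<eta> p u) (\<phi> p (\<xi> p)) 0 (\<xi> p)"
      using eq'[OF that] by (simp add: fun_eq_iff lincomb_def)
    then have "\<eta> p (lincomb (\<eta> p (\<phi> p u)) (\<xi> p) 0 (\<xi> p)) = \<eta> p (lincomb (\<eta> p u) (\<phi> p (\<xi> p)) 0 (\<xi> p))"
      by simp
    then show ?thesis by (simp add: \<eta> \<phi>(1) \<xi> \<eta>\<xi>)
  qed
  have "\<phi> p (\<phi> p (\<xi> p)) = (\<lambda>f. 0)"
    using \<phi>(3)[OF \<xi>] by (simp add: \<eta>\<xi> lincomb_def)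
  then have "\<eta> p (\<phi> p (\<phi> p (\<xi> p))) = 0"
    using \<eta>[OF \<xi> \<xi>, of 0 0] by (simp add: lincomb_def)
  then have 0: "\<eta> p (\<phi> p (\<xi> p)) = 0" using \<eta>'[OF \<phi>(1)[OF \<xi>]] by simp
  then show 1: "\<phi> p (\<xi> p) = (\<lambda>f. 0)" using eq'[OF \<xi>] by (auto simp: \<eta>\<xi>)
  show 2: "\<eta> p (\<phi> p u) = 0" using \<eta>'[OF u] 0 by simp
  have "g p (\<phi> p (\<xi> p)) (\<phi> p u) = g p (\<xi> p) u - \<eta> p (\<xi> p) * \<eta> p u"
    using cm \<xi> u unfolding compatible_metric_def by blast
  moreover have "g p (lincomb 0 (\<xi> p) 0 (\<xi> p)) (\<phi> p u) = 0"
    using metricD(2)[OF \<xi> \<xi> \<phi>(1)[OF u], of 0 0] by simp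
  ultimately show "g p (\<xi> p) u = \<eta> p u" by (simp add: 1 \<eta>\<xi> lincomb_def)
qed

lemma quasi_sasakiI:
  assumes ac: "almost_contact A \<phi> \<xi> \<eta>" and cm: "compatible_metric A \<phi> \<eta> g"
    and norm: "normal_structure A \<phi> \<xi> \<eta>" and cl: "closed2 A (fundamental_form \<phi> g)"
  shows "quasi_sasaki (smooth_funs A) (vector_fields A) fsmult fderiv lie_bracket (fmetric g) (fendo \<phi>) \<xi>"
    and "X \<in> vector_fields A \<Longrightarrow> fmetric g \<xi> X = (\<lambda>q. \<eta> q (X q))"
proof -
  note T = vector_fieldsD(1)
  have \<phi>: "X \<in> vector_fields A \<Longrightarrow> (\<lambda>p. \<phi> p (X p)) \<in> vector_fields A"
    "u \<in> tangent_space A p \<Longrightarrow> v \<in> tangent_space A p \<Longrightarrow>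
      \<phi> p (lincomb a u b v) = lincomb a (\<phi> p u) b (\<phi> p v)"
    "u \<in> tangent_space A p \<Longrightarrow> \<phi> p (\<phi> p u) = lincomb (-1) u (\<eta> p u) (\<xi> p)" for u v a b p X
    using ac unfolding almost_contact_def tensors11_def by blast+
  have \<eta>\<xi>: "\<eta> p (\<xi> p) = 1" for p using ac unfolding almost_contact_def by blast
  have \<xi>: "\<xi> \<in> vector_fields A" using ac unfolding almost_contact_def by blast
  note D = almost_contactD[OF ac cm T]
  show g\<xi>: "fmetric g \<xi> X = (\<lambda>q. \<eta> q (X q))" if "X \<in> vector_fields A" for X
    using D(3)[OF that] by (simp add: fmetric_def)
  show "quasi_sasaki (smooth_funs A) (vector_fields A) fsmult fderiv lie_bracket (fmetric g) (fendo \<phi>) \<xi>"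
  proof
    show "\<xi> \<in> vector_fields A" by (rule \<xi>)
    show "fmetric g \<xi> \<xi> = 1" using \<eta>\<xi> by (simp add: g\<xi>[OF \<xi>] fun_eq_iff)
    show "fendo \<phi> \<xi> = 0" using D(1)[OF \<xi>] by (simp add: fun_eq_iff fendo_def)
    fix X Y Z assume X: "X \<in> vector_fields A"
    show "fendo \<phi> X \<in> vector_fields A" using \<phi>(1)[OF X] by (simp add: fendo_def)
    show "fendo \<phi> (fendo \<phi> X) = - X + fsmult (fmetric g \<xi> X) \<xi>"
      using \<phi>(3)[OF T[OF X]] by (simp add: fun_eq_iff fendo_def g\<xi>[OF X] lincomb_def fsmult_def)
    show "fmetric g \<xi> (fendo \<phi> X) = 0"
      using D(2)[OF X] g\<xi>[OF \<phi>(1)[OF X]] by (simp add: fun_eq_iff fendo_def)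
    assume Y: "Y \<in> vector_fields A"
    show "fendo \<phi> (X + Y) = fendo \<phi> X + fendo \<phi> Y"
      unfolding field_eqs using \<phi>(2)[OF T[OF X] T[OF Y]] by (simp add: fendo_def)
    show "fmetric g (fendo \<phi> X) (fendo \<phi> Y) = fmetric g X Y - fmetric g \<xi> X * fmetric g \<xi> Y"
      unfolding g\<xi>[OF X] g\<xi>[OF Y] using cm T[OF X] T[OF Y] unfolding compatible_metric_def
      by (simp add: fun_eq_iff fmetric_def fendo_def)
    show "fendo \<phi> (fendo \<phi> (lie_bracket X Y)) + lie_bracket (fendo \<phi> X) (fendo \<phi> Y)
        - fendo \<phi> (lie_bracket (fendo \<phi> X) Y) - fendo \<phi> (lie_bracket X (fendo \<phi> Y))
        + fsmult (dd \<xi> X Y) \<xi> = 0"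
    proof (intro ext)
      fix p f
      have "lincomb 1 (nijenhuis \<phi> X Y p) (2 * d1 \<eta> X Y p) (\<xi> p) f = 0"
        using norm X Y unfolding normal_structure_def by simp
      then show "(fendo \<phi> (fendo \<phi> (lie_bracket X Y)) + lie_bracket (fendo \<phi> X) (fendo \<phi> Y)
        - fendo \<phi> (lie_bracket (fendo \<phi> X) Y) - fendo \<phi> (lie_bracket X (fendo \<phi> Y))
        + fsmult (dd \<xi> X Y) \<xi>) p f = 0 p f"
        using dd_eq[OF g\<xi> X Y] by (simp add: lincomb_def nijenhuis_def fsmult_def fendo_def)
    qed
    assume Z: "Z \<in> vector_fields A"
    show "fderiv X (fmetric g Y (fendo \<phi> Z)) + fderiv Y (fmetric g Z (fendo \<phi> X))
        + fderiv Z (fmetric g X (fendo \<phi> Y)) - fmetric g (lie_bracket X Y) (fendo \<phi> Z)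
        - fmetric g (lie_bracket Y Z) (fendo \<phi> X) - fmetric g (lie_bracket Z X) (fendo \<phi> Y) = 0"
    proof (rule ext)
      fix p
      have "d2 (fundamental_form \<phi> g) X Y Z p = 0" using cl X Y Z unfolding closed2_def by blast
      then show "(fderiv X (fmetric g Y (fendo \<phi> Z)) + fderiv Y (fmetric g Z (fendo \<phi> X))
        + fderiv Z (fmetric g X (fendo \<phi> Y)) - fmetric g (lie_bracket X Y) (fendo \<phi> Z)
        - fmetric g (lie_bracket Y Z) (fendo \<phi> X) - fmetric g (lie_bracket Z X) (fendo \<phi> Y)) p = 0 p"
        by (simp add: d2_def fundamental_form_def fderiv_def fmetric_def fendo_def)
    qed
  qed
qed

end

subsection \<open>The rank of the one-forms\<close>

lemma wedge_power_eq_alt_power: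
  assumes \<omega>: "\<And>X. (\<And>i. X i \<in> V) \<Longrightarrow> \<omega> X p = w (ev (X 0)) (ev (X 1))" and X: "\<And>i. X i \<in> V"
  shows "wedge_power \<omega> n X p = alt_power w n (\<lambda>i. ev (X i))"
  using X by (induction n arbitrary: X) (simp_all add: wedge_def \<omega>)

context smooth_mfd
begin

lemma wedge_power_smooth:
  assumes \<omega>: "\<And>X. (\<And>i. X i \<in> vector_fields A) \<Longrightarrow> \<omega> X \<in> smooth_funs A"
    and X: "\<And>i. X i \<in> vector_fields A"
  shows "wedge_power \<omega> n X \<in> smooth_funs A"
  using X
proof (induction n arbitrary: X)
  case (Suc n)
  show ?case
    unfolding wedge_power.simps wedge_def
    by (intro smooth_funs_mult smooth_funs_const smooth_funs_sum \<omega> Suc.IH Suc.prems)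
qed simp

text \<open>The set is a union of sets where a continuous function is nonzero. This is where the
  semicontinuity of the ranks comes from.\<close>

lemma open_wedge_power_nonzero:
  assumes \<omega>: "\<And>X. (\<And>i. X i \<in> vector_fields A) \<Longrightarrow> \<omega> X \<in> smooth_funs A"
  shows "open {x. \<not> form_zero_at A (wedge_power \<omega> n) x}"
proof -
  have "{x. \<not> form_zero_at A (wedge_power \<omega> n) x} =
      (\<Union>X\<in>{X. \<forall>i. X i \<in> vector_fields A}. {x. wedge_power \<omega> n X x \<noteq> 0})"
    by (auto simp: form_zero_at_def)
  moreover have "open {x. wedge_power \<omega> n X x \<noteq> 0}" if "\<forall>i. X i \<in> vector_fields A" for X
    using wedge_power_smooth[OF \<omega>, where X = X and n = n] that
    by (intro open_Collect_neq smooth_funs_continuous) auto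
  ultimately show ?thesis by auto
qed

end

context riemannian_mfd
begin

text \<open>Each coordinate vector is realised by some field. Injectivity of the coordinates makes
  the value of that field at \<open>p\<close> independent of the choice, so the metric transports to
  a bilinear \<open>G\<close>.\<close>

lemma tangent_evaluation:
  obtains ev :: "'m vfield \<Rightarrow> 'e" and G
  where "point_evaluation (smooth_funs A) (vector_fields A) fsmult fderiv lie_bracket (fmetric g)
    ev (\<lambda>f. f p) G"
proof -
  note T = vector_fieldsD(1)
  obtain ev :: "'m tvec \<Rightarrow> 'e" where
    lin: "\<And>u v a b. u \<in> tangent_space A p \<Longrightarrow> v \<in> tangent_space A p \<Longrightarrow>
      ev (lincomb a u b v) = a *\<^sub>R ev u + b *\<^sub>R ev v" and
    inj: "\<And>v. v \<in> tangent_space A p \<Longrightarrow> ev v = 0 \<Longrightarrow> v = (\<lambda>f. 0)" and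
    surj: "\<And>e. \<exists>X\<in>vector_fields A. ev (X p) = e"
    by (rule tangent_coordinates[of p]) blast
  obtain S where S: "\<And>e. S e \<in> vector_fields A" "\<And>e. ev (S e p) = e" using surj by metis
  have SX: "S (ev (X p)) p = X p" if X: "X \<in> vector_fields A" for X
  proof -
    let ?d = "lincomb 1 (S (ev (X p)) p) (- 1) (X p)"
    have "ev ?d = 0" using S(2) by (simp add: lin T[OF S(1)] T[OF X])
    then have "?d = (\<lambda>f. 0)" using inj tangent_space_lincomb T[OF S(1)] T[OF X] by metis
    then show ?thesis by (simp add: fun_eq_iff lincomb_def)
  qed
  define G where "G u v = g p (S u p) (S v p)" for u v
  have G_ev: "G (ev (X p)) (ev (Y p)) = fmetric g X Y p"
    if "X \<in> vector_fields A" "Y \<in> vector_fields A" for X Y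
    by (simp add: G_def SX that fmetric_def)
  have S_lin: "S (a *\<^sub>R u + b *\<^sub>R v) p = lincomb a (S u p) b (S v p)" for a b u v
  proof -
    have "(\<lambda>q. lincomb a (S u q) b (S v q)) \<in> vector_fields A"
      by (rule vector_fields_lincomb[OF S(1) S(1) smooth_funs_const smooth_funs_const])
    from SX[OF this] show ?thesis by (simp add: lin T[OF S(1)] S(2))
  qed
  have "point_evaluation (smooth_funs A) (vector_fields A) fsmult fderiv lie_bracket (fmetric g)
      (\<lambda>X. ev (X p)) (\<lambda>f. f p) G"
  proof
    show "\<exists>X\<in>vector_fields A. ev (X p) = u" for u by (rule surj)
    show "ev ((X + Y) p) = ev (X p) + ev (Y p)" if "X \<in> vector_fields A" "Y \<in> vector_fields A" for X Y
      using that unfolding field_eqs by (simp add: lin T)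
    show "ev (fsmult f X p) = f p *\<^sub>R ev (X p)" if "X \<in> vector_fields A" for f X
      using that unfolding field_eqs by (simp add: lin T)
    show "bilinear G"
      unfolding bilinear_def linear_iff G_def
      using S_lin[of 1 _ 1] S_lin[of _ _ 0 0]
      by (simp add: metricD(2)[OF T[OF S(1)] T[OF S(1)] T[OF S(1)]]
        metric_lincomb2[OF T[OF S(1)] T[OF S(1)] T[OF S(1)]])
    show "G u v = G v u" for u v unfolding G_def by (rule metricD(1)[OF T[OF S(1)] T[OF S(1)]])
    show "0 < G u u" if "u \<noteq> 0" for u
      unfolding G_def
    proof (rule metricD(3)[OF T[OF S(1)]], rule notI)
      assume "S u p = (\<lambda>f. 0)"
      then have "ev (lincomb 0 (S u p) 0 (S u p)) = u" using S(2)[of u] by (simp add: lincomb_def)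
      then show False using that by (simp add: lin T[OF S(1)])
    qed
  qed (simp_all add: G_ev)
  then show ?thesis using that by blast
qed

end

section \<open>The manifold as an instance of the algebra, and its ranks point by point\<close>

locale three_quasi_sasakian_mfd = riemannian_mfd A g
  for A :: "('m::{t2_space, second_countable_topology}, 'e::euclidean_space) chart set" and g +
  fixes \<phi> :: "nat \<Rightarrow> 'm tensor11" and \<xi> :: "nat \<Rightarrow> 'm vfield" and \<eta> :: "nat \<Rightarrow> 'm oneform" and c :: real
  assumes tqs: "three_quasi_sasakian A \<phi> \<xi> \<eta> g"
    and bracket: "\<And>\<alpha> \<beta> \<gamma>. (\<alpha>, \<beta>, \<gamma>) \<in> even_perms3 \<Longrightarrow>
           lie_bracket (\<xi> \<alpha>) (\<xi> \<beta>) = (\<lambda>p f. c * \<xi> \<gamma> p f)"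
begin

lemma structures:
  assumes "\<alpha> \<in> {1, 2, 3}"
  shows "almost_contact A (\<phi> \<alpha>) (\<xi> \<alpha>) (\<eta> \<alpha>)" "compatible_metric A (\<phi> \<alpha>) (\<eta> \<alpha>) g"
    "normal_structure A (\<phi> \<alpha>) (\<xi> \<alpha>) (\<eta> \<alpha>)" "closed2 A (fundamental_form (\<phi> \<alpha>) g)"
  using tqs assms unfolding three_quasi_sasakian_def almost_3_contact_metric_def hyper_normal_def
  by blast+

lemma quasi: "\<alpha> \<in> {1, 2, 3} \<Longrightarrow> quasi_sasaki (smooth_funs A) (vector_fields A) fsmult fderiv lie_bracket
    (fmetric g) (fendo (\<phi> \<alpha>)) (\<xi> \<alpha>)"
  and g_xi: "\<alpha> \<in> {1, 2, 3} \<Longrightarrow> X \<in> vector_fields A \<Longrightarrow> fmetric g (\<xi> \<alpha>) X = (\<lambda>q. \<eta> \<alpha> q (X q))"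
  using quasi_sasakiI[OF structures] by blast+

lemma xi_field: "\<alpha> \<in> {1, 2, 3} \<Longrightarrow> \<xi> \<alpha> \<in> vector_fields A"
  using structures(1)[of \<alpha>] unfolding almost_contact_def by blast

lemma phi_field: "\<alpha> \<in> {1, 2, 3} \<Longrightarrow> X \<in> vector_fields A \<Longrightarrow> fendo (\<phi> \<alpha>) X \<in> vector_fields A"
  using structures(1)[of \<alpha>] unfolding almost_contact_def tensors11_def fendo_def by blast

lemma perms:
  assumes "(\<alpha>, \<beta>, \<gamma>) \<in> even_perms3"
  shows "\<alpha> \<in> {1, 2, 3}" "\<beta> \<in> {1, 2, 3}" "\<gamma> \<in> {1, 2, 3}"
    "(\<beta>, \<gamma>, \<alpha>) \<in> even_perms3" "(\<gamma>, \<alpha>, \<beta>) \<in> even_perms3"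
  using assms by (auto simp: even_perms3_def)

lemma three_rel:
  assumes "(\<alpha>, \<beta>, \<gamma>) \<in> even_perms3"
  shows "u \<in> tangent_space A p \<Longrightarrow> \<phi> \<gamma> p u = lincomb 1 (\<phi> \<alpha> p (\<phi> \<beta> p u)) (- \<eta> \<beta> p u) (\<xi> \<alpha> p)"
    "u \<in> tangent_space A p \<Longrightarrow> \<phi> \<gamma> p u = lincomb (-1) (\<phi> \<beta> p (\<phi> \<alpha> p u)) (\<eta> \<alpha> p u) (\<xi> \<beta> p)"
    "u \<in> tangent_space A p \<Longrightarrow> \<eta> \<gamma> p u = \<eta> \<alpha> p (\<phi> \<beta> p u)"
    "u \<in> tangent_space A p \<Longrightarrow> \<eta> \<gamma> p u = - \<eta> \<beta> p (\<phi> \<alpha> p u)"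
    "\<xi> \<gamma> p = \<phi> \<alpha> p (\<xi> \<beta> p)" "\<xi> \<gamma> p = (\<lambda>f. - \<phi> \<beta> p (\<xi> \<alpha> p) f)"
proof -
  note r = tqs[unfolded three_quasi_sasakian_def almost_3_contact_metric_def, THEN conjunct1,
    THEN conjunct2, THEN conjunct2, THEN conjunct2, THEN conjunct2, THEN bspec, OF assms, unfolded prod.case]
  show "u \<in> tangent_space A p \<Longrightarrow> \<phi> \<gamma> p u = lincomb 1 (\<phi> \<alpha> p (\<phi> \<beta> p u)) (- \<eta> \<beta> p u) (\<xi> \<alpha> p)"
    "u \<in> tangent_space A p \<Longrightarrow> \<phi> \<gamma> p u = lincomb (-1) (\<phi> \<beta> p (\<phi> \<alpha> p u)) (\<eta> \<alpha> p u) (\<xi> \<beta> p)"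
    "u \<in> tangent_space A p \<Longrightarrow> \<eta> \<gamma> p u = \<eta> \<alpha> p (\<phi> \<beta> p u)"
    "u \<in> tangent_space A p \<Longrightarrow> \<eta> \<gamma> p u = - \<eta> \<beta> p (\<phi> \<alpha> p u)"
    "\<xi> \<gamma> p = \<phi> \<alpha> p (\<xi> \<beta> p)" "\<xi> \<gamma> p = (\<lambda>f. - \<phi> \<beta> p (\<xi> \<alpha> p) f)"
    using r by blast+
qed

lemma quaternion_rel_phi:
  assumes P: "(\<alpha>, \<beta>, \<gamma>) \<in> even_perms3"
  shows "quaternion_rel (fendo (\<phi> \<alpha>)) (\<xi> \<alpha>) (fendo (\<phi> \<beta>)) (\<xi> \<beta>) (fendo (\<phi> \<gamma>)) (\<xi> \<gamma>) (\<lambda>p. c)"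
  unfolding quaternion_rel_def
proof (intro conjI ballI)
  note T = vector_fieldsD(1) and I = perms[OF P]
  note R = three_rel[OF P] and R'' = three_rel[OF I(5)]
  fix X assume X: "X \<in> vector_fields A"
  show "fendo (\<phi> \<gamma>) X = fendo (\<phi> \<alpha>) (fendo (\<phi> \<beta>) X) - fsmult (fmetric g (\<xi> \<beta>) X) (\<xi> \<alpha>)"
    using R(1)[OF T[OF X]] by (simp add: fun_eq_iff g_xi[OF I(2) X] fendo_def fsmult_def lincomb_def)
  show "fendo (\<phi> \<gamma>) X = - fendo (\<phi> \<beta>) (fendo (\<phi> \<alpha>) X) + fsmult (fmetric g (\<xi> \<alpha>) X) (\<xi> \<beta>)"
    using R(2)[OF T[OF X]] by (simp add: fun_eq_iff g_xi[OF I(1) X] fendo_def fsmult_def lincomb_def)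
  show "fmetric g (\<xi> \<gamma>) X = fmetric g (\<xi> \<alpha>) (fendo (\<phi> \<beta>) X)"
    using R(3)[OF T[OF X]] g_xi[OF I(1) phi_field[OF I(2) X]]
    by (simp add: fun_eq_iff g_xi[OF I(3) X] fendo_def)
  show "fmetric g (\<xi> \<gamma>) X = - fmetric g (\<xi> \<beta>) (fendo (\<phi> \<alpha>) X)"
    using R(4)[OF T[OF X]] g_xi[OF I(2) phi_field[OF I(1) X]]
    by (simp add: fun_eq_iff g_xi[OF I(3) X] fendo_def)
next
  note T = vector_fieldsD(1) and I = perms[OF P]
  note R = three_rel[OF P] and R'' = three_rel[OF I(5)]
  show "\<xi> \<gamma> = fendo (\<phi> \<alpha>) (\<xi> \<beta>)" by (rule ext) (simp add: fendo_def R(5))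
  show "\<xi> \<gamma> = - fendo (\<phi> \<beta>) (\<xi> \<alpha>)" by (rule ext) (simp add: fendo_def R(6) fun_eq_iff)
  have "\<eta> \<alpha> p (\<xi> \<beta> p) = 0" for p
  proof -
    have "\<eta> \<beta> p (\<xi> \<alpha> p) = - \<eta> \<alpha> p (\<xi> \<beta> p)"
      using R''(4)[OF T[OF xi_field[OF I(1)]], of p] R''(5)[of p] by simp
    moreover have "\<eta> \<beta> p (\<xi> \<alpha> p) = \<eta> \<alpha> p (\<xi> \<beta> p)"
      using g_sym[OF xi_field[OF I(1)] xi_field[OF I(2)]]
      by (simp add: g_xi[OF I(1) xi_field[OF I(2)]] g_xi[OF I(2) xi_field[OF I(1)]] fun_eq_iff)
    ultimately show ?thesis by simp
  qed
  then show "fmetric g (\<xi> \<alpha>) (\<xi> \<beta>) = 0"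
    by (simp add: g_xi[OF I(1) xi_field[OF I(2)]] fun_eq_iff)
  show "lie_bracket (\<xi> \<alpha>) (\<xi> \<beta>) = fsmult (\<lambda>p. c) (\<xi> \<gamma>)"
    using bracket[OF P] by (simp add: fsmult_def)
qed

lemma three_quasi_sasaki_fields:
  assumes P: "(\<alpha>, \<beta>, \<gamma>) \<in> even_perms3"
  shows "three_quasi_sasaki (smooth_funs A) (vector_fields A) fsmult fderiv lie_bracket (fmetric g)
    (fendo (\<phi> \<alpha>)) (\<xi> \<alpha>) (fendo (\<phi> \<beta>)) (\<xi> \<beta>) (fendo (\<phi> \<gamma>)) (\<xi> \<gamma>) (\<lambda>p. c)"
proof -
  note I = perms[OF P]
  interpret a: quasi_sasaki "smooth_funs A" "vector_fields A" fsmult fderiv lie_bracket "fmetric g" "fendo (\<phi> \<alpha>)" "\<xi> \<alpha>"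
    by (rule quasi[OF I(1)])
  interpret b: quasi_sasaki "smooth_funs A" "vector_fields A" fsmult fderiv lie_bracket "fmetric g" "fendo (\<phi> \<beta>)" "\<xi> \<beta>"
    by (rule quasi[OF I(2)])
  interpret c: quasi_sasaki "smooth_funs A" "vector_fields A" fsmult fderiv lie_bracket "fmetric g" "fendo (\<phi> \<gamma>)" "\<xi> \<gamma>"
    by (rule quasi[OF I(3)])
  show ?thesis
  proof
    show "(\<lambda>p. c) \<in> smooth_funs A" by simp
    show "fderiv X (\<lambda>p. c) = 0" if "X \<in> vector_fields A" for X
      using tangent_const[OF vector_fieldsD(1)[OF that]] by (simp add: fun_eq_iff fderiv_def)
  qed (rule quaternion_rel_phi P I)+
qed

abbreviation lft :: "('m vfield \<Rightarrow> 'e) \<Rightarrow> ('m vfield \<Rightarrow> 'm vfield) \<Rightarrow> 'e \<Rightarrow> 'e" where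
  "lft ev T \<equiv> point_evaluation.lift_op (vector_fields A) ev T"

definition psi_form :: "nat \<Rightarrow> 'm form" where
  "psi_form \<gamma> X p = g p (X 0 p) (\<phi> \<gamma> p (X 1 p)) - 2 / c * d1 (\<eta> \<gamma>) (X 0) (X 1) p"

lemma ext_d_smooth:
  assumes \<gamma>: "\<gamma> \<in> {1, 2, 3}" and X: "\<And>i. X i \<in> vector_fields A"
  shows "ext_d (\<eta> \<gamma>) X \<in> smooth_funs A" "psi_form \<gamma> X \<in> smooth_funs A"
proof -
  have "ext_d (\<eta> \<gamma>) X = (\<lambda>p. 1 / 2 * dd (\<xi> \<gamma>) (X 0) (X 1) p)"
    using dd_eq[OF g_xi[OF \<gamma>] X X] by (simp add: ext_d_def fun_eq_iff)
  moreover have "dd (\<xi> \<gamma>) (X 0) (X 1) \<in> smooth_funs A" by (rule dd_closed[OF xi_field[OF \<gamma>] X X])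
  ultimately show 1: "ext_d (\<eta> \<gamma>) X \<in> smooth_funs A"
    using smooth_funs_mult[OF smooth_funs_const[of "1 / 2"]] by (simp only:)
  have "psi_form \<gamma> X = (\<lambda>p. fmetric g (X 0) (fendo (\<phi> \<gamma>) (X 1)) p - 2 / c * ext_d (\<eta> \<gamma>) X p)"
    by (simp add: psi_form_def fun_eq_iff fmetric_def fendo_def ext_d_def)
  then show "psi_form \<gamma> X \<in> smooth_funs A"
    using smooth_funs_diff[OF g_closed[OF X phi_field[OF \<gamma> X]] smooth_funs_mult[OF smooth_funs_const[of "2 / c"] 1]]
    by (simp only:)
qed

text \<open>Nonvanishing is recorded for all smaller exponents too. Hence \<open>k \<le> l\<close>
  iff the power \<open>2 * k + 1\<close> of d\<eta> is nonzero, and \<open>k \<le> m\<close> iff the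
  power \<open>2 * k\<close> of the complementary form is: each superlevel set of \<open>l\<close>
  or \<open>m\<close> is described by a single power.\<close>

definition rank_data :: "nat \<Rightarrow> nat \<Rightarrow> nat \<Rightarrow> 'm \<Rightarrow> bool" where
  "rank_data \<gamma> l m p \<longleftrightarrow>
    (\<forall>n\<le>l. \<not> form_zero_at A (wedge_power (ext_d (\<eta> \<gamma>)) (2 * n + 1)) p) \<and>
    (\<forall>n>2 * l + 1. form_zero_at A (wedge_power (ext_d (\<eta> \<gamma>)) n) p) \<and>
    \<not> form_zero_at A (wedge 1 (2 * (2 * l + 1)) (form_of_oneform (\<eta> \<gamma>))
        (wedge_power (ext_d (\<eta> \<gamma>)) (2 * l + 1))) p \<and>
    (\<forall>n\<le>m. \<not> form_zero_at A (wedge_power (psi_form \<gamma>) (2 * n)) p) \<and>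
    (\<forall>n>2 * m. form_zero_at A (wedge_power (psi_form \<gamma>) n) p)"

end

lemma form_zero_at_wedge_power_iff:
  assumes surj: "\<And>u. \<exists>X\<in>vector_fields A. ev X = u"
    and \<omega>: "\<And>X. (\<And>i. X i \<in> vector_fields A) \<Longrightarrow> \<omega> X p = w (ev (X 0)) (ev (X 1))"
  shows "form_zero_at A (wedge_power \<omega> n) p \<longleftrightarrow> (\<forall>u. alt_power w n u = 0)"
proof -
  obtain S where S: "\<And>u. S u \<in> vector_fields A" "\<And>u. ev (S u) = u" using surj by metis
  have eq: "wedge_power \<omega> n X p = alt_power w n (\<lambda>i. ev (X i))" if "\<And>i. X i \<in> vector_fields A" for X
    by (rule wedge_power_eq_alt_power[where V = "vector_fields A"]) (rule \<omega> that, assumption?)+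
  show ?thesis
  proof
    assume z: "form_zero_at A (wedge_power \<omega> n) p"
    show "\<forall>u. alt_power w n u = 0"
    proof
      fix u
      have "wedge_power \<omega> n (\<lambda>i. S (u i)) p = 0" using z S(1) by (simp add: form_zero_at_def)
      then show "alt_power w n u = 0" using eq[of "\<lambda>i. S (u i)"] S by simp
    qed
  qed (use eq in \<open>simp add: form_zero_at_def\<close>)
qed

text \<open>A vector \<open>x\<close> outside the kernel of \<open>h\<close> is put in front of the
  symplectic sequence, which lies inside the kernel, and all these vectors are extended to global
  fields.\<close>

lemma wedge_oneform_nonzero:
  assumes surj: "\<And>u. \<exists>X\<in>vector_fields A. ev X = u"
    and \<omega>: "\<And>X. (\<And>i. X i \<in> vector_fields A) \<Longrightarrow> \<omega> X p = w (ev (X 0)) (ev (X 1))"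
    and \<eta>: "\<And>X. X \<in> vector_fields A \<Longrightarrow> \<eta> p (X p) = h (ev X)"
    and e: "symplectic_seq w s n e" "s \<noteq> 0" "\<And>i. i < 2 * n \<Longrightarrow> h (e i) = 0" "h x \<noteq> 0"
  shows "\<not> form_zero_at A (wedge 1 (2 * n) (form_of_oneform \<eta>) (wedge_power \<omega> n)) p"
proof -
  obtain S where S: "\<And>u. S u \<in> vector_fields A" "\<And>u. ev (S u) = u" using surj by metis
  have eq: "wedge_power \<omega> n X p = alt_power w n (\<lambda>i. ev (X i))" if "\<And>i. X i \<in> vector_fields A" for X
    by (rule wedge_power_eq_alt_power[where V = "vector_fields A"]) (rule \<omega> that, assumption?)+
  define e' where "e' i = (case i of 0 \<Rightarrow> x | Suc j \<Rightarrow> e j)" for i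
  have "(\<Sum>\<sigma> | \<sigma> permutes {..<1 + 2 * n}.
      of_int (sign \<sigma>) * h (e' (\<sigma> 0)) * alt_power w n (\<lambda>i. e' (\<sigma> (1 + i)))) \<noteq> 0"
    using e by (intro wedge_alt_power_nonzero[where s = s]) (auto simp: e'_def split: nat.splits)
  then have "wedge 1 (2 * n) (form_of_oneform \<eta>) (wedge_power \<omega> n) (\<lambda>i. S (e' i)) p \<noteq> 0"
    by (simp add: wedge_def form_of_oneform_def \<eta> eq S)
  then show ?thesis using S(1) unfolding form_zero_at_def
    by (intro notI) (drule spec[of _ "\<lambda>i. S (e' i)"], simp)
qed

context three_quasi_sasakian_mfd
begin

lemma rank_data_at_point:
  assumes P: "(\<alpha>, \<beta>, \<gamma>) \<in> even_perms3" and c: "c \<noteq> 0"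
    and pe: "point_evaluation (smooth_funs A) (vector_fields A) fsmult fderiv lie_bracket (fmetric g)
      ev (\<lambda>f. f p) G"
    and ad: "contact3.adapted G c
      (lft ev (fendo (\<phi> \<alpha>))) (ev (\<xi> \<alpha>)) (lft ev (lie_op (fendo (\<phi> \<gamma>)) (\<xi> \<beta>)))
      (lft ev (fendo (\<phi> \<beta>))) (ev (\<xi> \<beta>)) (lft ev (lie_op (fendo (\<phi> \<alpha>)) (\<xi> \<gamma>)))
      (lft ev (fendo (\<phi> \<gamma>))) (ev (\<xi> \<gamma>)) (lft ev (lie_op (fendo (\<phi> \<beta>)) (\<xi> \<alpha>))) U U'"
  shows "rank_data \<gamma> (card U) (card U') p"
proof -
  note I = perms[OF P]
  interpret t: three_quasi_sasaki_point "smooth_funs A" "vector_fields A" fsmult fderiv lie_bracket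
    "fmetric g" "fendo (\<phi> \<alpha>)" "\<xi> \<alpha>" "fendo (\<phi> \<beta>)" "\<xi> \<beta>" "fendo (\<phi> \<gamma>)" "\<xi> \<gamma>" "\<lambda>p. c" ev "\<lambda>f. f p" G
    using three_quasi_sasaki_fields[OF P] pe by (rule three_quasi_sasaki_point.intro)
  interpret s: contact3 G c
    "lft ev (fendo (\<phi> \<alpha>))" "ev (\<xi> \<alpha>)" "lft ev (lie_op (fendo (\<phi> \<gamma>)) (\<xi> \<beta>))"
    "lft ev (fendo (\<phi> \<beta>))" "ev (\<xi> \<beta>)" "lft ev (lie_op (fendo (\<phi> \<alpha>)) (\<xi> \<gamma>))"
    "lft ev (fendo (\<phi> \<gamma>))" "ev (\<xi> \<gamma>)" "lft ev (lie_op (fendo (\<phi> \<beta>)) (\<xi> \<alpha>))"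
    by (rule t.contact3)
  have w: "ext_d (\<eta> \<gamma>) X p = s.wc (ev (X 0)) (ev (X 1))" if X: "\<And>i. X i \<in> vector_fields A" for X
    using t.G_lift_lie_op[OF X[of 0] X[of 1]] dd_eq[OF g_xi[OF I(3)] X[of 0] X[of 1], of p]
    by (simp add: ext_d_def s.wc_def)
  have psi: "psi_form \<gamma> X p = s.psi (ev (X 0)) (ev (X 1))" if X: "\<And>i. X i \<in> vector_fields A" for X
    using t.G_lift_lie_op[OF X[of 0] X[of 1]] dd_eq[OF g_xi[OF I(3)] X[of 0] X[of 1], of p]
      t.lift_op(1)[OF t.skew_op_phi(3) X[of 1]] t.G_ev[OF X[of 0] phi_field[OF I(3) X[of 1]]]
    by (simp add: psi_form_def s.psi_def fmetric_def fendo_def)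
  have h: "\<eta> \<gamma> p (X p) = G (ev (\<xi> \<gamma>)) (ev X)" if X: "X \<in> vector_fields A" for X
    using t.G_ev[OF xi_field[OF I(3)] X] g_xi[OF I(3) X] by simp
  have fz: "form_zero_at A (wedge_power (ext_d (\<eta> \<gamma>)) n) p \<longleftrightarrow> (\<forall>u. alt_power s.wc n u = 0)"
    "form_zero_at A (wedge_power (psi_form \<gamma>) n) p \<longleftrightarrow> (\<forall>u. alt_power s.psi n u = 0)" for n
    by (rule form_zero_at_wedge_power_iff[where ev = ev, OF t.ev_surj], rule w psi, assumption)+
  note pos = alt_power_symplectic_pos
  show ?thesis
    unfolding rank_data_def fz
  proof (intro conjI allI impI)
    show "\<not> (\<forall>u. alt_power s.wc (2 * n + 1) u = 0)" if "n \<le> card U" for n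
      using s.wc_symplectic[OF ad c that] pos[of s.wc "- (c / 2)" "2 * n + 1"] c by fastforce
    show "alt_power s.wc n u = 0" if "2 * card U + 1 < n" for n u by (rule s.wc_vanish[OF ad that])
    show "\<not> (\<forall>u. alt_power s.psi (2 * n) u = 0)" if "n \<le> card U'" for n
      using s.psi_symplectic[OF ad that] pos[of s.psi "- 1" "2 * n"] by fastforce
    show "alt_power s.psi n u = 0" if "2 * card U' < n" for n u by (rule s.psi_vanish[OF ad c that])
    obtain e where e: "symplectic_seq s.wc (- (c / 2)) (2 * card U + 1) e"
        "\<And>i. i < 2 * (2 * card U + 1) \<Longrightarrow> G (ev (\<xi> \<gamma>)) (e i) = 0"
      using s.wc_symplectic[OF ad c order_refl] by blast
    show "\<not> form_zero_at A (wedge 1 (2 * (2 * card U + 1)) (form_of_oneform (\<eta> \<gamma>))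
        (wedge_power (ext_d (\<eta> \<gamma>)) (2 * card U + 1))) p"
    proof (rule wedge_oneform_nonzero[where ev = ev and w = s.wc and h = "G (ev (\<xi> \<gamma>))"
          and x = "ev (\<xi> \<gamma>)" and s = "- (c / 2)" and e = e])
      show "ext_d (\<eta> \<gamma>) X p = s.wc (ev (X 0)) (ev (X 1))" if "\<And>i. X i \<in> vector_fields A" for X
        by (rule w[OF that])
    qed (use c e s.unit t.ev_surj h in simp_all)
  qed
qed

lemma rank_data_ex:
  assumes c: "c \<noteq> 0"
  shows "\<exists>l m. 4 * l + 4 * m + 3 = DIM('e) \<and> (\<forall>\<gamma>\<in>{1, 2, 3}. rank_data \<gamma> l m p)"
proof -
  obtain ev :: "'m vfield \<Rightarrow> 'e" and G where pe: "point_evaluation (smooth_funs A) (vector_fields A)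
      fsmult fderiv lie_bracket (fmetric g) ev (\<lambda>f. f p) G"
    by (rule tangent_evaluation)
  have P: "(1, 2, 3) \<in> even_perms3" "(2, 3, 1) \<in> even_perms3" "(3, 1, 2) \<in> even_perms3"
    by (auto simp: even_perms3_def)
  interpret t: three_quasi_sasaki_point "smooth_funs A" "vector_fields A" fsmult fderiv lie_bracket
    "fmetric g" "fendo (\<phi> 1)" "\<xi> 1" "fendo (\<phi> 2)" "\<xi> 2" "fendo (\<phi> 3)" "\<xi> 3" "\<lambda>p. c" ev "\<lambda>f. f p" G
    using three_quasi_sasaki_fields[OF P(1)] pe by (rule three_quasi_sasaki_point.intro)
  interpret s: contact3 G c
    "lft ev (fendo (\<phi> 1))" "ev (\<xi> 1)" "lft ev (lie_op (fendo (\<phi> 3)) (\<xi> 2))"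
    "lft ev (fendo (\<phi> 2))" "ev (\<xi> 2)" "lft ev (lie_op (fendo (\<phi> 1)) (\<xi> 3))"
    "lft ev (fendo (\<phi> 3))" "ev (\<xi> 3)" "lft ev (lie_op (fendo (\<phi> 2)) (\<xi> 1))"
    by (rule t.contact3)
  obtain U U' where ad: "s.adapted U U'" using s.ex_adapted[OF c] by blast
  \<comment> \<open>The same two systems stay adapted after rotation, so \<open>l\<close> and
    \<open>m\<close> do not depend on the index.\<close>
  note ad' = s.adapted_rotate[THEN iffD2, OF ad]
  note ad'' = contact3.adapted_rotate[OF s.rotate, THEN iffD2, OF ad']
  show ?thesis
    using s.adapted_card[OF ad c] rank_data_at_point[OF P(1) c pe ad]
      rank_data_at_point[OF P(2) c pe ad'] rank_data_at_point[OF P(3) c pe ad'']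
    by (intro exI[of _ "card U"] exI[of _ "card U'"]) simp
qed

lemma ext_d_zero:
  assumes c: "c = 0" and P: "(\<alpha>, \<beta>, \<gamma>) \<in> even_perms3" and X: "X \<in> vector_fields A" "Y \<in> vector_fields A"
  shows "d1 (\<eta> \<gamma>) X Y p = 0"
proof -
  obtain ev :: "'m vfield \<Rightarrow> 'e" and G where pe: "point_evaluation (smooth_funs A) (vector_fields A)
      fsmult fderiv lie_bracket (fmetric g) ev (\<lambda>f. f p) G"
    by (rule tangent_evaluation)
  interpret t: three_quasi_sasaki_point "smooth_funs A" "vector_fields A" fsmult fderiv lie_bracket
    "fmetric g" "fendo (\<phi> \<alpha>)" "\<xi> \<alpha>" "fendo (\<phi> \<beta>)" "\<xi> \<beta>" "fendo (\<phi> \<gamma>)" "\<xi> \<gamma>" "\<lambda>p. c" ev "\<lambda>f. f p" G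
    using three_quasi_sasaki_fields[OF P] pe by (rule three_quasi_sasaki_point.intro)
  have "G (ev X) 0 = 0" using bilinear_rzero[OF t.G(1)] .
  then show ?thesis
    using t.G_lift_lie_op[OF X] contact3.Bc_zero[OF t.contact3, of "ev Y"] c
      dd_eq[OF g_xi[OF perms(3)[OF P]] X, of p] by simp
qed

end

theorem theorem5p5:
  fixes A :: "('m::{t2_space, second_countable_topology}, 'e::euclidean_space) chart set"
    and \<phi> :: "nat \<Rightarrow> 'm tensor11" and \<xi> :: "nat \<Rightarrow> 'm vfield"
    and \<eta> :: "nat \<Rightarrow> 'm oneform" and g :: "'m tensor02"
    and c :: real and n :: nat
  assumes "three_quasi_sasakian A \<phi> \<xi> \<eta> g"
    and "connected (UNIV :: 'm set)"
    and "DIM('e) = 4 * n + 3"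
    and "\<And>\<alpha> \<beta> \<gamma>. (\<alpha>, \<beta>, \<gamma>) \<in> even_perms3 \<Longrightarrow>
           lie_bracket (\<xi> \<alpha>) (\<xi> \<beta>) = (\<lambda>p f. c * \<xi> \<gamma> p f)"
  shows "\<exists>l\<le>n. \<forall>\<alpha>\<in>{1, 2, 3}. has_rank A (\<eta> \<alpha>) (if c \<noteq> 0 then 4 * l + 3 else 4 * l + 1)"
proof -
  interpret three_quasi_sasakian_mfd A g \<phi> \<xi> \<eta> c
    using assms(1,4)
    by unfold_locales (auto simp: three_quasi_sasakian_def almost_3_contact_metric_def)
  show ?thesis
  proof (cases "c = 0")
    case True
    \<comment> \<open>For \<open>c = 0\<close> all d\<eta> vanish, so the rank is 1 and
      \<open>l = 0\<close>; \<eta> is nowhere 0 because its value on \<xi> is 1.\<close>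
    have "has_rank A (\<eta> \<gamma>) (4 * 0 + 1)" if P: "(\<alpha>, \<beta>, \<gamma>) \<in> even_perms3" for \<alpha> \<beta> \<gamma>
    proof -
      note I = perms[OF P]
      have "form_zero_at A (wedge_power (ext_d (\<eta> \<gamma>)) (0 + 1)) x" for x
        unfolding form_zero_at_def
        by (simp add: wedge_def ext_d_def ext_d_zero[OF True P])
      moreover have "\<not> form_zero_at A (wedge 1 (2 * 0) (form_of_oneform (\<eta> \<gamma>)) (wedge_power (ext_d (\<eta> \<gamma>)) 0)) x" for x
      proof -
        have "\<eta> \<gamma> x (\<xi> \<gamma> x) = 1" using structures(1)[OF I(3)] unfolding almost_contact_def by blast
        then show ?thesis
          using xi_field[OF I(3)] unfolding form_zero_at_def
          by (intro notI) (drule spec[of _ "\<lambda>i. \<xi> \<gamma>"], simp add: wedge_def form_of_oneform_def lessThan_Suc permutes_sing)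
      qed
      ultimately show ?thesis unfolding has_rank_def by (intro disjI2 exI[of _ 0]) simp
    qed
    then show ?thesis using True by (intro exI[of _ 0]) (auto simp: even_perms3_def)
  next
    case False
    obtain l m where lm: "\<And>p. 4 * l p + 4 * m p + 3 = DIM('e)"
      "\<And>p \<gamma>. \<gamma> \<in> {1, 2, 3} \<Longrightarrow> rank_data \<gamma> (l p) (m p) p"
      using rank_data_ex[OF False] by metis
    \<comment> \<open>One index suffices, because \<open>l\<close> and \<open>m\<close> are common
      to the three one-forms.\<close>
    have l: "{x. k \<le> l x} = {x. \<not> form_zero_at A (wedge_power (ext_d (\<eta> 1)) (2 * k + 1)) x}" for k
    proof (rule Collect_cong)
      fix x
      have d: "rank_data 1 (l x) (m x) x" by (rule lm(2)) simp
      show "k \<le> l x \<longleftrightarrow> \<not> form_zero_at A (wedge_power (ext_d (\<eta> 1)) (2 * k + 1)) x"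
      proof (cases "k \<le> l x")
        case True
        then show ?thesis using d unfolding rank_data_def by blast
      next
        case False
        then have "2 * l x + 1 < 2 * k + 1" by simp
        then show ?thesis using d False unfolding rank_data_def by blast
      qed
    qed
    have m: "{x. k \<le> m x} = {x. \<not> form_zero_at A (wedge_power (psi_form 1) (2 * k)) x}" for k
    proof (rule Collect_cong)
      fix x
      have d: "rank_data 1 (l x) (m x) x" by (rule lm(2)) simp
      show "k \<le> m x \<longleftrightarrow> \<not> form_zero_at A (wedge_power (psi_form 1) (2 * k)) x"
      proof (cases "k \<le> m x")
        case True
        then show ?thesis using d unfolding rank_data_def by blast
      next
        case False
        then have "2 * m x < 2 * k" by simp
        then show ?thesis using d False unfolding rank_data_def by blast
      qed
    qed
    have "l x = l y" for x y
    proof (rule connected_local_const[OF assms(2)])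
      show "\<forall>x\<in>UNIV. \<forall>\<^sub>F y in at x within UNIV. l x = l y"
      proof
        fix x
        \<comment> \<open>On this open set neither \<open>l\<close> nor \<open>m\<close> drops below
          its value at \<open>x\<close>. Their sum is fixed by the dimension, so neither can
          grow.\<close>
        have "open ({y. l x \<le> l y} \<inter> {y. m x \<le> m y})"
          unfolding l m by (intro open_Int open_wedge_power_nonzero ext_d_smooth) auto
        then have "\<forall>\<^sub>F y in nhds x. y \<in> {y. l x \<le> l y} \<inter> {y. m x \<le> m y}"
          by (rule eventually_nhds_in_open) simp
        then show "\<forall>\<^sub>F y in at x within UNIV. l x = l y"
          unfolding eventually_at_filter
        proof (rule eventually_mono)
          fix y assume "y \<in> {y. l x \<le> l y} \<inter> {y. m x \<le> m y}"
          then show "y \<noteq> x \<longrightarrow> y \<in> UNIV \<longrightarrow> l x = l y" using lm(1)[of x] lm(1)[of y] by auto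
        qed
      qed
    qed auto
    then obtain k where k: "\<And>x. l x = k" by metis
    have "k \<le> n" using lm(1)[of undefined] k assms(3) by simp
    \<comment> \<open>The odd case of the rank with exponent \<open>2 * k + 1\<close>: to the
      \<open>2 * k\<close> pairs from \<open>W\<close> the plane of the two other Reeb vectors adds
      one.\<close>
    moreover have "has_rank A (\<eta> \<gamma>) (4 * k + 3)" if "\<gamma> \<in> {1, 2, 3}" for \<gamma>
      unfolding has_rank_def
    proof (intro disjI2 exI[of _ "2 * k + 1"] conjI allI)
      show "4 * k + 3 = 2 * (2 * k + 1) + 1" by simp
      fix x
      show "\<not> form_zero_at A (wedge 1 (2 * (2 * k + 1)) (form_of_oneform (\<eta> \<gamma>))
          (wedge_power (ext_d (\<eta> \<gamma>)) (2 * k + 1))) x"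
        "form_zero_at A (wedge_power (ext_d (\<eta> \<gamma>)) (2 * k + 1 + 1)) x"
        using lm(2)[OF that, of x] unfolding rank_data_def k by auto
    qed
    ultimately show ?thesis using False by auto
  qed
qed

end
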